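(* Denote $\Omega^{(1,0)}_q(\mathbf{C}P^{N-1})=(\mathbf{C}_q[SU_N]\otimes V_+)^{U_{N-1}}$ and $\Omega^{(0,1)}_q(\mathbf{C}P^{N-1})=(\mathbf{C}_q[SU_N]\otimes V_-)^{U_{N-1}}$. Then there is a vector space decomposition $$\Omega^1_q(\mathbf{C}P^{N-1})=\Omega^{(1,0)}_q(\mathbf{C}P^{N-1})\oplus\Omega^{(0,1)}_q(\mathbf{C}P^{N-1}).$$
   Context: Algebras are unital over $\mathbf{C}$; Sweedler notation is used. Fix $N\ge 2$, $q\in(0,1]$, $\nu=q-q^{-1}$, and an $N$-th root $q^{1/N}$ of $q$. Let $H(x)=1$ for $x>0$ and $H(x)=0$ for $x\le 0$, and $R^{ik}_{jl}=q^{\delta_{ik}}\delta_{il}\delta_{kj}+\nu H(k-i)\delta_{ij}\delta_{kl}$. Quantum groups. For $n\ge1$, $\mathbf{C}_q[M_n]$ is the bialgebra generated by $u^i_j$ ($1\le i,j\le n$) with relations $\sum_{w,x}R^{ac}_{wx}u^w_bu^x_d=\sum_{y,z}R^{yz}_{bd}u^a_yu^c_z$, $\Delta(u^i_j)=\sum_k u^i_k\otimes u^k_j$, $\varepsilon(u^i_j)=\delta_{ij}$. The element $\det_n=\sum_{\pi\in S_n}(-q)^{\ell(\pi)}u^1_{\pi(1)}\cdots u^n_{\pi(n)}$ is central and grouplike. $\mathbf{C}_q[U_n]$ is the Hopf algebra obtained by adjoining $\det_n^{-1}$, and $\mathbf{C}_q[SU_n]=\mathbf{C}_q[M_n]/\langle\det_n-1\rangle$.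 Put $G=\mathbf{C}_q[SU_N]$, $G^+=\ker\varepsilon$. $\alpha_N:G\to\mathbf{C}_q[U_{N-1}]$ is the Hopf algebra map with $\alpha_N(u^1_1)=\det_{N-1}^{-1}$, $\alpha_N(u^1_i)=\alpha_N(u^i_1)=0$ ($i\ne1$), $\alpha_N(u^i_j)=u^{i-1}_{j-1}$ ($i,j\ge2$), and $M=\mathbf{C}_q[\mathbf{C}P^{N-1}]$ is the algebra of coinvariants of $(\mathrm{id}\otimes\alpha_N)\Delta$ on $G$. Calculus. $G$ is coquasi-triangular with $r$ determined by $r(u^i_j\otimes u^k_l)=q^{-1/N}R^{ki}_{jl}$, $r(fg\otimes h)=r(f\otimes h_{(1)})r(g\otimes h_{(2)})$, $r(f\otimes gh)=r(f_{(1)}\otimes h)r(f_{(2)}\otimes g)$. Define $Q:G\to M_N(\mathbf{C})$ by $Q_{kl}(h)=\mathcal{Q}(h\otimes u^k_l)$, $\mathcal{Q}(h\otimes g)=r(g_{(1)}\otimes h_{(1)})r(h_{(2)}\otimes g_{(2)})$. Let $I_{SU_N}=(\ker Q\cap G^+)+\mathrm{span}\{u^i_1S(u^1_i):2\le i\le N\}+\mathrm{span}\{u^i_j:2\le i,j\le N,\ i\ne j\}$, a right ideal of $G^+$, and $\Lambda^1_{SU_N}=G^+/I_{SU_N}$ with classes $\overline{v}$. The calculus $\Omega^1_q(SU_N)$ is $G\otimes\Lambda^1_{SU_N}$ with left multiplication on the first factor, $(g\otimes\overline{v})h=gh_{(1)}\otimes\overline{vh_{(2)}}$, $\mathrm{d}h=h_{(1)}\otimes\overline{h_{(2)}-\varepsilon(h_{(2)})1}$.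 Its restriction to $M$ is $\Omega^1_q(\mathbf{C}P^{N-1})=\mathrm{span}\{f\,\mathrm{d}g:f,g\in M\}\subseteq\Omega^1_q(SU_N)$. In $\Lambda^1_{SU_N}$ let $V_+=\mathrm{span}\{\overline{u^i_1}:2\le i\le N\}$ and $V_-=\mathrm{span}\{\overline{u^1_i}:2\le i\le N\}$. The space $V_{\mathbf{C}P^{N-1}}=(M\cap G^+)/(M\cap I_{SU_N})$ is identified with its image in $\Lambda^1_{SU_N}$, which is $V_+\oplus V_-$; it carries the right $\mathbf{C}_q[U_{N-1}]$-coaction $\overline{v}\mapsto\overline{v_{(2)}}\otimes S(\alpha_N(v_{(1)}))$ for $v\in M\cap G^+$. The superscript $U_{N-1}$ denotes coinvariants with respect to the tensor product of the coaction $(\mathrm{id}\otimes\alpha_N)\Delta$ on $G$ with this coaction; these are regarded as subspaces of $G\otimes\Lambda^1_{SU_N}=\Omega^1_q(SU_N)$. *)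

theory Defs
  imports Complex_Main "HOL-Library.Poly_Mapping" "HOL-Combinatorics.Permutations"
begin

section \<open>Complex vector spaces and unital complex algebras\<close>

class scaleC =
  fixes scaleC :: "complex \<Rightarrow> 'a \<Rightarrow> 'a" (infixr "*\<^sub>C" 75)

class complex_vector = scaleC + ab_group_add +
  assumes scaleC_add_right: "c *\<^sub>C (x + y) = c *\<^sub>C x + c *\<^sub>C y"
    and scaleC_add_left: "(c + d) *\<^sub>C x = c *\<^sub>C x + d *\<^sub>C x"
    and scaleC_scaleC: "c *\<^sub>C (d *\<^sub>C x) = (c * d) *\<^sub>C x"
    and scaleC_one: "1 *\<^sub>C x = x"

class complex_algebra_1 = complex_vector + ring_1 +
  assumes mult_scaleC_left: "(c *\<^sub>C x) * y = c *\<^sub>C (x * y)"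
    and mult_scaleC_right: "x * (c *\<^sub>C y) = c *\<^sub>C (x * y)"

global_interpretation cvec: vector_space "scaleC :: complex \<Rightarrow> 'a \<Rightarrow> 'a::complex_vector"
  by unfold_locales (simp_all add: scaleC_add_right scaleC_add_left scaleC_scaleC scaleC_one)

abbreviation cspan :: "'a::complex_vector set \<Rightarrow> 'a set"
  where "cspan \<equiv> cvec.span"

abbreviation csubspace :: "'a::complex_vector set \<Rightarrow> bool"
  where "csubspace \<equiv> cvec.subspace"

abbreviation clinear :: "('a::complex_vector \<Rightarrow> 'b::complex_vector) \<Rightarrow> bool"
  where "clinear \<equiv> Vector_Spaces.linear scaleC scaleC"

definition cbilinear :: "('a::complex_vector \<Rightarrow> 'b::complex_vector \<Rightarrow> 'c::complex_vector) \<Rightarrow> bool"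
  where "cbilinear b \<longleftrightarrow> (\<forall>x. clinear (b x)) \<and> (\<forall>y. clinear (\<lambda>x. b x y))"

text \<open>\<open>is_direct_sum W A B\<close>: the subspace \<open>W\<close> is the internal direct sum of \<open>A\<close> and \<open>B\<close>.\<close>

definition is_direct_sum :: "'a::complex_vector set \<Rightarrow> 'a set \<Rightarrow> 'a set \<Rightarrow> bool"
  where "is_direct_sum W A B \<longleftrightarrow>
    csubspace A \<and> csubspace B \<and> W = {a + b | a b. a \<in> A \<and> b \<in> B} \<and> A \<inter> B = {0}"

text \<open>
  \<open>is_quotient_map W I p\<close>: the restriction of \<open>p\<close> to the subspace \<open>W\<close> exhibits the codomain
  as the quotient space \<open>W / I\<close>. Since HOL functions are total, \<open>p\<close> is some linear extension
  of the quotient map to the whole space; its values outside \<open>W\<close> carry no information.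
\<close>

definition is_quotient_map ::
  "'a::complex_vector set \<Rightarrow> 'a set \<Rightarrow> ('a \<Rightarrow> 'b::complex_vector) \<Rightarrow> bool"
  where "is_quotient_map W I p \<longleftrightarrow> clinear p \<and> p ` W = UNIV \<and> {w \<in> W. p w = 0} = I"

instantiation complex :: complex_algebra_1
begin

definition scaleC_complex :: "complex \<Rightarrow> complex \<Rightarrow> complex"
  where "scaleC_complex c x = c * x"

instance
  by standard (simp_all add: scaleC_complex_def algebra_simps)

end

instantiation poly_mapping :: (type, complex_vector) complex_vector
begin

lift_definition scaleC_poly_mapping :: "complex \<Rightarrow> ('a \<Rightarrow>\<^sub>0 'b) \<Rightarrow> 'a \<Rightarrow>\<^sub>0 'b"
  is "\<lambda>c f k. c *\<^sub>C f k"
proof -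
  fix c and f :: "'a \<Rightarrow> 'b"
  assume "finite {k. f k \<noteq> 0}"
  then show "finite {k. c *\<^sub>C f k \<noteq> 0}"
    by (rule rev_finite_subset) auto
qed

instance
  by standard (transfer; simp add: fun_eq_iff scaleC_add_right scaleC_add_left scaleC_scaleC scaleC_one)+

end

lemma lookup_scaleC [simp]: "Poly_Mapping.lookup (c *\<^sub>C p) k = c *\<^sub>C Poly_Mapping.lookup p k"
  by transfer simp

lemma scaleC_Sum_any: "c *\<^sub>C Sum_any f = Sum_any (\<lambda>x. c *\<^sub>C (f x :: 'b::complex_vector))"
proof (cases "c = 0")
  case False
  then show ?thesis
    by (simp add: Sum_any.expand_set cvec.scale_sum_right)
qed simp

lemma scaleC_when: "c *\<^sub>C ((x :: 'b::complex_vector) when P) = (c *\<^sub>C x when P)"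
  by (simp add: when_def)

instance poly_mapping :: (monoid_add, complex_algebra_1) complex_algebra_1
proof
  fix c and p q :: "'a \<Rightarrow>\<^sub>0 'b"
  show "(c *\<^sub>C p) * q = c *\<^sub>C (p * q)"
    by transfer (simp add: prod_fun_def fun_eq_iff scaleC_Sum_any mult_scaleC_left)
  show "p * (c *\<^sub>C q) = c *\<^sub>C (p * q)"
    by transfer
      (simp add: prod_fun_def fun_eq_iff scaleC_Sum_any mult_scaleC_right flip: scaleC_when,
       simp add: mult_scaleC_right flip: scaleC_Sum_any)
qed

definition lincomb :: "('k \<Rightarrow> 'a::complex_vector) \<Rightarrow> ('k \<Rightarrow>\<^sub>0 complex) \<Rightarrow> 'a"
  where "lincomb f p = (\<Sum>k\<in>Poly_Mapping.keys p. Poly_Mapping.lookup p k *\<^sub>C f k)"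

lemma lincomb_superset:
  assumes "finite A" "Poly_Mapping.keys p \<subseteq> A"
  shows "lincomb f p = (\<Sum>k\<in>A. Poly_Mapping.lookup p k *\<^sub>C f k)"
  unfolding lincomb_def using assms
  by (intro sum.mono_neutral_left) (auto simp: in_keys_iff)

lemma clinear_lincomb: "clinear (lincomb (f :: 'k \<Rightarrow> 'a::complex_vector))"
proof (unfold_locales)
  fix p q :: "'k \<Rightarrow>\<^sub>0 complex" and c
  let ?A = "Poly_Mapping.keys p \<union> Poly_Mapping.keys q \<union> Poly_Mapping.keys (p + q) \<union> Poly_Mapping.keys (c *\<^sub>C p)"
  have fin: "finite ?A" by simp
  have e: "lincomb f s = (\<Sum>k\<in>?A. Poly_Mapping.lookup s k *\<^sub>C f k)"
    if "s \<in> {p, q, p + q, c *\<^sub>C p}" for s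
    using that by (intro lincomb_superset[OF fin]) auto
  show "lincomb f (p + q) = lincomb f p + lincomb f q"
    by (simp only: e insertI1 insertI2 lookup_add scaleC_add_left sum.distrib)
  show "lincomb f (c *\<^sub>C p) = c *\<^sub>C lincomb f p"
    by (simp only: e insertI1 insertI2 lookup_scaleC cvec.scale_sum_right scaleC_complex_def
        scaleC_scaleC)
qed

lemma lincomb_single [simp]: "lincomb f (Poly_Mapping.single k c) = c *\<^sub>C f k"
  by (cases "c = 0") (simp_all add: lincomb_def)


section \<open>The algebraic tensor product\<close>

definition tensor_null :: "('a::complex_vector \<times> 'b::complex_vector \<Rightarrow>\<^sub>0 complex) set"
  where "tensor_null = cspan
    ({Poly_Mapping.single (a + a', b) 1 - Poly_Mapping.single (a, b) 1
        - Poly_Mapping.single (a', b) 1 | a a' b. True} \<union>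
     {Poly_Mapping.single (a, b + b') 1 - Poly_Mapping.single (a, b) 1
        - Poly_Mapping.single (a, b') 1 | a b b'. True} \<union>
     {Poly_Mapping.single (c *\<^sub>C a, b) 1 - Poly_Mapping.single (a, b) c | a b c. True} \<union>
     {Poly_Mapping.single (a, c *\<^sub>C b) 1 - Poly_Mapping.single (a, b) c | a b c. True})"

lemma subspace_tensor_null: "csubspace tensor_null"
  unfolding tensor_null_def by (rule cvec.subspace_span)

quotient_type (overloaded) ('a, 'b) tensor =
  "'a::complex_vector \<times> 'b::complex_vector \<Rightarrow>\<^sub>0 complex" / "\<lambda>p q. p - q \<in> tensor_null"
proof (rule equivpI)
  show "reflp (\<lambda>p q. p - q \<in> tensor_null)"
    by (simp add: reflp_def cvec.subspace_0[OF subspace_tensor_null])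
  show "symp (\<lambda>p q. p - q \<in> tensor_null)"
    by (rule sympI, drule cvec.subspace_neg[OF subspace_tensor_null]) simp
  show "transp (\<lambda>p q. p - q \<in> tensor_null)"
    by (rule transpI, drule (1) cvec.subspace_add[OF subspace_tensor_null]) simp
qed

instantiation tensor :: (complex_vector, complex_vector) complex_vector
begin

lift_definition zero_tensor :: "('a, 'b) tensor" is 0 .

lift_definition plus_tensor :: "('a, 'b) tensor \<Rightarrow> ('a, 'b) tensor \<Rightarrow> ('a, 'b) tensor" is "(+)"
  by (drule (1) cvec.subspace_add[OF subspace_tensor_null]) (simp only: add_diff_add)

lift_definition uminus_tensor :: "('a, 'b) tensor \<Rightarrow> ('a, 'b) tensor" is uminus
  by (drule cvec.subspace_neg[OF subspace_tensor_null]) (simp add: minus_diff_commute)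

lift_definition minus_tensor :: "('a, 'b) tensor \<Rightarrow> ('a, 'b) tensor \<Rightarrow> ('a, 'b) tensor" is "(-)"
proof -
  fix p p' q q' :: "'a \<times> 'b \<Rightarrow>\<^sub>0 complex"
  assume "p - p' \<in> tensor_null" "q - q' \<in> tensor_null"
  then have "(p - p') - (q - q') \<in> tensor_null"
    by (rule cvec.subspace_diff[OF subspace_tensor_null])
  also have "(p - p') - (q - q') = (p - q) - (p' - q')"
    by (simp add: algebra_simps)
  finally show "(p - q) - (p' - q') \<in> tensor_null" .
qed

lift_definition scaleC_tensor :: "complex \<Rightarrow> ('a, 'b) tensor \<Rightarrow> ('a, 'b) tensor" is scaleC
  by (drule cvec.subspace_scale[OF subspace_tensor_null])
    (simp only: cvec.scale_right_diff_distrib)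

instance
  by standard
    (transfer; simp add: scaleC_add_right scaleC_add_left scaleC_scaleC scaleC_one ac_simps
       cvec.subspace_0[OF subspace_tensor_null])+

end

lift_definition tensor_of :: "'a::complex_vector \<Rightarrow> 'b::complex_vector \<Rightarrow> ('a, 'b) tensor"
    (infixl "\<otimes>" 72)
  is "\<lambda>a b. Poly_Mapping.single (a, b) 1" .

text \<open>
  \<open>tlift b\<close> is the linear map on the tensor product induced by a bilinear map \<open>b\<close>
  (see \<open>tlift_tensor\<close> below); in particular Sweedler's
  \<open>b h\<^sub>(\<^sub>1\<^sub>) h\<^sub>(\<^sub>2\<^sub>)\<close> is \<open>tlift b (\<Delta> h)\<close>. It is only meaningful for bilinear \<open>b\<close>.
\<close>

definition tlift :: "('a::complex_vector \<Rightarrow> 'b::complex_vector \<Rightarrow> 'c::complex_vector)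
    \<Rightarrow> ('a, 'b) tensor \<Rightarrow> 'c"
  where "tlift b t = lincomb (\<lambda>(x, y). b x y) (rep_tensor t)"

lemma lincomb_tensor_null:
  assumes b: "cbilinear b" and p: "p \<in> tensor_null"
  shows "lincomb (\<lambda>(x, y). b x y) p = 0"
proof -
  interpret L: Vector_Spaces.linear scaleC scaleC "lincomb (\<lambda>(x, y). b x y)"
    by (rule clinear_lincomb)
  have r: "b x (y + y') = b x y + b x y'" "b x (c *\<^sub>C y) = c *\<^sub>C b x y" for x y y' c
    using b by (auto simp: cbilinear_def Vector_Spaces.linear_iff)
  have l: "b (x + x') y = b x y + b x' y" "b (c *\<^sub>C x) y = c *\<^sub>C b x y" for x x' y c
    using b by (auto simp: cbilinear_def Vector_Spaces.linear_iff)
  show ?thesis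
    using p unfolding tensor_null_def
  proof (rule cvec.span_induct)
    show "csubspace {p. lincomb (\<lambda>(x, y). b x y) p = 0}"
      by (rule L.subspace_kernel)
  qed (auto simp: L.diff r l scaleC_one)
qed

lemma tlift_abs:
  assumes "cbilinear b"
  shows "tlift b (abs_tensor p) = lincomb (\<lambda>(x, y). b x y) p"
proof -
  interpret L: Vector_Spaces.linear scaleC scaleC "lincomb (\<lambda>(x, y). b x y)"
    by (rule clinear_lincomb)
  have "abs_tensor (rep_tensor (abs_tensor p)) = abs_tensor p"
    by (rule Quotient3_abs_rep[OF Quotient3_tensor])
  then have "rep_tensor (abs_tensor p) - p \<in> tensor_null"
    by (simp add: tensor.abs_eq_iff)
  from lincomb_tensor_null[OF assms this] show ?thesis
    by (simp add: tlift_def L.diff)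
qed

lemma tlift_tensor: "cbilinear b \<Longrightarrow> tlift b (x \<otimes> y) = b x y"
  by (simp add: tensor_of.abs_eq tlift_abs scaleC_one)

lemma clinear_tlift:
  assumes "cbilinear b"
  shows "clinear (tlift b)"
proof -
  interpret L: Vector_Spaces.linear scaleC scaleC "lincomb (\<lambda>(x, y). b x y)"
    by (rule clinear_lincomb)
  have "tlift b (s + t) = tlift b s + tlift b t" for s t
    by (induct s rule: tensor.abs_induct, induct t rule: tensor.abs_induct)
      (simp add: plus_tensor.abs_eq tlift_abs[OF assms] L.add)
  moreover have "tlift b (c *\<^sub>C t) = c *\<^sub>C tlift b t" for c t
    by (induct t rule: tensor.abs_induct)
      (simp add: scaleC_tensor.abs_eq tlift_abs[OF assms] L.scale)
  ultimately show ?thesis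
    by unfold_locales
qed

lemma cbilinear_tensor_of: "cbilinear (\<otimes>)"
proof -
  have gen: "abs_tensor p = abs_tensor q" if "p - q \<in> tensor_null" for p q :: "'a \<times> 'b \<Rightarrow>\<^sub>0 complex"
    using that by (simp add: tensor.abs_eq_iff)
  have "(a + a') \<otimes> b = a \<otimes> b + a' \<otimes> b" for a a' :: 'a and b :: 'b
    unfolding tensor_of.abs_eq plus_tensor.abs_eq
    by (rule gen, unfold tensor_null_def diff_diff_eq[symmetric], rule cvec.span_base) blast
  moreover have "a \<otimes> (b + b') = a \<otimes> b + a \<otimes> b'" for a :: 'a and b b' :: 'b
    unfolding tensor_of.abs_eq plus_tensor.abs_eq
    by (rule gen, unfold tensor_null_def diff_diff_eq[symmetric], rule cvec.span_base) blast
  moreover have sc: "c *\<^sub>C Poly_Mapping.single k (1::complex) = Poly_Mapping.single k c"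
    for c and k :: "'a \<times> 'b"
    by (rule poly_mapping_eqI) (simp add: lookup_single scaleC_complex_def when_def)
  have "(c *\<^sub>C a) \<otimes> b = c *\<^sub>C (a \<otimes> b)" for c and a :: 'a and b :: 'b
    unfolding tensor_of.abs_eq scaleC_tensor.abs_eq sc
    by (rule gen, unfold tensor_null_def, rule cvec.span_base) blast
  moreover have "a \<otimes> (c *\<^sub>C b) = c *\<^sub>C (a \<otimes> b)" for c and a :: 'a and b :: 'b
    unfolding tensor_of.abs_eq scaleC_tensor.abs_eq sc
    by (rule gen, unfold tensor_null_def, rule cvec.span_base) blast
  ultimately show ?thesis
    unfolding cbilinear_def by (simp add: Vector_Spaces.linear_iff cvec.vector_space_axioms)
qed

definition tmap :: "('a::complex_vector \<Rightarrow> 'c::complex_vector) \<Rightarrow>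
    ('b::complex_vector \<Rightarrow> 'd::complex_vector) \<Rightarrow> ('a, 'b) tensor \<Rightarrow> ('c, 'd) tensor"
  where "tmap f g = tlift (\<lambda>x y. f x \<otimes> g y)"

definition tassoc :: "(('a::complex_vector, 'b::complex_vector) tensor, 'c::complex_vector) tensor
    \<Rightarrow> ('a, ('b, 'c) tensor) tensor"
  where "tassoc = tlift (\<lambda>s z. tlift (\<lambda>x y. x \<otimes> (y \<otimes> z)) s)"

definition tmult :: "('a::complex_algebra_1, 'b::complex_algebra_1) tensor
    \<Rightarrow> ('a, 'b) tensor \<Rightarrow> ('a, 'b) tensor"
  where "tmult s t = tlift (\<lambda>a b. tlift (\<lambda>c d. (a * c) \<otimes> (b * d)) t) s"

text \<open>The image of \<open>A \<otimes> B\<close> in the tensor product of the ambient spaces.\<close>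

definition tensor_space :: "'a::complex_vector set \<Rightarrow> 'b::complex_vector set \<Rightarrow> ('a, 'b) tensor set"
  where "tensor_space A B = cspan {x \<otimes> y | x y. x \<in> A \<and> y \<in> B}"


section \<open>Algebras given by generators and relations\<close>

text \<open>Poly_Mapping multiplies by adding keys, so words carry concatenation as addition.\<close>

datatype 'x free_word = Word (letters: "'x list")

instantiation free_word :: (type) monoid_add
begin

definition zero_free_word :: "'a free_word"
  where "0 = Word []"

definition plus_free_word :: "'a free_word \<Rightarrow> 'a free_word \<Rightarrow> 'a free_word"
  where "v + w = Word (letters v @ letters w)"

instance
  by standard (simp_all add: zero_free_word_def plus_free_word_def)

end

type_synonym 'x free_algebra = "'x free_word \<Rightarrow>\<^sub>0 complex"

definition free_gen :: "'x \<Rightarrow> 'x free_algebra"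
  where "free_gen x = Poly_Mapping.single (Word [x]) 1"

definition free_algebra_on :: "'x set \<Rightarrow> 'x free_algebra set"
  where "free_algebra_on X = {p. \<forall>w\<in>Poly_Mapping.keys p. set (letters w) \<subseteq> X}"

definition free_eval :: "('x \<Rightarrow> 'a::complex_algebra_1) \<Rightarrow> 'x free_algebra \<Rightarrow> 'a"
  where "free_eval f = lincomb (\<lambda>w. prod_list (map f (letters w)))"

definition ideal_generated :: "'x set \<Rightarrow> 'x free_algebra set \<Rightarrow> 'x free_algebra set"
  where "ideal_generated X rels =
    cspan {a * r * b | a r b. a \<in> free_algebra_on X \<and> r \<in> rels \<and> b \<in> free_algebra_on X}"

text \<open>
  \<open>presented_by X rels f\<close>: the codomain of \<open>f\<close> is the algebra generated by the elements
  \<open>f x\<close> (\<open>x \<in> X\<close>) with defining relations \<open>r = 0\<close> (\<open>r \<in> rels\<close>), i.e. evaluation induces an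
  isomorphism from the free algebra on \<open>X\<close> modulo the two-sided ideal generated by \<open>rels\<close>.
\<close>

definition presented_by ::
  "'x set \<Rightarrow> 'x free_algebra set \<Rightarrow> ('x \<Rightarrow> 'a::complex_algebra_1) \<Rightarrow> bool"
  where "presented_by X rels f \<longleftrightarrow>
    free_eval f ` free_algebra_on X = UNIV \<and>
    {p \<in> free_algebra_on X. free_eval f p = 0} = ideal_generated X rels"


section \<open>Hopf algebras and coquasi-triangular structures\<close>

locale hopf_algebra =
  fixes cop :: "'h::complex_algebra_1 \<Rightarrow> ('h, 'h) tensor"
    and eps :: "'h \<Rightarrow> complex"
    and ant :: "'h \<Rightarrow> 'h"
  assumes cop_linear: "clinear cop"
    and eps_linear: "clinear eps"
    and ant_linear: "clinear ant"
    and coassoc: "tassoc (tmap cop id (cop h)) = tmap id cop (cop h)"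
    and counit_left: "tlift (\<lambda>h1 h2. eps h1 *\<^sub>C h2) (cop h) = h"
    and counit_right: "tlift (\<lambda>h1 h2. eps h2 *\<^sub>C h1) (cop h) = h"
    and cop_one: "cop 1 = 1 \<otimes> 1"
    and cop_mult: "cop (g * h) = tmult (cop g) (cop h)"
    and eps_one: "eps 1 = 1"
    and eps_mult: "eps (g * h) = eps g * eps h"
    and antipode_left: "tlift (\<lambda>h1 h2. ant h1 * h2) (cop h) = eps h *\<^sub>C 1"
    and antipode_right: "tlift (\<lambda>h1 h2. h1 * ant h2) (cop h) = eps h *\<^sub>C 1"

locale hopf_algebra_hom =
  dom: hopf_algebra cop eps ant + cod: hopf_algebra cop' eps' ant'
  for cop :: "'h::complex_algebra_1 \<Rightarrow> ('h, 'h) tensor" and eps ant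
    and cop' :: "'k::complex_algebra_1 \<Rightarrow> ('k, 'k) tensor" and eps' ant' +
  fixes \<phi> :: "'h \<Rightarrow> 'k"
  assumes hom_linear: "clinear \<phi>"
    and hom_one: "\<phi> 1 = 1"
    and hom_mult: "\<phi> (g * h) = \<phi> g * \<phi> h"
    and hom_cop: "cop' (\<phi> h) = tmap \<phi> \<phi> (cop h)"
    and hom_eps: "eps' (\<phi> h) = eps h"
    and hom_ant: "ant' (\<phi> h) = \<phi> (ant h)"

text \<open>The functional \<open>r\<close> on \<open>H \<otimes> H\<close> is given as a bilinear form, \<open>r f g = r(f \<otimes> g)\<close>.\<close>

locale coquasi_triangular = hopf_algebra cop eps ant
  for cop :: "'h::complex_algebra_1 \<Rightarrow> ('h, 'h) tensor" and eps ant +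
  fixes r :: "'h \<Rightarrow> 'h \<Rightarrow> complex"
  assumes r_bilinear: "cbilinear r"
    and r_invertible: "\<exists>r'. cbilinear r' \<and>
      (\<forall>f g. tlift (\<lambda>f1 f2. tlift (\<lambda>g1 g2. r f1 g1 * r' f2 g2) (cop g)) (cop f) = eps f * eps g) \<and>
      (\<forall>f g. tlift (\<lambda>f1 f2. tlift (\<lambda>g1 g2. r' f1 g1 * r f2 g2) (cop g)) (cop f) = eps f * eps g)"
    and r_quasi_commutative:
      "tlift (\<lambda>f1 f2. tlift (\<lambda>g1 g2. r f1 g1 *\<^sub>C (f2 * g2)) (cop g)) (cop f) =
       tlift (\<lambda>f1 f2. tlift (\<lambda>g1 g2. r f2 g2 *\<^sub>C (g1 * f1)) (cop g)) (cop f)"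
    and r_mult_left: "r (f * g) h = tlift (\<lambda>h1 h2. r f h1 * r g h2) (cop h)"
    and r_mult_right: "r f (g * h) = tlift (\<lambda>f1 f2. r f1 h * r f2 g) (cop f)"


section \<open>The quantum groups\<close>

text \<open>\<open>rmat q i k j l\<close> is \<open>R\<^sup>i\<^sup>k\<^sub>j\<^sub>l\<close>.\<close>

definition rmat :: "real \<Rightarrow> nat \<Rightarrow> nat \<Rightarrow> nat \<Rightarrow> nat \<Rightarrow> complex"
  where "rmat q i k j l =
    (if i = k then of_real q else 1) * (if i = l then 1 else 0) * (if k = j then 1 else 0)
    + of_real (q - inverse q) *
      (if k > i then 1 else 0) * (if i = j then 1 else 0) * (if k = l then 1 else 0)"

definition inv_count :: "nat \<Rightarrow> (nat \<Rightarrow> nat) \<Rightarrow> nat"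
  where "inv_count n \<pi> = card {(i, j). 1 \<le> i \<and> i < j \<and> j \<le> n \<and> \<pi> j < \<pi> i}"

definition qdet :: "real \<Rightarrow> nat \<Rightarrow> (nat \<Rightarrow> nat \<Rightarrow> 'a::complex_algebra_1) \<Rightarrow> 'a"
  where "qdet q n x = (\<Sum>\<pi> | \<pi> permutes {1..n}.
    of_real ((- q) ^ inv_count n \<pi>) *\<^sub>C prod_list (map (\<lambda>i. x i (\<pi> i)) [1..<Suc n]))"

datatype qgen = U nat nat | DetInv

abbreviation fU :: "nat \<Rightarrow> nat \<Rightarrow> qgen free_algebra"
  where "fU i j \<equiv> free_gen (U i j)"

definition mat_gens :: "nat \<Rightarrow> qgen set"
  where "mat_gens n = {U i j | i j. i \<in> {1..n} \<and> j \<in> {1..n}}"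

definition rtt_rels :: "real \<Rightarrow> nat \<Rightarrow> qgen free_algebra set"
  where "rtt_rels q n =
    {(\<Sum>w\<in>{1..n}. \<Sum>x\<in>{1..n}. rmat q a c w x *\<^sub>C (fU w b * fU x d))
      - (\<Sum>y\<in>{1..n}. \<Sum>z\<in>{1..n}. rmat q y z b d *\<^sub>C (fU a y * fU c z))
     | a b c d. a \<in> {1..n} \<and> b \<in> {1..n} \<and> c \<in> {1..n} \<and> d \<in> {1..n}}"

definition presents_SU :: "real \<Rightarrow> nat \<Rightarrow> (nat \<Rightarrow> nat \<Rightarrow> 'a::complex_algebra_1) \<Rightarrow> bool"
  where "presents_SU q n u \<longleftrightarrow>
    presented_by (mat_gens n) (rtt_rels q n \<union> {qdet q n fU - 1}) (case_qgen u 0)"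

text \<open>The inverse \<open>t\<close> of \<open>det\<^sub>n\<close> is adjoined as a two-sided inverse of a central element,
  so that it is central as well.\<close>

definition presents_U ::
  "real \<Rightarrow> nat \<Rightarrow> (nat \<Rightarrow> nat \<Rightarrow> 'a::complex_algebra_1) \<Rightarrow> 'a \<Rightarrow> bool"
  where "presents_U q n u t \<longleftrightarrow>
    presented_by (insert DetInv (mat_gens n))
      (rtt_rels q n \<union> {qdet q n fU * free_gen DetInv - 1, free_gen DetInv * qdet q n fU - 1})
      (case_qgen u t)"

definition matrix_coalgebra :: "nat \<Rightarrow> (nat \<Rightarrow> nat \<Rightarrow> 'h::complex_algebra_1) \<Rightarrow>
    ('h \<Rightarrow> ('h, 'h) tensor) \<Rightarrow> ('h \<Rightarrow> complex) \<Rightarrow> bool"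
  where "matrix_coalgebra n u cop eps \<longleftrightarrow>
    (\<forall>i\<in>{1..n}. \<forall>j\<in>{1..n}.
      cop (u i j) = (\<Sum>k\<in>{1..n}. u i k \<otimes> u k j) \<and> eps (u i j) = (if i = j then 1 else 0))"

definition augmentation_ideal :: "('h \<Rightarrow> complex) \<Rightarrow> 'h set"
  where "augmentation_ideal eps = {h. eps h = 0}"

text \<open>The coinvariants of the right coaction \<open>(id \<otimes> \<alpha>) \<Delta>\<close>.\<close>

definition coinvariant_algebra :: "('g::complex_algebra_1 \<Rightarrow> ('g, 'g) tensor) \<Rightarrow>
    ('g \<Rightarrow> 'k::complex_algebra_1) \<Rightarrow> 'g set"
  where "coinvariant_algebra cop \<alpha> = {g. tmap id \<alpha> (cop g) = g \<otimes> 1}"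


section \<open>The differential calculus\<close>

definition Q_form :: "('g::complex_algebra_1 \<Rightarrow> ('g, 'g) tensor) \<Rightarrow> ('g \<Rightarrow> 'g \<Rightarrow> complex)
    \<Rightarrow> 'g \<Rightarrow> 'g \<Rightarrow> complex"
  where "Q_form cop r h g =
    tlift (\<lambda>g1 g2. tlift (\<lambda>h1 h2. r g1 h1 * r h2 g2) (cop h)) (cop g)"

definition ker_Q :: "nat \<Rightarrow> (nat \<Rightarrow> nat \<Rightarrow> 'g::complex_algebra_1) \<Rightarrow>
    ('g \<Rightarrow> ('g, 'g) tensor) \<Rightarrow> ('g \<Rightarrow> 'g \<Rightarrow> complex) \<Rightarrow> 'g set"
  where "ker_Q N u cop r = {h. \<forall>k\<in>{1..N}. \<forall>l\<in>{1..N}. Q_form cop r h (u k l) = 0}"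

definition ideal_SU :: "nat \<Rightarrow> (nat \<Rightarrow> nat \<Rightarrow> 'g::complex_algebra_1) \<Rightarrow>
    ('g \<Rightarrow> ('g, 'g) tensor) \<Rightarrow> ('g \<Rightarrow> complex) \<Rightarrow> ('g \<Rightarrow> 'g) \<Rightarrow> ('g \<Rightarrow> 'g \<Rightarrow> complex) \<Rightarrow> 'g set"
  where "ideal_SU N u cop eps ant r =
    {a + b + c | a b c.
      a \<in> ker_Q N u cop r \<inter> augmentation_ideal eps \<and>
      b \<in> cspan {u i 1 * ant (u 1 i) | i. i \<in> {2..N}} \<and>
      c \<in> cspan {u i j | i j. i \<in> {2..N} \<and> j \<in> {2..N} \<and> i \<noteq> j}}"

text \<open>
  In the following, \<open>cls\<close> is the class map from the augmentation ideal \<open>G\<^sup>+\<close> onto \<open>\<Lambda>\<^sup>1\<close>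
  (see \<open>is_quotient_map\<close>), the type \<open>'l\<close> being \<open>\<Lambda>\<^sup>1\<close>, and \<open>\<Omega>\<^sup>1\<^sub>q(SU\<^sub>N)\<close> is the type
  \<open>('g, 'l) tensor\<close>. The right \<open>G\<close>-action of the calculus does not enter the span of the
  forms \<open>f dg\<close>.
\<close>

definition left_mult :: "'g::complex_algebra_1 \<Rightarrow> ('g, 'l::complex_vector) tensor \<Rightarrow> ('g, 'l) tensor"
  where "left_mult f = tmap (\<lambda>g. f * g) id"

definition differential :: "('g::complex_algebra_1 \<Rightarrow> ('g, 'g) tensor) \<Rightarrow> ('g \<Rightarrow> complex) \<Rightarrow>
    ('g \<Rightarrow> 'l::complex_vector) \<Rightarrow> 'g \<Rightarrow> ('g, 'l) tensor"
  where "differential cop eps cls h = tlift (\<lambda>h1 h2. h1 \<otimes> cls (h2 - eps h2 *\<^sub>C 1)) (cop h)"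

definition Omega_CP :: "('g::complex_algebra_1 \<Rightarrow> ('g, 'g) tensor) \<Rightarrow> ('g \<Rightarrow> complex) \<Rightarrow>
    ('g \<Rightarrow> 'k::complex_algebra_1) \<Rightarrow> ('g \<Rightarrow> 'l::complex_vector) \<Rightarrow> ('g, 'l) tensor set"
  where "Omega_CP cop eps \<alpha> cls = cspan {left_mult f (differential cop eps cls g) | f g.
    f \<in> coinvariant_algebra cop \<alpha> \<and> g \<in> coinvariant_algebra cop \<alpha>}"

definition V_plus :: "nat \<Rightarrow> (nat \<Rightarrow> nat \<Rightarrow> 'g) \<Rightarrow> ('g \<Rightarrow> 'l::complex_vector) \<Rightarrow> 'l set"
  where "V_plus N u cls = cspan {cls (u i 1) | i. i \<in> {2..N}}"

definition V_minus :: "nat \<Rightarrow> (nat \<Rightarrow> nat \<Rightarrow> 'g) \<Rightarrow> ('g \<Rightarrow> 'l::complex_vector) \<Rightarrow> 'l set"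
  where "V_minus N u cls = cspan {cls (u 1 i) | i. i \<in> {2..N}}"

text \<open>
  With \<open>M\<close> the coinvariant algebra, \<open>V\<^sub>C\<^sub>P\<close> is the image of \<open>M \<inter> G\<^sup>+\<close> under \<open>cls\<close>, and \<open>is_V_coaction\<close> says that \<open>\<delta>\<close>
  restricts on it to the coaction sending the class of \<open>v\<close> to
  (class of \<open>v\<^sub>(\<^sub>2\<^sub>)\<close>) \<open>\<otimes> S(\<alpha>(v\<^sub>(\<^sub>1\<^sub>)))\<close>. As for quotient maps, \<open>\<delta>\<close> is an arbitrary linear
  extension, irrelevant outside \<open>V\<^sub>C\<^sub>P\<close>. For \<open>v \<in> M \<inter> G\<^sup>+\<close> one has
  \<open>\<alpha>(v\<^sub>(\<^sub>1\<^sub>)) \<otimes> v\<^sub>(\<^sub>2\<^sub>) \<in> \<C>\<^sub>q[U] \<otimes> (M \<inter> G\<^sup>+)\<close>, so only classes of elements of \<open>G\<^sup>+\<close> enter.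
\<close>

definition is_V_coaction :: "('g::complex_algebra_1 \<Rightarrow> ('g, 'g) tensor) \<Rightarrow> ('g \<Rightarrow> complex) \<Rightarrow>
    ('k \<Rightarrow> 'k) \<Rightarrow> ('g \<Rightarrow> 'k::complex_algebra_1) \<Rightarrow> ('g \<Rightarrow> 'l::complex_vector) \<Rightarrow>
    ('l \<Rightarrow> ('l, 'k) tensor) \<Rightarrow> bool"
  where "is_V_coaction cop eps antU \<alpha> cls \<delta> \<longleftrightarrow> clinear \<delta> \<and>
    (\<forall>v \<in> coinvariant_algebra cop \<alpha> \<inter> augmentation_ideal eps.
      \<delta> (cls v) = tlift (\<lambda>v1 v2. cls v2 \<otimes> antU (\<alpha> v1)) (cop v))"

text \<open>The tensor product coaction
  \<open>g \<otimes> x \<mapsto> g\<^sub>(\<^sub>1\<^sub>) \<otimes> x\<^sub>(\<^sub>0\<^sub>) \<otimes> \<alpha>(g\<^sub>(\<^sub>2\<^sub>)) x\<^sub>(\<^sub>1\<^sub>)\<close>.\<close>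

definition tensor_coaction :: "('g::complex_algebra_1 \<Rightarrow> ('g, 'g) tensor) \<Rightarrow>
    ('g \<Rightarrow> 'k::complex_algebra_1) \<Rightarrow> ('l::complex_vector \<Rightarrow> ('l, 'k) tensor) \<Rightarrow>
    ('g, 'l) tensor \<Rightarrow> (('g, 'l) tensor, 'k) tensor"
  where "tensor_coaction cop \<alpha> \<delta> = tlift (\<lambda>g x.
    tlift (\<lambda>g1 g2. tlift (\<lambda>x0 x1. (g1 \<otimes> x0) \<otimes> (\<alpha> g2 * x1)) (\<delta> x)) (cop g))"

text \<open>\<open>(G \<otimes> V)\<^sup>U\<close> for a subspace \<open>V\<close> of \<open>V\<^sub>C\<^sub>P\<close>.\<close>

definition coinvariant_forms :: "('g::complex_algebra_1 \<Rightarrow> ('g, 'g) tensor) \<Rightarrow>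
    ('g \<Rightarrow> 'k::complex_algebra_1) \<Rightarrow> ('l::complex_vector \<Rightarrow> ('l, 'k) tensor) \<Rightarrow>
    'l set \<Rightarrow> ('g, 'l) tensor set"
  where "coinvariant_forms cop \<alpha> \<delta> V =
    {t \<in> tensor_space UNIV V. tensor_coaction cop \<alpha> \<delta> t = t \<otimes> 1}"

end

theory Submission
  imports Defs
begin

text \<open>
  The calculus on the quantum group is governed by the functionals \<open>Q\<^sub>k\<^sub>l\<close>, whose values on the
  generators \<open>u\<^sup>i\<^sub>j\<close> and on the coinvariants \<open>z\<^sub>a\<^sub>b = u\<^sup>a\<^sub>1 S(u\<^sup>1\<^sub>b)\<close> follow from the Hecke relation and
  the triangularity of the R-matrix: for \<open>q \<noteq> 1\<close> each \<open>z\<^sub>a\<^sub>b\<close> other than \<open>z\<^sub>1\<^sub>1\<close> is sent by \<open>Q\<close> to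
  a nonzero multiple of a matrix unit, and \<open>Q\<^sub>1\<^sub>1\<close> agrees with the counit on coinvariants. Hence the
  class of any coinvariant in the augmentation ideal is a combination of the classes \<open>e\<^sub>p\<close> of the \<open>z\<^sub>a\<^sub>1\<close> and \<open>z\<^sub>1\<^sub>b\<close>, which are linearly independent and
  span \<open>V\<^sub>+\<close> and \<open>V\<^sub>-\<close>. Coinvariance of \<open>\<Sum> g\<^sub>p \<otimes> e\<^sub>p\<close> becomes a system of equations on the
  coefficients that is block diagonal with respect to \<open>V\<^sub>+\<close> and \<open>V\<^sub>-\<close>, and a solution yields
  explicit coinvariants \<open>f\<^sub>l\<close> with \<open>\<Sum> f\<^sub>l dz\<^sub>l = \<Sum> g\<^sub>p \<otimes> e\<^sub>p\<close>, without recourse to a Haar functional.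
\<close>

section \<open>Linear maps and tensor products\<close>

text \<open>The difficulty is that classes in \<open>\<Lambda>\<^sup>1\<close> can be computed only
  through Q, while the coaction \<open>\<delta>\<close> is prescribed only on classes of
  coinvariants. The elements \<open>u i 1\<close> and \<open>u 1 i\<close> that define
  \<open>V_plus\<close> and \<open>V_minus\<close> are not coinvariant, but Q sends them to
  multiples of the same matrix units as \<open>z (i, 1)\<close> and \<open>z (1, i)\<close>, so the
  two families of classes are proportional. The remaining z vanish in the quotient for two reasons:
  \<open>z (i, i)\<close> lies in the ideal outright, and for distinct a, b above 1 the ideal
  contains \<open>u a b\<close>, which shares its matrix unit with \<open>z (a, b)\<close>. The
  matrix units of the z miss only the entry (1,1), which the counit controls on coinvariants. All
  this divides by \<open>\<nu>\<close>, hence the separate case \<open>q = 1\<close>, where Q is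
  scalar. Averaging is avoidable because the z form one column of a matrix corepresentation y whose
  inverse matrix \<open>antG (y p l)\<close> has its coefficients in G: multiplying the coefficients
  of a coinvariant form by this inverse cancels their transformation under the coaction.\<close>

named_theorems linear_rules

lemma clinear_iff:
  "clinear f \<longleftrightarrow> (\<forall>x y. f (x + y) = f x + f y) \<and> (\<forall>c x. f (c *\<^sub>C x) = c *\<^sub>C f x)"
  by (simp add: Vector_Spaces.linear_iff cvec.vector_space_axioms)

lemma clinearI:
  assumes "\<And>x y. f (x + y) = f x + f y" "\<And>c x. f (c *\<^sub>C x) = c *\<^sub>C f x"
  shows "clinear f"
  using assms by (simp add: clinear_iff)

lemma clinear_add: "clinear f \<Longrightarrow> f (x + y) = f x + f y"
  and clinear_scale: "clinear f \<Longrightarrow> f (c *\<^sub>C x) = c *\<^sub>C f x"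
  by (simp_all add: clinear_iff)

lemma clinear_0: "clinear f \<Longrightarrow> f 0 = 0"
  using clinear_scale[of f 0 0] by simp

lemma clinear_diff: "clinear f \<Longrightarrow> f (x - y) = f x - f y"
  using clinear_add[of f "x - y" y] by (simp add: algebra_simps)

lemma clinear_sum: "clinear f \<Longrightarrow> f (\<Sum>i\<in>A. g i) = (\<Sum>i\<in>A. f (g i))"
  by (induction A rule: infinite_finite_induct) (simp_all add: clinear_0 clinear_add)

lemma cbilinearI:
  assumes "\<And>x. clinear (b x)" "\<And>y. clinear (\<lambda>x. b x y)"
  shows "cbilinear b"
  using assms by (simp add: cbilinear_def)

lemma clinear_compose: "clinear g \<Longrightarrow> clinear f \<Longrightarrow> clinear (\<lambda>x. g (f x))"
  by (simp add: clinear_iff)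

lemma clinear_bilinear_left: "cbilinear b \<Longrightarrow> clinear f \<Longrightarrow> clinear (\<lambda>x. b (f x) y)"
  by (simp add: clinear_iff cbilinear_def)

lemma clinear_bilinear_right: "cbilinear b \<Longrightarrow> clinear f \<Longrightarrow> clinear (\<lambda>x. b y (f x))"
  by (simp add: clinear_iff cbilinear_def)

lemma clinear_ident [linear_rules]: "clinear (\<lambda>x. x)"
  and clinear_id [linear_rules]: "clinear id"
  and clinear_zero [linear_rules]: "clinear (\<lambda>x. 0)"
  by (simp_all add: clinear_iff)

lemma clinear_plus [linear_rules]: "clinear f \<Longrightarrow> clinear g \<Longrightarrow> clinear (\<lambda>x. f x + g x)"
  and clinear_minus [linear_rules]: "clinear f \<Longrightarrow> clinear g \<Longrightarrow> clinear (\<lambda>x. f x - g x)"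
  by (simp_all add: clinear_iff algebra_simps cvec.scale_right_distrib cvec.scale_right_diff_distrib)

lemma clinear_Sum [linear_rules]:
  "(\<And>i. i \<in> A \<Longrightarrow> clinear (f i)) \<Longrightarrow> clinear (\<lambda>x. \<Sum>i\<in>A. f i x)"
  by (simp add: clinear_iff sum.distrib cvec.scale_sum_right)

lemma clinear_scaleC_right [linear_rules]: "clinear f \<Longrightarrow> clinear (\<lambda>x. c *\<^sub>C f x)"
  by (simp add: clinear_iff scaleC_scaleC scaleC_add_right mult.commute)

lemma clinear_scaleC_left [linear_rules]: "clinear f \<Longrightarrow> clinear (\<lambda>x. f x *\<^sub>C v)"
  by (simp add: clinear_iff scaleC_scaleC scaleC_add_left scaleC_complex_def)

lemma clinear_mult_left [linear_rules]: "clinear f \<Longrightarrow> clinear (\<lambda>x. f x * (y::'a::complex_algebra_1))"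
  and clinear_mult_right [linear_rules]: "clinear f \<Longrightarrow> clinear (\<lambda>x. (y::'a::complex_algebra_1) * f x)"
  by (simp_all add: clinear_iff algebra_simps mult_scaleC_left mult_scaleC_right)

lemmas clinear_tensor_left [linear_rules] = clinear_bilinear_left[OF cbilinear_tensor_of]
  and clinear_tensor_right [linear_rules] = clinear_bilinear_right[OF cbilinear_tensor_of]

lemma tensor_add_left: "(a + a') \<otimes> b = a \<otimes> b + a' \<otimes> b"
  and tensor_add_right: "a \<otimes> (b + b') = a \<otimes> b + a \<otimes> b'"
  and tensor_diff_right: "a \<otimes> (b - b') = a \<otimes> b - a \<otimes> b'"
  and tensor_scaleC_left: "(c *\<^sub>C a) \<otimes> b = c *\<^sub>C (a \<otimes> b)"
  and tensor_scaleC_right: "a \<otimes> (c *\<^sub>C b) = c *\<^sub>C (a \<otimes> b)"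
  and tensor_zero_left [simp]: "0 \<otimes> b = 0"
  and tensor_zero_right [simp]: "a \<otimes> 0 = 0"
  and tensor_sum_left: "(\<Sum>i\<in>A. g i) \<otimes> b = (\<Sum>i\<in>A. g i \<otimes> b)"
  and tensor_sum_right: "a \<otimes> (\<Sum>i\<in>A. h i) = (\<Sum>i\<in>A. a \<otimes> h i)"
proof -
  have l: "clinear (\<lambda>x. x \<otimes> b)" and r: "clinear (\<lambda>x. a \<otimes> x)"
    by (rule linear_rules clinear_ident)+
  show "(a + a') \<otimes> b = a \<otimes> b + a' \<otimes> b" "(c *\<^sub>C a) \<otimes> b = c *\<^sub>C (a \<otimes> b)" "0 \<otimes> b = 0"
    "(\<Sum>i\<in>A. g i) \<otimes> b = (\<Sum>i\<in>A. g i \<otimes> b)"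
    using clinear_add[OF l] clinear_scale[OF l] clinear_0[OF l] clinear_sum[OF l] by simp_all
  show "a \<otimes> (b + b') = a \<otimes> b + a \<otimes> b'" "a \<otimes> (c *\<^sub>C b) = c *\<^sub>C (a \<otimes> b)" "a \<otimes> 0 = 0"
    "a \<otimes> (b - b') = a \<otimes> b - a \<otimes> b'" "a \<otimes> (\<Sum>i\<in>A. h i) = (\<Sum>i\<in>A. a \<otimes> h i)"
    using clinear_add[OF r] clinear_scale[OF r] clinear_0[OF r] clinear_diff[OF r] clinear_sum[OF r]
    by simp_all
qed

section \<open>Induction on tensors and linearity of the induced maps\<close>

lemma poly_mapping_single_add_induct [case_names single add]:
  assumes single: "\<And>k c. P (Poly_Mapping.single k c)" and add: "\<And>p q. P p \<Longrightarrow> P q \<Longrightarrow> P (p + q)"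
  shows "P (p :: 'k \<Rightarrow>\<^sub>0 'b::comm_monoid_add)"
proof -
  have "P (\<Sum>k\<in>K. Poly_Mapping.single k (Poly_Mapping.lookup p k))" for K
    by (induction K rule: infinite_finite_induct) (use single[of undefined 0] in \<open>simp_all add: single add\<close>)
  moreover have "(\<Sum>k\<in>Poly_Mapping.keys p. Poly_Mapping.single k (Poly_Mapping.lookup p k)) = p"
    by (rule poly_mapping_eqI) (simp add: lookup_sum lookup_single when_def in_keys_iff)
  ultimately show "P p" by metis
qed

lemma tensor_induct [case_names pure add]:
  assumes pure: "\<And>a b. P (a \<otimes> b)" and add: "\<And>s t. P s \<Longrightarrow> P t \<Longrightarrow> P (s + t)"
  shows "P t"
proof (induct t rule: tensor.abs_induct)
  fix p :: "'a \<times> 'b \<Rightarrow>\<^sub>0 complex"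
  show "P (abs_tensor p)"
  proof (induct p rule: poly_mapping_single_add_induct)
    case (single k c)
    obtain a b where k: "k = (a, b)" by (cases k)
    have "Poly_Mapping.single k c = c *\<^sub>C Poly_Mapping.single k 1"
      by (rule poly_mapping_eqI) (simp add: lookup_single scaleC_complex_def when_def)
    then have "abs_tensor (Poly_Mapping.single k c) = c *\<^sub>C (a \<otimes> b)"
      by (simp add: k tensor_of.abs_eq scaleC_tensor.abs_eq)
    then show ?case
      by (metis pure tensor_scaleC_left)
  qed (metis add plus_tensor.abs_eq)
qed

lemma clinear_tensor_eqI:
  assumes "clinear F" "clinear G" "\<And>a b. F (a \<otimes> b) = G (a \<otimes> b)"
  shows "F t = G t"
  by (induct t rule: tensor_induct) (simp_all add: assms clinear_add)

lemma clinear_tlift_arg [linear_rules]: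
  "cbilinear b \<Longrightarrow> clinear f \<Longrightarrow> clinear (\<lambda>x. tlift b (f x))"
  by (rule clinear_compose[OF clinear_tlift])

lemma clinear_tlift_fun [linear_rules]:
  assumes b: "\<And>x. cbilinear (b x)" and l: "\<And>a c. clinear (\<lambda>x. b x a c)"
  shows "clinear (\<lambda>x. tlift (b x) t)"
proof (induct t rule: tensor_induct)
  case (pure a c)
  then show ?case using l by (simp add: tlift_tensor[OF b])
next
  case (add s t)
  then show ?case by (simp add: clinear_add[OF clinear_tlift[OF b]] clinear_plus)
qed

lemma clinear_comp_tlift:
  assumes "clinear f" "cbilinear b"
  shows "f (tlift b t) = tlift (\<lambda>x y. f (b x y)) t"
proof -
  have b': "cbilinear (\<lambda>x y. f (b x y))"
    using assms by (simp add: cbilinear_def clinear_iff)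
  show ?thesis
    by (rule clinear_tensor_eqI[where F = "\<lambda>t. f (tlift b t)"])
      (simp_all add: assms clinear_compose clinear_tlift[OF b'] clinear_tlift tlift_tensor[OF b'] tlift_tensor)
qed

lemmas bilinear_rules = cbilinearI linear_rules

lemma clinear_tmap [linear_rules]:
  assumes "clinear f" "clinear g" "clinear k"
  shows "clinear (\<lambda>x. tmap f g (k x))"
  unfolding tmap_def using assms(3)
  by (intro bilinear_rules assms(1,2)) auto

lemma tmap_tensor: "clinear f \<Longrightarrow> clinear g \<Longrightarrow> tmap f g (a \<otimes> b) = f a \<otimes> g b"
  unfolding tmap_def by (subst tlift_tensor) (auto intro!: bilinear_rules)

lemma tlift_tmap:
  assumes "cbilinear b" "clinear f" "clinear g"
  shows "tlift b (tmap f g t) = tlift (\<lambda>x y. b (f x) (g y)) t"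
proof -
  have b': "cbilinear (\<lambda>x y. b (f x) (g y))"
    using assms by (simp add: cbilinear_def clinear_iff)
  show ?thesis
    by (rule clinear_tensor_eqI[where F = "\<lambda>t. tlift b (tmap f g t)"])
      (use assms in \<open>simp_all add: clinear_tlift[OF b'] clinear_tlift_arg clinear_tmap clinear_ident
        tlift_tensor[OF b'] tlift_tensor[OF assms(1)] tmap_tensor\<close>)
qed

section \<open>The tensor product of two unital algebras as a ring\<close>

lemma exists_functional:
  fixes v :: "'a::complex_vector"
  assumes "v \<noteq> 0"
  shows "\<exists>f :: 'a \<Rightarrow> complex. clinear f \<and> f v = 1"
proof -
  interpret P: vector_space_pair "scaleC :: complex \<Rightarrow> 'a \<Rightarrow> 'a" "scaleC :: complex \<Rightarrow> complex \<Rightarrow> complex"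
    by unfold_locales
  have "cvec.independent {v}" using assms by simp
  from P.linear_independent_extend[OF this, of "\<lambda>_. 1"] show ?thesis by auto
qed

instantiation tensor :: (complex_algebra_1, complex_algebra_1) complex_algebra_1
begin

definition times_tensor :: "('a, 'b) tensor \<Rightarrow> ('a, 'b) tensor \<Rightarrow> ('a, 'b) tensor"
  where "times_tensor = tmult"

definition one_tensor :: "('a, 'b) tensor"
  where "one_tensor = 1 \<otimes> 1"

instance
proof
  have bil: "cbilinear (\<lambda>a b. tlift (\<lambda>c d. (a * c) \<otimes> (b * d)) t)" for t :: "('a, 'b) tensor"
    by (intro bilinear_rules)
  have lin1: "clinear (\<lambda>s. s * t)" for t :: "('a, 'b) tensor"
    unfolding times_tensor_def tmult_def by (intro linear_rules bil)
  have lin2: "clinear (\<lambda>t. s * t)" for s :: "('a, 'b) tensor"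
    unfolding times_tensor_def tmult_def by (intro bilinear_rules bil)
  have pure: "(a \<otimes> b) * (c \<otimes> d) = (a * c) \<otimes> (b * d)" for a c :: 'a and b d :: 'b
    unfolding times_tensor_def tmult_def
    by (subst tlift_tensor[OF bil], subst tlift_tensor) (intro bilinear_rules, simp)
  fix s t v :: "('a, 'b) tensor" and k
  show "(s + t) * v = s * v + t * v" "(k *\<^sub>C s) * t = k *\<^sub>C (s * t)"
    by (simp_all add: clinear_add[OF lin1] clinear_scale[OF lin1])
  show "s * (t + v) = s * t + s * v" "s * (k *\<^sub>C t) = k *\<^sub>C (s * t)"
    by (simp_all add: clinear_add[OF lin2] clinear_scale[OF lin2])
  show "1 * s = s"
    by (induct s rule: tensor_induct) (simp_all add: one_tensor_def pure clinear_add[OF lin2])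
  show "s * 1 = s"
    by (induct s rule: tensor_induct) (simp_all add: one_tensor_def pure clinear_add[OF lin1])
  show "s * t * v = s * (t * v)"
  proof (induct s rule: tensor_induct)
    case (pure a b)
    show ?case
    proof (induct t rule: tensor_induct)
      case (pure c d)
      show ?case
        by (induct v rule: tensor_induct) (simp_all add: \<open>\<And>a b c d. (a \<otimes> b) * (c \<otimes> d) = (a * c) \<otimes> (b * d)\<close>
            mult.assoc clinear_add[OF lin2])
    qed (simp add: clinear_add[OF lin1] clinear_add[OF lin2])
  qed (simp add: clinear_add[OF lin1])
  \<comment> \<open>The class \<open>ring_1\<close> demands \<open>0 \<noteq> 1\<close>. Functionals
    with value 1 at the two units detect \<open>1 \<otimes> 1\<close>.\<close>
  obtain f :: "'a \<Rightarrow> complex" and g :: "'b \<Rightarrow> complex"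
    where fg: "clinear f" "f 1 = 1" "clinear g" "g 1 = 1"
    using exists_functional[of "1::'a"] exists_functional[of "1::'b"] by auto
  have bfg: "cbilinear (\<lambda>a b. f a * g b)"
    using fg by (intro bilinear_rules) auto
  have "tlift (\<lambda>a b. f a * g b) (1 \<otimes> 1) = 1"
    by (simp add: tlift_tensor[OF bfg] fg)
  then show "(0::('a, 'b) tensor) \<noteq> 1"
    using clinear_0[OF clinear_tlift[OF bfg]] by (auto simp: one_tensor_def)
qed

end

lemma tensor_mult: "(a \<otimes> b) * (c \<otimes> d) = (a * c) \<otimes> (b * d)"
  unfolding times_tensor_def tmult_def
  by (subst tlift_tensor, intro bilinear_rules, subst tlift_tensor) (intro bilinear_rules, simp)

text \<open>Expand the first leg in a basis of its space. The coordinate functionals recover each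
  second leg as a slice of \<open>t\<close>; this is how \<open>M_components\<close> learns that
  second legs of a coproduct are again coinvariant.\<close>

lemma tensor_slices:
  fixes t :: "('a::complex_vector, 'b::complex_vector) tensor"
  obtains I :: "'a set" and b :: "'a \<Rightarrow> 'b" and \<xi> :: "'a \<Rightarrow> 'a \<Rightarrow> complex"
  where "finite I" "t = (\<Sum>a\<in>I. a \<otimes> b a)" "\<And>a. a \<in> I \<Longrightarrow> clinear (\<xi> a)"
    "\<And>a. a \<in> I \<Longrightarrow> b a = tlift (\<lambda>x y. \<xi> a x *\<^sub>C y) t"
proof -
  obtain B :: "'a set" where B: "cvec.independent B" "UNIV \<subseteq> cvec.span B"
    using cvec.basis_exists[of "UNIV :: 'a set"] by blast
  then have B: "cvec.independent B" "cvec.span B = UNIV" by auto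
  have rep: "clinear (\<lambda>v. cvec.representation B v a)" for a
    using cvec.representation_add[OF B(1)] cvec.representation_scale[OF B(1)] B(2)
    by (intro clinearI) (auto simp: scaleC_complex_def)
  have "\<exists>I b. finite I \<and> I \<subseteq> B \<and> t = (\<Sum>a\<in>I. a \<otimes> b a)"
  proof (induct t rule: tensor_induct)
    case (pure v c)
    let ?I = "{a. cvec.representation B v a \<noteq> 0}"
    have "v = (\<Sum>a\<in>?I. cvec.representation B v a *\<^sub>C a)"
      using cvec.sum_nonzero_representation_eq[OF B(1), of v] B(2) by simp
    then have "v \<otimes> c = (\<Sum>a\<in>?I. cvec.representation B v a *\<^sub>C a) \<otimes> c" by simp
    then have "v \<otimes> c = (\<Sum>a\<in>?I. a \<otimes> (cvec.representation B v a *\<^sub>C c))"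
      by (simp only: tensor_sum_left tensor_scaleC_left tensor_scaleC_right)
    then show ?case
      using cvec.finite_representation[of B v] cvec.representation_ne_zero[of B v]
      by (intro exI[of _ ?I] exI[of _ "\<lambda>a. cvec.representation B v a *\<^sub>C c"]) auto
  next
    case (add s t)
    obtain I b where "finite I" "I \<subseteq> B" "s = (\<Sum>a\<in>I. a \<otimes> b a)" using add(1) by blast
    moreover obtain J c where "finite J" "J \<subseteq> B" "t = (\<Sum>a\<in>J. a \<otimes> c a)" using add(2) by blast
    ultimately have *: "finite I" "I \<subseteq> B" "s = (\<Sum>a\<in>I. a \<otimes> b a)"
      "finite J" "J \<subseteq> B" "t = (\<Sum>a\<in>J. a \<otimes> c a)" by auto
    let ?b = "\<lambda>a. (if a \<in> I then b a else 0) + (if a \<in> J then c a else 0)"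
    have "s = (\<Sum>a\<in>I \<union> J. a \<otimes> (if a \<in> I then b a else 0))" "t = (\<Sum>a\<in>I \<union> J. a \<otimes> (if a \<in> J then c a else 0))"
      using * by (auto intro!: sum.mono_neutral_cong_left)
    then have "s + t = (\<Sum>a\<in>I \<union> J. a \<otimes> ?b a)"
      by (simp add: tensor_add_right sum.distrib)
    then show ?case using *
      by (intro exI[of _ "I \<union> J"] exI[of _ ?b]) auto
  qed
  then obtain I b where I: "finite I" "I \<subseteq> B" and t: "t = (\<Sum>a\<in>I. a \<otimes> b a)" by blast
  let ?\<xi> = "\<lambda>a v. cvec.representation B v a"
  have "b a = tlift (\<lambda>x y. ?\<xi> a x *\<^sub>C y) t" if a: "a \<in> I" for a
  proof -
    have bil: "cbilinear (\<lambda>x (y::'b). ?\<xi> a x *\<^sub>C y)"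
      by (intro bilinear_rules rep)
    have "tlift (\<lambda>x y. ?\<xi> a x *\<^sub>C y) t = (\<Sum>a'\<in>I. ?\<xi> a a' *\<^sub>C b a')"
      by (simp add: t clinear_sum[OF clinear_tlift[OF bil]] tlift_tensor[OF bil])
    also have "\<dots> = (\<Sum>a'\<in>I. if a' = a then b a' else 0)"
      using I by (intro sum.cong refl) (auto simp: cvec.representation_basis[OF B(1)] scaleC_one)
    finally show ?thesis using I a by simp
  qed
  with that[OF I(1) t rep] show thesis by simp
qed

lemma tmap_mult:
  assumes "clinear f" "\<And>a b. f (a * b) = f a * f b" "clinear g" "\<And>a b. g (a * b) = g a * g b"
  shows "tmap f g (s * t) = tmap f g s * tmap f g t"
proof -
  have lin: "clinear (tmap f g)"
    using clinear_tmap[OF assms(1,3) clinear_ident] by simp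
  show ?thesis
  proof (induct s rule: tensor_induct)
    case (pure a b)
    show ?case
      by (induct t rule: tensor_induct)
        (simp_all add: tensor_mult tmap_tensor assms distrib_left clinear_add[OF lin])
  qed (simp add: distrib_right clinear_add[OF lin])
qed

text \<open>The coefficients \<open>g\<close> need not be unique, since the family \<open>e\<close>
  may be dependent. Uniqueness enters only with \<open>dual_functional\<close>.\<close>

lemma tensor_space_span:
  assumes "finite A"
  shows "tensor_space UNIV (cspan (e ` A)) = range (\<lambda>g. \<Sum>p\<in>A. g p \<otimes> e p)" (is "?L = ?R")
proof
  have sub: "csubspace ?R"
  proof (rule cvec.subspaceI)
    show "0 \<in> ?R" by (rule range_eqI[of _ _ "\<lambda>_. 0"]) simp
    show "x + y \<in> ?R" if x: "x \<in> ?R" and y: "y \<in> ?R" for x y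
    proof -
      from x obtain g where "x = (\<Sum>p\<in>A. g p \<otimes> e p)" by (rule imageE)
      moreover from y obtain h where "y = (\<Sum>p\<in>A. h p \<otimes> e p)" by (rule imageE)
      ultimately show ?thesis
        by (intro range_eqI[of _ _ "\<lambda>p. g p + h p"]) (simp add: tensor_add_left sum.distrib)
    qed
    show "c *\<^sub>C x \<in> ?R" if "x \<in> ?R" for c x
    proof -
      from that obtain g where "x = (\<Sum>p\<in>A. g p \<otimes> e p)" by (rule imageE)
      then show ?thesis
        by (intro range_eqI[of _ _ "\<lambda>p. c *\<^sub>C g p"]) (simp add: tensor_scaleC_left cvec.scale_sum_right)
    qed
  qed
  have "x \<otimes> v \<in> ?R" if "v \<in> cspan (e ` A)" for x v
    using that
  proof (induct rule: cvec.span_induct)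
    show "csubspace {v. x \<otimes> v \<in> ?R}"
      by (rule cvec.subspaceI) (simp_all only: mem_Collect_eq tensor_add_right tensor_scaleC_right
          tensor_zero_right cvec.subspace_0[OF sub] cvec.subspace_add[OF sub] cvec.subspace_scale[OF sub])
    fix v assume "v \<in> e ` A"
    then obtain p where p: "p \<in> A" "v = e p" by auto
    then show "x \<otimes> v \<in> ?R"
      using assms by (intro range_eqI[of _ _ "\<lambda>p'. if p' = p then x else 0"])
        (simp add: if_distrib[of "\<lambda>x. x \<otimes> _"] cong: if_cong)
  qed
  then show "?L \<subseteq> ?R"
    unfolding tensor_space_def by (intro cvec.span_minimal sub) blast
  show "?R \<subseteq> ?L"
    unfolding tensor_space_def
  proof clarify
    fix g
    have "e p \<in> cspan (e ` A)" if "p \<in> A" for p using that by (intro cvec.span_base imageI)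
    then show "(\<Sum>p\<in>A. g p \<otimes> e p) \<in> cspan {x \<otimes> y | x y. x \<in> UNIV \<and> y \<in> cspan (e ` A)}"
      by (intro cvec.span_sum cvec.span_base) blast
  qed
qed


section \<open>Presented algebras\<close>

lemma clinear_free_eval: "clinear (free_eval f)"
  unfolding free_eval_def by (rule clinear_lincomb)

lemma free_eval_single: "free_eval f (Poly_Mapping.single w c) = c *\<^sub>C prod_list (map f (letters w))"
  by (simp add: free_eval_def)

lemma free_eval_gen [simp]: "free_eval f (free_gen x) = f x"
  by (simp add: free_gen_def free_eval_single scaleC_one)

lemma free_eval_one [simp]: "free_eval f 1 = 1"
  by (simp add: free_eval_single scaleC_one zero_free_word_def flip: single_one)

lemma free_eval_mult: "free_eval f (p * q) = free_eval f p * free_eval f q"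
proof (induct p rule: poly_mapping_single_add_induct)
  case (single v c)
  show ?case
  proof (induct q rule: poly_mapping_single_add_induct)
    case (single w d)
    then show ?case
      by (simp add: mult_single free_eval_single plus_free_word_def mult_scaleC_left mult_scaleC_right
          scaleC_scaleC)
  qed (simp add: distrib_left clinear_add[OF clinear_free_eval])
qed (simp add: distrib_right clinear_add[OF clinear_free_eval])

lemmas free_eval_simps = free_eval_mult clinear_add[OF clinear_free_eval] clinear_diff[OF clinear_free_eval]
  clinear_sum[OF clinear_free_eval] clinear_scale[OF clinear_free_eval]

lemma free_eval_prod_list: "free_eval f (prod_list ps) = prod_list (map (free_eval f) ps)"
  by (induct ps) (simp_all add: free_eval_mult)

lemma one_free_algebra_on: "1 \<in> free_algebra_on X"
  by (auto simp: free_algebra_on_def zero_free_word_def simp flip: single_one split: if_splits)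

lemma gen_free_algebra_on: "x \<in> X \<Longrightarrow> free_gen x \<in> free_algebra_on X"
  by (auto simp: free_algebra_on_def free_gen_def split: if_splits)

lemma add_free_algebra_on: "p \<in> free_algebra_on X \<Longrightarrow> q \<in> free_algebra_on X \<Longrightarrow> p + q \<in> free_algebra_on X"
  using keys_add[of p q] by (auto simp: free_algebra_on_def)

lemma scaleC_free_algebra_on: "p \<in> free_algebra_on X \<Longrightarrow> c *\<^sub>C p \<in> free_algebra_on X"
  by (auto simp: free_algebra_on_def in_keys_iff)

lemma diff_free_algebra_on: "p \<in> free_algebra_on X \<Longrightarrow> q \<in> free_algebra_on X \<Longrightarrow> p - q \<in> free_algebra_on X"
  using keys_diff[of p q] by (auto simp: free_algebra_on_def)

lemma mult_free_algebra_on: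
  "p \<in> free_algebra_on X \<Longrightarrow> q \<in> free_algebra_on X \<Longrightarrow> p * q \<in> free_algebra_on X"
  using keys_mult[of p q] by (fastforce simp: free_algebra_on_def plus_free_word_def)

lemma presented_induct [consumes 1, case_names one gen mult add scale]:
  assumes pres: "presented_by X rels f" and one: "P 1" and gen: "\<And>x. x \<in> X \<Longrightarrow> P (f x)"
    and mult: "\<And>a b. P a \<Longrightarrow> P b \<Longrightarrow> P (a * b)" and add: "\<And>a b. P a \<Longrightarrow> P b \<Longrightarrow> P (a + b)"
    and scale: "\<And>c a. P a \<Longrightarrow> P (c *\<^sub>C a)"
  shows "P h"
proof -
  have "h \<in> free_eval f ` free_algebra_on X"
    using pres by (auto simp: presented_by_def)
  then obtain p where p: "h = free_eval f p" "p \<in> free_algebra_on X" by auto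
  have word: "P (prod_list (map f xs))" if "set xs \<subseteq> X" for xs
    using that by (induct xs) (simp_all add: one gen mult)
  have "P (\<Sum>w\<in>K. Poly_Mapping.lookup p w *\<^sub>C prod_list (map f (letters w)))"
    if "K \<subseteq> Poly_Mapping.keys p" for K
    using that
  proof (induct K rule: infinite_finite_induct)
    case (insert w K)
    moreover have "set (letters w) \<subseteq> X" using insert p(2) by (auto simp: free_algebra_on_def)
    ultimately show ?case by (simp add: add scale word)
  qed (use scale[OF one, of 0] in simp_all)
  then show ?thesis by (simp add: p(1) free_eval_def lincomb_def)
qed

text \<open>A set-theoretic choice of preimages under evaluation suffices: two preimages of one
  element differ by a member of the ideal, where \<open>free_eval g\<close> vanishes, so the
  composite is linear and multiplicative even if the choice is not.\<close>

lemma presented_hom_exists: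
  fixes f :: "'x \<Rightarrow> 'a::complex_algebra_1" and g :: "'x \<Rightarrow> 'b::complex_algebra_1"
  assumes pres: "presented_by X rels f" and rels: "\<And>r. r \<in> rels \<Longrightarrow> free_eval g r = 0"
  obtains \<psi> where "clinear \<psi>" "\<psi> 1 = 1" "\<And>a b. \<psi> (a * b) = \<psi> a * \<psi> b" "\<And>x. x \<in> X \<Longrightarrow> \<psi> (f x) = g x"
proof -
  have zero: "free_eval g p = 0" if "p \<in> free_algebra_on X" "free_eval f p = 0" for p
  proof -
    have "p \<in> ideal_generated X rels" using pres that by (auto simp: presented_by_def)
    then show ?thesis
      unfolding ideal_generated_def
    proof (rule cvec.span_induct)
      show "csubspace {p. free_eval g p = 0}"
        by (auto simp: cvec.subspace_def free_eval_simps clinear_0[OF clinear_free_eval])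
    qed (auto simp: free_eval_simps rels)
  qed
  define lift where "lift a = (SOME p. p \<in> free_algebra_on X \<and> free_eval f p = a)" for a
  have "\<exists>p. p \<in> free_algebra_on X \<and> free_eval f p = a" for a
  proof -
    have "a \<in> free_eval f ` free_algebra_on X" using pres by (auto simp: presented_by_def)
    then show ?thesis by auto
  qed
  then have "lift a \<in> free_algebra_on X \<and> free_eval f (lift a) = a" for a
    unfolding lift_def by (rule someI_ex)
  then have lift: "lift a \<in> free_algebra_on X" "free_eval f (lift a) = a" for a by auto
  have eq: "free_eval g (lift a) = free_eval g p" if "p \<in> free_algebra_on X" "free_eval f p = a" for p a
    using zero[of "lift a - p"] lift that by (simp add: diff_free_algebra_on free_eval_simps)
  show thesis
  proof (rule that[of "\<lambda>a. free_eval g (lift a)"])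
    show "clinear (\<lambda>a. free_eval g (lift a))"
    proof (rule clinearI)
      fix a b c
      show "free_eval g (lift (a + b)) = free_eval g (lift a) + free_eval g (lift b)"
        by (subst eq[of "lift a + lift b"]) (simp_all add: lift add_free_algebra_on free_eval_simps)
      show "free_eval g (lift (c *\<^sub>C a)) = c *\<^sub>C free_eval g (lift a)"
        by (subst eq[of "c *\<^sub>C lift a"]) (simp_all add: lift scaleC_free_algebra_on free_eval_simps)
    qed
    show "free_eval g (lift 1) = 1"
      by (subst eq[of 1]) (simp_all add: one_free_algebra_on)
    show "free_eval g (lift (a * b)) = free_eval g (lift a) * free_eval g (lift b)" for a b
      by (subst eq[of "lift a * lift b"]) (simp_all add: lift mult_free_algebra_on free_eval_simps)
    show "free_eval g (lift (f x)) = g x" if "x \<in> X" for x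
      by (subst eq[of "free_gen x"]) (simp_all add: that gen_free_algebra_on)
  qed
qed


section \<open>Hopf algebras and matrix corepresentations\<close>

text \<open>Associativity is all it takes, so the entries may lie in a noncommutative ring. It is
  applied to matrices over the tensor square of a Hopf algebra.\<close>

lemma matrix_inverse_unique:
  fixes a b b' :: "'i \<Rightarrow> 'i \<Rightarrow> 'a::ring_1"
  assumes fin: "finite I" and ij: "i \<in> I" "j \<in> I"
    and l: "\<And>i j. i \<in> I \<Longrightarrow> j \<in> I \<Longrightarrow> (\<Sum>k\<in>I. b i k * a k j) = of_bool (i = j)"
    and r: "\<And>i j. i \<in> I \<Longrightarrow> j \<in> I \<Longrightarrow> (\<Sum>k\<in>I. a i k * b' k j) = of_bool (i = j)"
  shows "b i j = b' i j"
proof -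
  have "b i j = (\<Sum>k\<in>I. b i k * (\<Sum>l\<in>I. a k l * b' l j))"
    using fin ij by (simp add: r of_bool_def if_distrib[of "\<lambda>x. _ * x"] cong: if_cong)
  also have "\<dots> = (\<Sum>l\<in>I. (\<Sum>k\<in>I. b i k * a k l) * b' l j)"
    unfolding sum_distrib_left sum_distrib_right by (subst sum.swap) (simp add: mult.assoc)
  also have "\<dots> = b' i j"
    using fin ij by (simp add: l of_bool_def if_distrib[of "\<lambda>x. x * _"] cong: if_cong)
  finally show ?thesis .
qed

context hopf_algebra
begin

lemmas hopf_linear_rules = linear_rules clinear_compose[OF cop_linear] clinear_compose[OF eps_linear]
  clinear_compose[OF ant_linear] cop_linear eps_linear ant_linear

text \<open>Sweedler's freedom to rebracket an iterated coproduct, phrased by a trilinear test map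
  so that later computations need not mention \<open>tassoc\<close>.\<close>

lemma cop_coassoc:
  assumes F1: "\<And>b c. clinear (\<lambda>a. F a b c)" and F2: "\<And>a c. clinear (\<lambda>b. F a b c)"
    and F3: "\<And>a b. clinear (F a b)"
  shows "tlift (\<lambda>x c. tlift (\<lambda>a b. F a b c) (cop x)) (cop h) = tlift (\<lambda>a y. tlift (F a) (cop y)) (cop h)"
proof -
  have bF: "cbilinear (F a)" "cbilinear (\<lambda>a b. F a b c)" for a c
    using assms by (auto intro: cbilinearI)
  let ?L = "tlift (\<lambda>a t. tlift (F a) t)"
  have bL: "cbilinear (\<lambda>a t. tlift (F a) t)"
    by (intro bilinear_rules assms bF)
  have b3: "cbilinear (\<lambda>s c. tlift (\<lambda>a b. F a b c) s)"
    by (intro bilinear_rules assms bF)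
  have assoc: "?L (tassoc t) = tlift (\<lambda>s c. tlift (\<lambda>a b. F a b c) s) t" for t
  proof (rule clinear_tensor_eqI[where F = "\<lambda>t. ?L (tassoc t)"])
    show "clinear (\<lambda>t. ?L (tassoc t))"
      unfolding tassoc_def by (intro bilinear_rules bL)
    show "clinear (tlift (\<lambda>s c. tlift (\<lambda>a b. F a b c) s))"
      by (intro clinear_tlift b3)
    fix s :: "('h, 'h) tensor" and c :: 'h
    have "tassoc (s \<otimes> c) = tlift (\<lambda>x y. x \<otimes> (y \<otimes> c)) s"
      unfolding tassoc_def by (subst tlift_tensor) (intro bilinear_rules, simp)
    also have "?L \<dots> = tlift (\<lambda>a b. F a b c) s"
      by (subst clinear_comp_tlift)
        (intro clinear_tlift bL bilinear_rules | simp add: tlift_tensor[OF bL] tlift_tensor[OF bF(1)])+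
    finally show "?L (tassoc (s \<otimes> c)) = tlift (\<lambda>s c. tlift (\<lambda>a b. F a b c) s) (s \<otimes> c)"
      by (simp add: tlift_tensor[OF b3])
  qed
  have "tlift (\<lambda>s c. tlift (\<lambda>a b. F a b c) s) (tmap cop id (cop h)) = ?L (tmap id cop (cop h))"
    by (simp add: coassoc flip: assoc)
  then show ?thesis
    by (simp add: tlift_tmap[OF b3] tlift_tmap[OF bL] cop_linear clinear_id)
qed

lemma cop_hom: "cop (g * h) = cop g * cop h" "cop 1 = 1"
  by (simp_all add: cop_mult cop_one times_tensor_def one_tensor_def)

lemma bilinear_ant_left: "cbilinear (\<lambda>h1 h2. ant h1 * h2)"
  and bilinear_ant_right: "cbilinear (\<lambda>h1 h2. h1 * ant h2)"
  by (rule cbilinearI; (intro hopf_linear_rules))+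

lemma ant_one: "ant 1 = 1"
  using antipode_left[of 1] by (simp add: cop_one tlift_tensor[OF bilinear_ant_left] eps_one scaleC_one)

context
  fixes I :: "'i set" and v :: "'i \<Rightarrow> 'i \<Rightarrow> 'h"
  assumes fin: "finite I"
    and cop_v: "\<And>i j. i \<in> I \<Longrightarrow> j \<in> I \<Longrightarrow> cop (v i j) = (\<Sum>k\<in>I. v i k \<otimes> v k j)"
    and eps_v: "\<And>i j. i \<in> I \<Longrightarrow> j \<in> I \<Longrightarrow> eps (v i j) = of_bool (i = j)"
begin

lemma ant_matrix_left:
  assumes "i \<in> I" "j \<in> I"
  shows "(\<Sum>k\<in>I. ant (v i k) * v k j) = of_bool (i = j)"
  using antipode_left[of "v i j"] assms
  by (simp add: cop_v eps_v clinear_sum[OF clinear_tlift[OF bilinear_ant_left]]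
      tlift_tensor[OF bilinear_ant_left] scaleC_one split: if_splits)

lemma ant_matrix_right:
  assumes "i \<in> I" "j \<in> I"
  shows "(\<Sum>k\<in>I. v i k * ant (v k j)) = of_bool (i = j)"
  using antipode_right[of "v i j"] assms
  by (simp add: cop_v eps_v clinear_sum[OF clinear_tlift[OF bilinear_ant_right]]
      tlift_tensor[OF bilinear_ant_right] scaleC_one split: if_splits)

text \<open>Both sides are inverse to the matrix with entries \<open>cop (v i j)\<close>: one from
  the left, by applying \<open>cop\<close> to the antipode relation, the other from the right, by
  direct expansion. The index type is arbitrary because the lemma serves both u, indexed by numbers,
  and y, indexed by pairs.\<close>

lemma cop_ant_matrix:
  assumes ij: "i \<in> I" "j \<in> I"
  shows "cop (ant (v i j)) = (\<Sum>k\<in>I. ant (v k j) \<otimes> ant (v i k))"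
proof (rule matrix_inverse_unique[OF fin ij, where a = "\<lambda>i j. cop (v i j)"
      and b = "\<lambda>i j. cop (ant (v i j))" and b' = "\<lambda>i j. \<Sum>k\<in>I. ant (v k j) \<otimes> ant (v i k)"])
  fix i j assume ij: "i \<in> I" "j \<in> I"
  have "(\<Sum>k\<in>I. cop (ant (v i k)) * cop (v k j)) = cop (\<Sum>k\<in>I. ant (v i k) * v k j)"
    by (simp add: clinear_sum[OF cop_linear] cop_hom)
  also have "\<dots> = of_bool (i = j)"
    by (simp add: ant_matrix_left ij cop_hom clinear_0[OF cop_linear])
  finally show "(\<Sum>k\<in>I. cop (ant (v i k)) * cop (v k j)) = of_bool (i = j)" .
  have "(\<Sum>k\<in>I. cop (v i k) * (\<Sum>m\<in>I. ant (v m j) \<otimes> ant (v k m)))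
      = (\<Sum>k\<in>I. \<Sum>l\<in>I. \<Sum>m\<in>I. (v i l * ant (v m j)) \<otimes> (v l k * ant (v k m)))"
    by (simp add: cop_v ij sum_product tensor_mult)
  also have "\<dots> = (\<Sum>l\<in>I. \<Sum>m\<in>I. \<Sum>k\<in>I. (v i l * ant (v m j)) \<otimes> (v l k * ant (v k m)))"
    by (subst sum.swap, rule sum.cong[OF refl], subst sum.swap, rule refl)
  also have "\<dots> = (\<Sum>l\<in>I. \<Sum>m\<in>I. (v i l * ant (v m j)) \<otimes> of_bool (l = m))"
    by (simp add: ant_matrix_right flip: tensor_sum_right)
  also have "\<dots> = (\<Sum>l\<in>I. (v i l * ant (v l j)) \<otimes> 1)"
    using fin by (simp add: of_bool_def if_distrib[of "\<lambda>x. _ \<otimes> x"] cong: if_cong)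
  also have "\<dots> = of_bool (i = j)"
    by (simp add: ant_matrix_right ij one_tensor_def flip: tensor_sum_left)
  finally show "(\<Sum>k\<in>I. cop (v i k) * (\<Sum>m\<in>I. ant (v m j) \<otimes> ant (v k m))) = of_bool (i = j)" .
qed

lemma eps_ant_matrix:
  assumes ij: "i \<in> I" "j \<in> I"
  shows "eps (ant (v i j)) = of_bool (i = j)"
proof -
  have "eps (\<Sum>k\<in>I. ant (v i k) * v k j) = (\<Sum>k\<in>I. eps (ant (v i k)) * of_bool (k = j))"
    by (simp add: clinear_sum[OF eps_linear] eps_mult eps_v ij)
  also have "\<dots> = eps (ant (v i j))"
    using fin ij by (simp add: of_bool_def if_distrib[of "\<lambda>x. _ * x"] cong: if_cong)
  finally show ?thesis
    by (auto simp: ant_matrix_left ij eps_one clinear_0[OF eps_linear])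
qed

end

end

declare One_nat_def [simp del]

section \<open>Values of the universal r-form\<close>

locale quantum_projective_space =
  G: coquasi_triangular copG epsG antG r + H: hopf_algebra_hom copG epsG antG copU epsU antU \<alpha>
  for copG :: "'g::complex_algebra_1 \<Rightarrow> ('g, 'g) tensor" and epsG antG r
    and copU :: "'k::complex_algebra_1 \<Rightarrow> ('k, 'k) tensor" and epsU antU \<alpha> +
  fixes N :: nat and q :: real and q_root :: complex
    and u :: "nat \<Rightarrow> nat \<Rightarrow> 'g"
    and uU :: "nat \<Rightarrow> nat \<Rightarrow> 'k" and det_inv :: 'k
  assumes N: "N \<ge> 2" and q: "0 < q" "q \<le> 1" and q_root: "q_root ^ N = of_real q"
    and SU: "presents_SU q N u" "matrix_coalgebra N u copG epsG"
    and U: "presents_U q (N - 1) uU det_inv" "matrix_coalgebra (N - 1) uU copU epsU"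
    and \<alpha>_11: "\<alpha> (u 1 1) = det_inv"
    and \<alpha>_1i: "\<And>i. i \<in> {2..N} \<Longrightarrow> \<alpha> (u 1 i) = 0 \<and> \<alpha> (u i 1) = 0"
    and \<alpha>_ij: "\<And>i j. i \<in> {2..N} \<Longrightarrow> j \<in> {2..N} \<Longrightarrow> \<alpha> (u i j) = uU (i - 1) (j - 1)"
    and r_gen: "\<And>i j k l. i \<in> {1..N} \<Longrightarrow> j \<in> {1..N} \<Longrightarrow> k \<in> {1..N} \<Longrightarrow> l \<in> {1..N} \<Longrightarrow>
      r (u i j) (u k l) = inverse q_root * rmat q k i j l"
begin

abbreviation s :: "nat \<Rightarrow> nat \<Rightarrow> 'g" where "s i j \<equiv> antG (u i j)"

abbreviation c :: complex where "c \<equiv> inverse q_root"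

abbreviation \<nu> :: complex where "\<nu> \<equiv> of_real (q - inverse q)"

lemma q_root_nz: "q_root \<noteq> 0" and one_N: "1 \<in> {1..N}"
  using q q_root N by (auto simp: power_0_left)

lemma \<nu>_nz:
  assumes "q \<noteq> 1"
  shows "\<nu> \<noteq> 0"
proof -
  have "1 < inverse q" using assms q by (intro one_less_inverse) auto
  then have "q - inverse q \<noteq> 0" using q by simp
  then show ?thesis unfolding of_real_eq_0_iff .
qed

lemma cop_u: "i \<in> {1..N} \<Longrightarrow> j \<in> {1..N} \<Longrightarrow> copG (u i j) = (\<Sum>k\<in>{1..N}. u i k \<otimes> u k j)"
  and eps_u: "i \<in> {1..N} \<Longrightarrow> j \<in> {1..N} \<Longrightarrow> epsG (u i j) = of_bool (i = j)"
  using SU(2) by (simp_all add: matrix_coalgebra_def)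

lemma
  assumes "i \<in> {1..N}" "j \<in> {1..N}"
  shows s_u: "(\<Sum>k\<in>{1..N}. s i k * u k j) = of_bool (i = j)"
    and u_s: "(\<Sum>k\<in>{1..N}. u i k * s k j) = of_bool (i = j)"
    and cop_s: "copG (s i j) = (\<Sum>k\<in>{1..N}. s k j \<otimes> s i k)"
    and eps_s: "epsG (s i j) = of_bool (i = j)"
  using G.ant_matrix_left[of "{1..N}" u i j] G.ant_matrix_right[of "{1..N}" u i j]
    G.cop_ant_matrix[of "{1..N}" u i j] G.eps_ant_matrix[of "{1..N}" u i j] assms cop_u eps_u
  by simp_all

lemma clinear_r_left: "clinear f \<Longrightarrow> clinear (\<lambda>x. r (f x) h)"
  and clinear_r_right: "clinear g \<Longrightarrow> clinear (\<lambda>x. r h (g x))"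
  using clinear_bilinear_left[OF G.r_bilinear] clinear_bilinear_right[OF G.r_bilinear] by blast+

lemmas r_linear_rules = clinear_r_left clinear_r_right

lemmas r_left = r_linear_rules(1)[OF clinear_ident] and r_right = r_linear_rules(2)[OF clinear_ident]

lemma r_mult_u:
  assumes "p \<in> {1..N}" "l \<in> {1..N}"
  shows "r (f * g) (u p l) = (\<Sum>t\<in>{1..N}. r f (u p t) * r g (u t l))"
proof -
  have "cbilinear (\<lambda>h1 h2. r f h1 * r g h2)"
    by (rule cbilinearI; intro linear_rules r_linear_rules)
  then show ?thesis
    using assms by (simp add: G.r_mult_left cop_u clinear_sum[OF clinear_tlift] tlift_tensor)
qed

lemma r_u_mult:
  assumes "k \<in> {1..N}" "l \<in> {1..N}"
  shows "r (u k l) (f * g) = (\<Sum>t\<in>{1..N}. r (u k t) g * r (u t l) f)"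
proof -
  have "cbilinear (\<lambda>h1 h2. r h1 g * r h2 f)"
    by (rule cbilinearI; intro linear_rules r_linear_rules)
  then show ?thesis
    using assms by (simp add: G.r_mult_right cop_u clinear_sum[OF clinear_tlift] tlift_tensor)
qed

text \<open>The matrices \<open>r 1 (u p l)\<close> and \<open>r (u p l) 1\<close> are idempotent and right invertible.\<close>

lemma r_one_u:
  assumes pl: "p \<in> {1..N}" "l \<in> {1..N}"
  shows "r 1 (u p l) = of_bool (p = l)" "r (u p l) 1 = of_bool (p = l)"
proof -
  obtain r' where r': "cbilinear r'"
    "\<And>f g. tlift (\<lambda>f1 f2. tlift (\<lambda>g1 g2. r f1 g1 * r' f2 g2) (copG g)) (copG f) = epsG f * epsG g"
    using G.r_invertible by blast
  note rules = linear_rules r_linear_rules clinear_bilinear_left[OF r'(1)]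
    clinear_bilinear_right[OF r'(1)]
  have b1: "cbilinear (\<lambda>g1 g2. r f1 g1 * r' f2 g2)" for f1 f2
    by (rule cbilinearI; intro rules)
  have b2: "cbilinear (\<lambda>f1 f2. tlift (\<lambda>g1 g2. r f1 g1 * r' f2 g2) t)" for t
    by (rule cbilinearI; intro rules b1)
  have b3: "cbilinear (\<lambda>f1 f2. r f1 1 * r' f2 1)"
    by (rule cbilinearI; intro rules)
  have idem: "E p l = of_bool (p = l)"
    if pl: "p \<in> {1..N}" "l \<in> {1..N}"
      and E: "\<And>p l. p \<in> {1..N} \<Longrightarrow> l \<in> {1..N} \<Longrightarrow> E p l = (\<Sum>t\<in>{1..N}. E p t * E t l)"
      and inv: "\<And>p l. p \<in> {1..N} \<Longrightarrow> l \<in> {1..N} \<Longrightarrow> (\<Sum>t\<in>{1..N}. E p t * E' t l) = of_bool (p = l)"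
    for p l and E E' :: "nat \<Rightarrow> nat \<Rightarrow> complex"
  proof -
    have "E p l = (\<Sum>t\<in>{1..N}. E p t * (\<Sum>x\<in>{1..N}. E t x * E' x l))"
      using pl by (simp add: inv of_bool_def if_distrib[of "\<lambda>x. _ * x"] cong: if_cong)
    also have "\<dots> = (\<Sum>x\<in>{1..N}. (\<Sum>t\<in>{1..N}. E p t * E t x) * E' x l)"
      unfolding sum_distrib_left sum_distrib_right by (subst sum.swap) (simp add: mult.assoc)
    also have "\<dots> = of_bool (p = l)"
      using pl by (simp add: inv flip: E)
    finally show ?thesis .
  qed
  show "r 1 (u p l) = of_bool (p = l)"
  proof (rule idem[OF pl, where E' = "\<lambda>p l. r' 1 (u p l)"])
    fix p l assume pl: "p \<in> {1..N}" "l \<in> {1..N}"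
    show "r 1 (u p l) = (\<Sum>t\<in>{1..N}. r 1 (u p t) * r 1 (u t l))"
      using r_mult_u[OF pl, of 1 1] by simp
    show "(\<Sum>t\<in>{1..N}. r 1 (u p t) * r' 1 (u t l)) = of_bool (p = l)"
      using r'(2)[where f = 1 and g = "u p l"] pl
      by (simp add: G.cop_one tlift_tensor[OF b2] cop_u clinear_sum[OF clinear_tlift[OF b1]]
          tlift_tensor[OF b1] G.eps_one eps_u)
  qed
  show "r (u p l) 1 = of_bool (p = l)"
  proof (rule idem[OF pl, where E' = "\<lambda>p l. r' (u p l) 1"])
    fix p l assume pl: "p \<in> {1..N}" "l \<in> {1..N}"
    show "r (u p l) 1 = (\<Sum>t\<in>{1..N}. r (u p t) 1 * r (u t l) 1)"
      using r_u_mult[OF pl, of 1 1] by simp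
    show "(\<Sum>t\<in>{1..N}. r (u p t) 1 * r' (u t l) 1) = of_bool (p = l)"
      using r'(2)[where f = "u p l" and g = 1] pl
      by (simp add: G.cop_one tlift_tensor[OF b1] cop_u clinear_sum[OF clinear_tlift[OF b3]]
          tlift_tensor[OF b3] G.eps_one eps_u)
  qed
qed

text \<open>Once the upper indices are fixed, R has at most two nonzero entries: the transposed
  pair, and for \<open>k > i\<close> also the pair itself.\<close>

lemma sum_rmat_lower:
  assumes "i \<in> {1..N}" "k \<in> {1..N}"
  shows "(\<Sum>j\<in>{1..N}. \<Sum>l\<in>{1..N}. rmat q i k j l * X j l)
    = (if i = k then of_real q else 1) * X k i + (if k > i then \<nu> * X i k else 0)"
proof -
  have "(\<Sum>j\<in>{1..N}. \<Sum>l\<in>{1..N}. rmat q i k j l * X j l)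
    = (\<Sum>j\<in>{1..N}. \<Sum>l\<in>{1..N}. (if l = i then (if j = k then (if i = k then of_real q else 1) * X j l else 0) else 0))
      + (\<Sum>j\<in>{1..N}. \<Sum>l\<in>{1..N}. (if l = k then (if j = i then (if k > i then \<nu> * X j l else 0) else 0) else 0))"
    unfolding sum.distrib[symmetric]
    by (intro sum.cong refl) (auto simp: rmat_def algebra_simps)
  also have "\<dots> = (if i = k then of_real q else 1) * X k i + (if k > i then \<nu> * X i k else 0)"
    using assms by simp
  finally show ?thesis .
qed

text \<open>Pair the relation \<open>u s = 1\<close> with \<open>u p l\<close>. As 1 is the smallest
  index, the \<open>\<nu>\<close>-term of R is absent, and the sum collapses to the single wanted
  value, up to the factor q for \<open>p = 1\<close>.\<close>

lemma r_s_u: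
  assumes "k \<in> {1..N}" "l \<in> {1..N}" "p \<in> {1..N}"
  shows "r (s 1 k) (u p l) = of_bool (k = 1 \<and> p = l) * q_root * (if p = 1 then inverse (of_real q) else 1)"
proof -
  have "of_bool (1 = k) * of_bool (p = l) = r (\<Sum>j\<in>{1..N}. u 1 j * s j k) (u p l)"
    using u_s[OF one_N assms(1)] assms by (auto simp: r_one_u clinear_0[OF r_left])
  also have "\<dots> = (\<Sum>j\<in>{1..N}. \<Sum>t\<in>{1..N}. r (u 1 j) (u p t) * r (s j k) (u t l))"
    by (simp add: clinear_sum[OF r_left] r_mult_u[OF assms(3,2)])
  also have "\<dots> = c * (\<Sum>j\<in>{1..N}. \<Sum>t\<in>{1..N}. rmat q p 1 j t * r (s j k) (u t l))"
    using assms one_N by (simp add: r_gen sum_distrib_left mult.assoc)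
  also have "\<dots> = c * (if p = 1 then of_real q else 1) * r (s 1 k) (u p l)"
    using assms one_N by (subst sum_rmat_lower) auto
  finally show ?thesis
    using q_root_nz q by (auto simp: field_simps split: if_splits)
qed

text \<open>These numbers govern the size of Q on every z. The recursion below gives
  \<open>q_root / q\<close> for \<open>b = 1\<close> and
  \<open>- \<nu> * q_root * q^(2 - 2 * b)\<close> for larger b up to N.\<close>

definition \<tau> :: "nat \<Rightarrow> complex" where "\<tau> b = r (u b 1) (s 1 b)"

text \<open>Pair \<open>u k l\<close> with the relation \<open>s u = 1\<close>. Here the
  \<open>\<nu>\<close>-term of R does occur, but only for \<open>b = k\<close>, and it involves only
  diagonal values with smaller index. The resulting system is triangular.\<close>

lemma r_u_s_recursion:
  assumes "k \<in> {1..N}" "l \<in> {1..N}" "b \<in> {1..N}"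
  shows "(if b = k then of_real q else 1) * r (u k l) (s 1 b)
      + (if b = k then \<nu> * (\<Sum>j\<in>{1..<k}. r (u j l) (s 1 j)) else 0)
    = q_root * of_bool (b = 1 \<and> k = l)" (is "?A + ?B = _")
proof -
  have "of_bool (1 = b) * of_bool (k = l) = r (u k l) (\<Sum>j\<in>{1..N}. s 1 j * u j b)"
    using s_u[OF one_N assms(3)] assms by (auto simp: r_one_u clinear_0[OF r_right])
  also have "\<dots> = (\<Sum>j\<in>{1..N}. \<Sum>t\<in>{1..N}. r (u k t) (u j b) * r (u t l) (s 1 j))"
    by (simp add: clinear_sum[OF r_right] r_u_mult[OF assms(1,2)])
  also have "\<dots> = c * ((\<Sum>j\<in>{1..N}. \<Sum>t\<in>{1..N}.
      (if t = k then (if j = b then (if b = k then of_real q else 1) * r (u k l) (s 1 j) else 0) else 0))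
    + (\<Sum>j\<in>{1..N}. \<Sum>t\<in>{1..N}. (if t = j then (if b = k then (if j < k then \<nu> * r (u j l) (s 1 j) else 0) else 0) else 0)))"
    unfolding sum.distrib[symmetric] sum_distrib_left using assms
    by (intro sum.cong refl) (auto simp: r_gen rmat_def algebra_simps)
  also have "\<dots> = c * ((if b = k then of_real q else 1) * r (u k l) (s 1 b)
    + (\<Sum>j\<in>{1..N}. (if b = k then (if j < k then \<nu> * r (u j l) (s 1 j) else 0) else 0)))"
    using assms by simp
  also have "(\<Sum>j\<in>{1..N}. (if b = k then (if j < k then \<nu> * r (u j l) (s 1 j) else 0) else 0))
    = (if b = k then \<nu> * (\<Sum>j\<in>{1..<k}. r (u j l) (s 1 j)) else 0)"
    using assms by (auto simp: sum_distrib_left sum.If_cases intro!: sum.cong)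
  finally have "q_root * (of_bool (1 = b) * of_bool (k = l)) = q_root * (c * (?A + ?B))" by simp
  then show ?thesis
    using q_root_nz by (simp add: of_bool_conj eq_commute[of 1 b] flip: mult.assoc)
qed

text \<open>For \<open>l \<ge> 2\<close> the diagonal equations \<open>b = k\<close> have right-hand
  side zero, so the triangular system forces all diagonal values to vanish; the other equations
  contain a single unknown.\<close>

lemma r_u_s_offdiag:
  assumes "k \<in> {1..N}" "l \<in> {2..N}" "b \<in> {1..N}"
  shows "r (u k l) (s 1 b) = q_root * of_bool (b = 1 \<and> k = l)"
proof -
  have diag: "b \<in> {1..N} \<Longrightarrow> r (u b l) (s 1 b) = 0" for b
  proof (induct b rule: less_induct)
    case (less b)
    then have "(\<Sum>j\<in>{1..<b}. r (u j l) (s 1 j)) = 0"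
      by (intro sum.neutral) auto
    then show ?case
      using r_u_s_recursion[of b l b] less assms q by (auto simp: of_bool_def split: if_splits)
  qed
  show ?thesis
    using r_u_s_recursion[of k l b] diag[of b] assms by (cases "b = k") auto
qed

lemma r_u_s_first:
  assumes "k \<in> {1..N}" "b \<in> {1..N}"
  shows "r (u k 1) (s 1 b) = of_bool (k = b) * \<tau> b"
  using r_u_s_recursion[of k 1 b] assms by (cases "b = k") (auto simp: \<tau>_def)

text \<open>The recursion makes \<open>\<tau> b\<close> for \<open>b > 1\<close> a multiple of
  \<open>\<nu>\<close> times the preceding partial sum. Partial sums never vanish: since
  \<open>q - \<nu> = 1 / q\<close>, each is the previous one divided by the square of q.\<close>

lemma \<tau>_nz:
  assumes b: "b \<in> {1..N}" and q1: "q \<noteq> 1"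
  shows "\<tau> b \<noteq> 0"
proof -
  have rec: "of_real q * \<tau> b + \<nu> * (\<Sum>j\<in>{1..<b}. \<tau> j) = q_root * of_bool (b = 1)" if "b \<in> {1..N}" for b
    using r_u_s_recursion[of b 1 b] that one_N by (auto simp: \<tau>_def)
  have sum: "(\<Sum>j\<in>{1..b}. \<tau> j) \<noteq> 0" if "b \<ge> 1" "b \<le> N" for b
    using that
  proof (induct b rule: nat_induct_at_least)
    case base
    then show ?case using rec[of 1] q q_root_nz by auto
  next
    case (Suc b)
    let ?S = "\<Sum>j\<in>{1..b}. \<tau> j"
    have "of_real q * \<tau> (Suc b) = - (\<nu> * ?S)"
      using rec[of "Suc b"] Suc by (simp add: eq_neg_iff_add_eq_0 atLeastLessThanSuc_atLeastAtMost)
    moreover have "(\<Sum>j\<in>{1..Suc b}. \<tau> j) = ?S + \<tau> (Suc b)"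
      using Suc by simp
    ultimately have "of_real q * (\<Sum>j\<in>{1..Suc b}. \<tau> j) = (of_real q - \<nu>) * ?S"
      by (simp add: algebra_simps)
    then show ?case using Suc q by auto
  qed
  show ?thesis
  proof (cases "b = 1")
    case True
    then show ?thesis using rec[of 1] one_N q_root_nz by auto
  next
    case False
    then obtain b' where b': "b = Suc b'" "1 \<le> b'" using b by (cases b) auto
    then show ?thesis using rec[OF b] sum[of b'] b \<nu>_nz[OF q1]
      by (auto simp: atLeastLessThanSuc_atLeastAtMost)
  qed
qed


section \<open>The matrix of functionals Q\<close>

abbreviation Q :: "nat \<Rightarrow> nat \<Rightarrow> 'g \<Rightarrow> complex" where "Q k l h \<equiv> Q_form copG r h (u k l)"

abbreviation M :: "'g set" where "M \<equiv> coinvariant_algebra copG \<alpha>"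

lemma bilinear_rr: "cbilinear (\<lambda>h1 h2. r a h1 * r h2 b)"
  by (rule cbilinearI; intro linear_rules r_linear_rules)

lemma Q_expand:
  assumes "k \<in> {1..N}" "l \<in> {1..N}"
  shows "Q k l h = (\<Sum>p\<in>{1..N}. tlift (\<lambda>h1 h2. r (u k p) h1 * r h2 (u p l)) (copG h))"
proof -
  have "cbilinear (\<lambda>g1 g2. tlift (\<lambda>h1 h2. r g1 h1 * r h2 g2) (copG h))"
    by (rule cbilinearI; intro linear_rules r_linear_rules bilinear_rr)
  then show ?thesis
    using assms by (simp add: Q_form_def cop_u clinear_sum[OF clinear_tlift] tlift_tensor)
qed

lemma clinear_Q:
  assumes "k \<in> {1..N}" "l \<in> {1..N}"
  shows "clinear (Q k l)"
  unfolding Q_expand[OF assms] by (intro linear_rules bilinear_rr G.cop_linear)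

lemma Q_one:
  assumes "k \<in> {1..N}" "l \<in> {1..N}"
  shows "Q k l 1 = of_bool (k = l)"
  using assms by (simp add: Q_expand G.cop_one tlift_tensor[OF bilinear_rr] r_one_u of_bool_def
      if_distrib[of "\<lambda>x. x * _"] cong: if_cong)

text \<open>The given R already contains the flip, so the double braiding of two generators is the
  square of R up to the factor from the root, and the Hecke relation
  \<open>R^2 = 1 + \<nu> R\<close> makes it affine in R.\<close>

lemma Q_u:
  assumes "i \<in> {1..N}" "j \<in> {1..N}" "k \<in> {1..N}" "l \<in> {1..N}"
  shows "Q k l (u i j) = c\<^sup>2 * (of_bool (i = j \<and> k = l) + \<nu> * rmat q i k j l)"
proof -
  have q_nz: "complex_of_real q \<noteq> 0" "q \<noteq> 0" using q by auto
  have "Q k l (u i j) = c\<^sup>2 * (\<Sum>p\<in>{1..N}. \<Sum>t\<in>{1..N}. rmat q i k p t * rmat q p t j l)"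
    using assms by (simp add: Q_expand cop_u clinear_sum[OF clinear_tlift[OF bilinear_rr]]
        tlift_tensor[OF bilinear_rr] r_gen) (simp add: sum_distrib_left power2_eq_square mult_ac)
  also have "(\<Sum>p\<in>{1..N}. \<Sum>t\<in>{1..N}. rmat q i k p t * rmat q p t j l)
      = of_bool (i = j \<and> k = l) + \<nu> * rmat q i k j l"
    using q q_nz assms(1,3) by (subst sum_rmat_lower) (auto simp: rmat_def field_simps)
  finally show ?thesis .
qed

text \<open>Matrix coefficients of the fundamental corepresentation tensored with its dual. Pairs
  serve as indices so that y is itself a matrix coalgebra; the z form its column at (1,1).\<close>

definition y :: "nat \<times> nat \<Rightarrow> nat \<times> nat \<Rightarrow> 'g"
  where "y p p' = u (fst p) (fst p') * s (snd p') (snd p)"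

abbreviation z :: "nat \<times> nat \<Rightarrow> 'g" where "z p \<equiv> y p (1, 1)"

abbreviation IJ :: "(nat \<times> nat) set" where "IJ \<equiv> {1..N} \<times> {1..N}"

lemma cop_y:
  assumes "p \<in> IJ" "p' \<in> IJ"
  shows "copG (y p p') = (\<Sum>t\<in>IJ. y p t \<otimes> y t p')"
  using assms by (auto simp: y_def G.cop_hom cop_u cop_s sum_product tensor_mult sum.cartesian_product
      intro!: sum.cong)

lemma cop_z:
  assumes "a \<in> {1..N}" "b \<in> {1..N}"
  shows "copG (z (a, b)) = (\<Sum>t\<in>{1..N}. \<Sum>n\<in>{1..N}. (u a t * s n b) \<otimes> (u t 1 * s 1 n))"
  using cop_y[of "(a, b)" "(1, 1)"] assms one_N by (simp add: y_def sum.cartesian_product case_prod_beta)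

lemma eps_y:
  assumes "p \<in> IJ" "p' \<in> IJ"
  shows "epsG (y p p') = of_bool (p = p')"
  using assms by (auto simp: y_def G.eps_mult eps_u eps_s prod_eq_iff)

text \<open>Split both products by multiplicativity of r. On the right, \<open>r_s_u\<close> makes
  the factor from s diagonal and leaves only \<open>n = 1\<close>; on the left, the factor
  \<open>r (u k x) (s 1 b)\<close> comes out in front. What stays between them is the double
  braiding with \<open>u a 1\<close>.\<close>

lemma Q_z:
  assumes "a \<in> {1..N}" "b \<in> {1..N}" "k \<in> {1..N}" "l \<in> {1..N}"
  shows "Q k l (z (a, b)) = c * (if l = 1 then inverse (of_real q) else 1) *
    (\<Sum>x\<in>{1..N}. r (u k x) (s 1 b) * (of_bool (a = 1 \<and> x = l) + \<nu> * rmat q a x 1 l))"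
proof -
  let ?q = "if l = 1 then inverse (of_real q) else 1 :: complex"
  have zr: "r (u t 1 * s 1 n) (u p l) = of_bool (n = 1) * q_root * ?q * r (u t 1) (u p l)"
    if "t \<in> {1..N}" "n \<in> {1..N}" "p \<in> {1..N}" for t n p
  proof -
    have "r (u t 1 * s 1 n) (u p l) = (\<Sum>x\<in>{1..N}. r (u t 1) (u p x) * r (s 1 n) (u x l))"
      using assms that by (simp add: r_mult_u)
    also have "\<dots> = (\<Sum>x\<in>{1..N}. if x = l then of_bool (n = 1) * q_root * ?q * r (u t 1) (u p l) else 0)"
      using assms that by (intro sum.cong refl) (auto simp: r_s_u)
    finally show ?thesis using assms by simp
  qed
  have "Q k l (z (a, b)) = (\<Sum>p\<in>{1..N}. \<Sum>t\<in>{1..N}. \<Sum>n\<in>{1..N}.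
      r (u k p) (u a t * s n b) * r (u t 1 * s 1 n) (u p l))"
    unfolding Q_expand[OF assms(3,4)] cop_z[OF assms(1,2)]
    by (simp add: clinear_sum[OF clinear_tlift[OF bilinear_rr]] tlift_tensor[OF bilinear_rr])
  also have "\<dots> = (\<Sum>p\<in>{1..N}. \<Sum>t\<in>{1..N}. \<Sum>n\<in>{1..N}. if n = 1 then
      q_root * ?q * (r (u k p) (u a t * s 1 b) * r (u t 1) (u p l)) else 0)"
    by (intro sum.cong refl) (auto simp: zr)
  also have "\<dots> = q_root * ?q * (\<Sum>p\<in>{1..N}. \<Sum>t\<in>{1..N}. \<Sum>x\<in>{1..N}.
      r (u k x) (s 1 b) * (r (u x p) (u a t) * r (u t 1) (u p l)))"
    using one_N assms by (simp add: r_u_mult sum_distrib_left sum_distrib_right mult_ac)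
  also have "(\<Sum>p\<in>{1..N}. \<Sum>t\<in>{1..N}. \<Sum>x\<in>{1..N}.
      r (u k x) (s 1 b) * (r (u x p) (u a t) * r (u t 1) (u p l)))
    = (\<Sum>x\<in>{1..N}. \<Sum>p\<in>{1..N}. \<Sum>t\<in>{1..N}.
      r (u k x) (s 1 b) * (r (u x p) (u a t) * r (u t 1) (u p l)))"
    by (rule trans[OF sum.cong[OF refl sum.swap] sum.swap])
  also have "\<dots> = (\<Sum>x\<in>{1..N}. r (u k x) (s 1 b) * Q x l (u a 1))"
    using assms one_N by (simp add: Q_expand cop_u clinear_sum[OF clinear_tlift[OF bilinear_rr]]
        tlift_tensor[OF bilinear_rr] sum_distrib_left)
  also have "q_root * ?q * \<dots> = c * ?q *
      (\<Sum>x\<in>{1..N}. r (u k x) (s 1 b) * (of_bool (a = 1 \<and> x = l) + \<nu> * rmat q a x 1 l))"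
    (is "_ = c * ?q * ?S")
  proof -
    have "(\<Sum>x\<in>{1..N}. r (u k x) (s 1 b) * Q x l (u a 1)) = c\<^sup>2 * ?S"
      unfolding sum_distrib_left using assms one_N by (intro sum.cong) (simp_all add: Q_u)
    moreover have "q_root * X * (c\<^sup>2 * S) = c * X * S" for X S
      using q_root_nz by (simp add: power2_eq_square)
    ultimately show ?thesis by simp
  qed
  finally show ?thesis .
qed

lemma Q_z_row:
  assumes "a \<in> {2..N}" "b \<in> {1..N}" "k \<in> {1..N}" "l \<in> {1..N}"
  shows "Q k l (z (a, b)) = c * \<nu> * \<tau> b * of_bool (k = b \<and> l = a)"
proof -
  have "(\<Sum>x\<in>{1..N}. r (u k x) (s 1 b) * (of_bool (a = 1 \<and> x = l) + \<nu> * rmat q a x 1 l))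
    = (\<Sum>x\<in>{1..N}. if x = 1 then r (u k 1) (s 1 b) * \<nu> * of_bool (a = l) else 0)"
    using assms by (intro sum.cong refl) (auto simp: rmat_def)
  also have "\<dots> = \<nu> * \<tau> b * of_bool (k = b \<and> l = a)"
    using assms one_N by (auto simp: r_u_s_first)
  finally have S: "(\<Sum>x\<in>{1..N}. r (u k x) (s 1 b) * (of_bool (a = 1 \<and> x = l) + \<nu> * rmat q a x 1 l))
    = \<nu> * \<tau> b * of_bool (k = b \<and> l = a)" .
  show ?thesis
    using assms by (subst Q_z) (simp_all only: S, auto)
qed

lemma Q_z_first_column:
  assumes "b \<in> {1..N}" "k \<in> {1..N}"
  shows "Q k 1 (z (1, b)) = c * of_real q * \<tau> b * of_bool (k = b)"
proof -
  have "(\<Sum>x\<in>{1..N}. r (u k x) (s 1 b) * (of_bool (1 = 1 \<and> x = 1) + \<nu> * rmat q 1 x 1 1))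
    = (\<Sum>x\<in>{1..N}. if x = 1 then r (u k 1) (s 1 b) * (1 + \<nu> * of_real q) else 0)"
    by (intro sum.cong refl) (auto simp: rmat_def)
  \<comment> \<open>Here \<open>1 + \<nu> * q\<close> is the square of q; the prefactor
    \<open>1 / q\<close> of \<open>Q_z\<close> at \<open>l = 1\<close> then leaves one q.\<close>
  also have "\<dots> = of_bool (k = b) * \<tau> b * (of_real q)\<^sup>2"
    using assms one_N q by (simp add: r_u_s_first field_simps power2_eq_square)
  finally have S: "(\<Sum>x\<in>{1..N}. r (u k x) (s 1 b) * (of_bool (1 = (1::nat) \<and> x = 1) + \<nu> * rmat q 1 x 1 1))
    = of_bool (k = b) * \<tau> b * (of_real q)\<^sup>2" by simp
  show ?thesis
    using assms one_N q by (subst Q_z) (simp_all only: S, auto simp: power2_eq_square)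
qed

text \<open>Outside the first column only \<open>b = 1\<close> contributes, through a scalar matrix.
  Thus \<open>z (1, b)\<close> with \<open>b \<ge> 2\<close> still gives a matrix unit, whereas
  \<open>z (1, 1)\<close> does not and must be left out of the dual family.\<close>

lemma Q_z_other:
  assumes "b \<in> {1..N}" "k \<in> {1..N}" "l \<in> {2..N}"
  shows "Q k l (z (1, b)) = (1 + \<nu>\<^sup>2) * of_bool (b = 1 \<and> k = l)"
proof -
  have "(\<Sum>x\<in>{1..N}. r (u k x) (s 1 b) * (of_bool (1 = 1 \<and> x = l) + \<nu> * rmat q 1 x 1 l))
    = (\<Sum>x\<in>{1..N}. if x = l then r (u k l) (s 1 b) * (1 + \<nu>\<^sup>2) else 0)"
    using assms by (intro sum.cong refl) (auto simp: rmat_def power2_eq_square algebra_simps)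
  also have "\<dots> = q_root * (1 + \<nu>\<^sup>2) * of_bool (b = 1 \<and> k = l)"
    using assms by (auto simp: r_u_s_offdiag)
  finally have S: "(\<Sum>x\<in>{1..N}. r (u k x) (s 1 b) * (of_bool (1 = (1::nat) \<and> x = l) + \<nu> * rmat q 1 x 1 l))
    = q_root * (1 + \<nu>\<^sup>2) * of_bool (b = 1 \<and> k = l)" by simp
  show ?thesis
    using assms one_N q_root_nz by (subst Q_z) (simp_all only: S, auto)
qed


section \<open>The character by which the corner of Q acts\<close>

lemma qdet_scalar:
  "qdet q n (\<lambda>i j. d * of_bool (i = j) :: complex) = d ^ n"
proof -
  have "prod_list (map (\<lambda>i. d * of_bool (i = \<pi> i)) [1..<Suc n]) = (0::complex)"
    if "\<pi> permutes {1..n}" "\<pi> \<noteq> id" for \<pi>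
  proof -
    obtain i where i: "\<pi> i \<noteq> i" using \<open>\<pi> \<noteq> id\<close> by (auto simp: fun_eq_iff)
    then have "i \<in> {1..n}" using that(1) by (auto simp: permutes_def)
    then have "i \<in> set [1..<Suc n]" by (simp del: upt_Suc add: less_Suc_eq_le)
    then have "0 \<in> set (map (\<lambda>i. d * of_bool (i = \<pi> i)) [1..<Suc n])" using i by (force simp: image_iff)
    then show ?thesis by (simp only: prod_list_zero_iff)
  qed
  moreover have "{(i::nat, j). 1 \<le> i \<and> i < j \<and> j \<le> n \<and> j < i} = {}" by auto
  then have "inv_count n id = 0" unfolding inv_count_def id_apply by (simp only: card.empty)
  moreover have "prod_list (map (\<lambda>i. d * of_bool (i = id i)) [1..<Suc n]) = d ^ n"
    by (simp add: map_replicate_const del: upt_Suc)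
  ultimately have "qdet q n (\<lambda>i j. d * of_bool (i = j))
    = (\<Sum>\<pi> | \<pi> permutes {1..n}. if \<pi> = id then d ^ n else 0)"
    unfolding qdet_def
    by (intro sum.cong refl) (simp_all add: scaleC_complex_def del: upt_Suc)
  also have "\<dots> = d ^ n"
    by (simp add: finite_permutations permutes_id)
  finally show ?thesis .
qed

lemma free_eval_qdet: "free_eval f (qdet q n fU) = qdet q n (\<lambda>i j. f (U i j))"
  by (simp add: qdet_def free_eval_simps free_eval_prod_list o_def)

lemma gen_induct [case_names one gen mult add scale]:
  assumes "P 1" "\<And>i j. i \<in> {1..N} \<Longrightarrow> j \<in> {1..N} \<Longrightarrow> P (u i j)" "\<And>a b. P a \<Longrightarrow> P b \<Longrightarrow> P (a * b)"
    "\<And>a b. P a \<Longrightarrow> P b \<Longrightarrow> P (a + b)" "\<And>c a. P a \<Longrightarrow> P (c *\<^sub>C a)"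
  shows "P h"
  using SU(1)[unfolded presents_SU_def]
  by (induct h rule: presented_induct) (use assms in \<open>auto simp: mat_gens_def\<close>)

text \<open>A scalar matrix satisfies the R-matrix relations and has quantum determinant
  \<open>c ^ (N - 1)\<close>. So \<open>det_inv\<close> must go to the reciprocal, which is
  \<open>c * q\<close> because \<open>q_root ^ N = q\<close>. Pulled back along
  \<open>\<alpha>\<close>, this character turns out to be pairing with \<open>u 1 1\<close>.\<close>

lemma character_exists:
  obtains \<psi> :: "'k \<Rightarrow> complex" where "clinear \<psi>" "\<psi> 1 = 1" "\<And>a b. \<psi> (a * b) = \<psi> a * \<psi> b"
    "\<And>i j. i \<in> {1..N} \<Longrightarrow> j \<in> {1..N} \<Longrightarrow>
      \<psi> (\<alpha> (u i j)) = c * (if i = 1 then of_real q else 1) * of_bool (i = j)"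
proof -
  let ?g = "case_qgen (\<lambda>i j. c * of_bool (i = j)) (c * of_real q)"
  have det: "c ^ (N - 1) * (c * of_real q) = 1"
  proof -
    have "c ^ (N - 1) * c = c ^ N" using N by (cases N) auto
    then show ?thesis using q q_root by (simp add: power_inverse flip: mult.assoc)
  qed
  have rels: "free_eval ?g p = 0" if "p \<in> rtt_rels q (N - 1) \<union>
      {qdet q (N - 1) fU * free_gen DetInv - 1, free_gen DetInv * qdet q (N - 1) fU - 1}" for p
  proof -
    from that consider "p \<in> rtt_rels q (N - 1)" | "p = qdet q (N - 1) fU * free_gen DetInv - 1"
      | "p = free_gen DetInv * qdet q (N - 1) fU - 1" by blast
    then show "free_eval ?g p = 0"
    proof cases
      case 1
      then show ?thesis
        by (auto simp: rtt_rels_def free_eval_simps scaleC_complex_def of_bool_def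
            if_distrib[of "\<lambda>x. x * _"] if_distrib[of "\<lambda>x. _ * x"] cong: if_cong)
    next
      case 2
      then show ?thesis using det by (simp add: free_eval_simps free_eval_qdet qdet_scalar)
    next
      case 3
      then show ?thesis using det by (simp add: free_eval_simps free_eval_qdet qdet_scalar mult.commute)
    qed
  qed
  obtain \<psi> where \<psi>: "clinear \<psi>" "\<psi> 1 = 1" "\<And>a b. \<psi> (a * b) = \<psi> a * \<psi> b"
    "\<And>x. x \<in> insert DetInv (mat_gens (N - 1)) \<Longrightarrow> \<psi> (case_qgen uU det_inv x) = ?g x"
    using presented_hom_exists[OF U(1)[unfolded presents_U_def] rels] by blast
  show thesis
  proof (rule that[OF \<psi>(1,2,3)])
    fix i j assume ij: "i \<in> {1..N}" "j \<in> {1..N}"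
    consider "i = 1" "j = 1" | "i = 1" "j \<in> {2..N}" | "i \<in> {2..N}" "j = 1" | "i \<in> {2..N}" "j \<in> {2..N}"
      using ij by fastforce
    then show "\<psi> (\<alpha> (u i j)) = c * (if i = 1 then of_real q else 1) * of_bool (i = j)"
    proof cases
      case 4
      then have "U (i - 1) (j - 1) \<in> mat_gens (N - 1)" by (auto simp: mat_gens_def)
      then show ?thesis using 4 \<psi>(4)[of "U (i - 1) (j - 1)"] by (auto simp: \<alpha>_ij)
    qed (use \<psi>(4)[of DetInv] in \<open>auto simp: \<alpha>_11 \<alpha>_1i clinear_0[OF \<psi>(1)]\<close>)
  qed
qed

text \<open>On generators this is the triangularity of R at the smallest index. It passes to
  products because in the sum over the intermediate index one factor always has the same vanishing
  shape.\<close>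

lemma r_u1_eq_0:
  assumes p: "p \<in> {2..N}"
  shows "r (u 1 p) h = 0" and "r h (u p 1) = 0"
proof -
  have "\<forall>p\<in>{2..N}. r (u 1 p) h = 0 \<and> r h (u p 1) = 0" for h
  proof (induct h rule: gen_induct)
    case (mult a b)
    have "r (u 1 p) (a * b) = 0" "r (a * b) (u p 1) = 0" if "p \<in> {2..N}" for p
    proof -
      have t: "t = 1 \<or> t \<in> {2..N}" if "t \<in> {1..N}" for t :: nat using that by auto
      have p: "p \<in> {1..N}" using that by auto
      show "r (u 1 p) (a * b) = 0"
        unfolding r_u_mult[OF one_N p] using t that mult by (intro sum.neutral ballI) fastforce
      show "r (a * b) (u p 1) = 0"
        unfolding r_mult_u[OF p one_N] using t that mult by (intro sum.neutral ballI) fastforce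
    qed
    then show ?case by blast
  qed (use one_N in \<open>auto simp: r_one_u r_gen rmat_def clinear_add[OF r_left] clinear_add[OF r_right]
      clinear_scale[OF r_left] clinear_scale[OF r_right]\<close>)
  then show "r (u 1 p) h = 0" "r h (u p 1) = 0" using p by blast+
qed

lemma sum_first: "(\<And>t. t \<in> {2..N} \<Longrightarrow> f t = 0) \<Longrightarrow> (\<Sum>t\<in>{1..N}. f t) = f 1"
  for f :: "nat \<Rightarrow> 'x::comm_monoid_add"
  using one_N by (subst sum.remove[of _ 1]) (auto intro!: sum.neutral)

lemma coinvariant_tlift:
  assumes m: "m \<in> M" and b: "cbilinear b"
  shows "tlift (\<lambda>h1 h2. b h1 (\<alpha> h2)) (copG m) = b m 1"
proof -
  have "tlift (\<lambda>h1 h2. b h1 (\<alpha> h2)) (copG m) = tlift b (tmap id \<alpha> (copG m))"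
    by (simp add: tlift_tmap b clinear_id H.hom_linear)
  also have "\<dots> = b m 1"
    using m by (simp add: coinvariant_algebra_def tlift_tensor[OF b])
  finally show ?thesis .
qed

lemma \<alpha>_coinvariant:
  assumes "m \<in> M"
  shows "\<alpha> m = epsG m *\<^sub>C 1"
proof -
  have b: "cbilinear (\<lambda>h1 h2. epsG h1 *\<^sub>C h2)" for h2 :: "'x::complex_vector"
    by (rule cbilinearI; intro G.hopf_linear_rules)
  have "\<alpha> m = \<alpha> (tlift (\<lambda>h1 h2. epsG h1 *\<^sub>C h2) (copG m))"
    by (simp add: G.counit_left)
  also have "\<dots> = tlift (\<lambda>h1 h2. epsG h1 *\<^sub>C \<alpha> h2) (copG m)"
    by (subst clinear_comp_tlift[OF H.hom_linear b]) (simp add: clinear_scale[OF H.hom_linear])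
  also have "\<dots> = epsG m *\<^sub>C 1"
    by (rule coinvariant_tlift[OF assms b])
  finally show ?thesis .
qed

text \<open>By \<open>r_u1_eq_0\<close> only the intermediate index 1 contributes to the corner of
  Q, and pairing with \<open>u 1 1\<close> on either side is multiplicative. Comparison on
  generators identifies both pairings with \<open>\<psi>\<close> after \<open>\<alpha>\<close>, and
  then coinvariance removes the second leg.\<close>

lemma Q_11_coinvariant:
  assumes m: "m \<in> M"
  shows "Q 1 1 m = epsG m"
proof -
  obtain \<psi> :: "'k \<Rightarrow> complex" where \<psi>: "clinear \<psi>" "\<psi> 1 = 1" "\<And>a b. \<psi> (a * b) = \<psi> a * \<psi> b"
    "\<And>i j. i \<in> {1..N} \<Longrightarrow> j \<in> {1..N} \<Longrightarrow>
      \<psi> (\<alpha> (u i j)) = c * (if i = 1 then of_real q else 1) * of_bool (i = j)"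
    using character_exists by blast
  have char: "r (u 1 1) h = \<psi> (\<alpha> h) \<and> r h (u 1 1) = \<psi> (\<alpha> h)" for h
  proof (induct h rule: gen_induct)
    case (mult a b)
    have "r (u 1 1) (a * b) = r (u 1 1) b * r (u 1 1) a" "r (a * b) (u 1 1) = r a (u 1 1) * r b (u 1 1)"
      unfolding r_u_mult[OF one_N one_N] r_mult_u[OF one_N one_N]
      by (rule sum_first, simp add: r_u1_eq_0)+
    then show ?case using mult by (simp add: H.hom_mult \<psi>(3))
  qed (use one_N in \<open>auto simp: r_one_u r_gen rmat_def \<psi>(2,4) H.hom_one clinear_add[OF r_left] clinear_add[OF r_right]
      clinear_scale[OF r_left] clinear_scale[OF r_right] clinear_add[OF \<psi>(1)] clinear_scale[OF \<psi>(1)]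
      clinear_add[OF H.hom_linear] clinear_scale[OF H.hom_linear]\<close>)
  have bil: "cbilinear (\<lambda>h1 k. \<psi> (\<alpha> h1) * \<psi> k)"
    by (rule cbilinearI; intro linear_rules clinear_compose[OF \<psi>(1)] H.hom_linear \<psi>(1))
  have "Q 1 1 m = tlift (\<lambda>h1 h2. \<psi> (\<alpha> h1) * \<psi> (\<alpha> h2)) (copG m)"
  proof -
    have "tlift (\<lambda>h1 h2. r (u 1 t) h1 * r h2 (u t 1)) (copG m) = 0" if "t \<in> {2..N}" for t
      using that by (simp add: r_u1_eq_0 clinear_zero tlift_def lincomb_def case_prod_beta)
    then have "(\<Sum>t\<in>{1..N}. tlift (\<lambda>h1 h2. r (u 1 t) h1 * r h2 (u t 1)) (copG m))
      = tlift (\<lambda>h1 h2. r (u 1 1) h1 * r h2 (u 1 1)) (copG m)"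
      by (rule sum_first)
    then show ?thesis
      unfolding Q_expand[OF one_N one_N] by (simp add: char)
  qed
  also have "\<dots> = \<psi> (\<alpha> m) * \<psi> 1"
    by (rule coinvariant_tlift[OF m bil])
  also have "\<dots> = epsG m"
    by (simp add: \<alpha>_coinvariant[OF m] \<psi>(2) clinear_scale[OF \<psi>(1)] scaleC_complex_def)
  finally show ?thesis .
qed

text \<open>For \<open>q = 1\<close> the R-matrix is the flip.\<close>

lemma Q_classical:
  assumes q1: "q = 1" and kl: "k \<in> {1..N}" "l \<in> {1..N}"
  shows "Q k l h = of_bool (k = l) * Q 1 1 h"
proof -
  have delta: "(\<Sum>t\<in>{1..N}. of_bool (k = t) * A * (of_bool (t = p) * B)) = of_bool (k = p) * (A * B)"
    if "k \<in> {1..N}" for k p and A B :: complex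
  proof -
    have "(\<Sum>t\<in>{1..N}. of_bool (k = t) * A * (of_bool (t = p) * B))
      = (\<Sum>t\<in>{1..N}. if t = k then of_bool (k = p) * (A * B) else 0)"
      by (intro sum.cong) auto
    then show ?thesis using that by simp
  qed
  have "\<exists>X Y. \<forall>k\<in>{1..N}. \<forall>p\<in>{1..N}. r (u k p) h = of_bool (k = p) * X \<and> r h (u k p) = of_bool (k = p) * Y"
    for h
  proof (induct h rule: gen_induct)
    case one
    show ?case by (intro exI[of _ 1]) (auto simp: r_one_u)
  next
    case (gen i j)
    then show ?case using q1
      by (intro exI[of _ "c * of_bool (i = j)"]) (auto simp: r_gen rmat_def)
  next
    case (mult a b)
    obtain Xa Ya where a: "\<And>k p. k \<in> {1..N} \<Longrightarrow> p \<in> {1..N} \<Longrightarrow>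
      r (u k p) a = of_bool (k = p) * Xa \<and> r a (u k p) = of_bool (k = p) * Ya" using mult(1) by blast
    obtain Xb Yb where b: "\<And>k p. k \<in> {1..N} \<Longrightarrow> p \<in> {1..N} \<Longrightarrow>
      r (u k p) b = of_bool (k = p) * Xb \<and> r b (u k p) = of_bool (k = p) * Yb" using mult(2) by blast
    have "r (u k p) (a * b) = of_bool (k = p) * (Xb * Xa)" "r (a * b) (u k p) = of_bool (k = p) * (Ya * Yb)"
      if kp: "k \<in> {1..N}" "p \<in> {1..N}" for k p
    proof -
      have "r (u k p) (a * b) = (\<Sum>t\<in>{1..N}. of_bool (k = t) * Xb * (of_bool (t = p) * Xa))"
        unfolding r_u_mult[OF kp] using a b kp by (intro sum.cong) auto
      then show "r (u k p) (a * b) = of_bool (k = p) * (Xb * Xa)"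
        by (simp only: delta[OF kp(1)])
      have "r (a * b) (u k p) = (\<Sum>t\<in>{1..N}. of_bool (k = t) * Ya * (of_bool (t = p) * Yb))"
        unfolding r_mult_u[OF kp] using a b kp by (intro sum.cong) auto
      then show "r (a * b) (u k p) = of_bool (k = p) * (Ya * Yb)"
        by (simp only: delta[OF kp(1)])
    qed
    then show ?case by blast
  next
    case (add a b)
    then obtain Xa Ya Xb Yb where "\<forall>k\<in>{1..N}. \<forall>p\<in>{1..N}.
        r (u k p) a = of_bool (k = p) * Xa \<and> r a (u k p) = of_bool (k = p) * Ya"
      "\<forall>k\<in>{1..N}. \<forall>p\<in>{1..N}. r (u k p) b = of_bool (k = p) * Xb \<and> r b (u k p) = of_bool (k = p) * Yb"
      by blast
    then show ?case
      by (intro exI[of _ "Xa + Xb"] exI[of _ "Ya + Yb"])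
        (simp add: clinear_add[OF r_left] clinear_add[OF r_right] distrib_left)
  next
    case (scale d a)
    then obtain Xa Ya where "\<forall>k\<in>{1..N}. \<forall>p\<in>{1..N}.
        r (u k p) a = of_bool (k = p) * Xa \<and> r a (u k p) = of_bool (k = p) * Ya"
      by blast
    then show ?case
      by (intro exI[of _ "d * Xa"] exI[of _ "d * Ya"])
        (simp add: clinear_scale[OF r_left] clinear_scale[OF r_right] scaleC_complex_def)
  qed
  then have char: "r (u k p) h = of_bool (k = p) * r (u 1 1) h \<and> r h (u k p) = of_bool (k = p) * r h (u 1 1)"
    if "k \<in> {1..N}" "p \<in> {1..N}" for k p h
    using that one_N by (metis mult_1 of_bool_eq(2))
  have *: "Q k l h = of_bool (k = l) * tlift (\<lambda>h1 h2. r (u 1 1) h1 * r h2 (u 1 1)) (copG h)"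
    if kl: "k \<in> {1..N}" "l \<in> {1..N}" for k l
  proof -
    have "tlift (\<lambda>h1 h2. r (u k t) h1 * r h2 (u t l)) (copG h)
      = (if t = k then of_bool (k = l) * tlift (\<lambda>h1 h2. r (u 1 1) h1 * r h2 (u 1 1)) (copG h) else 0)"
      if "t \<in> {1..N}" for t
    proof (rule clinear_tensor_eqI)
      show "clinear (tlift (\<lambda>h1 h2. r (u k t) h1 * r h2 (u t l)))"
        by (rule clinear_tlift[OF bilinear_rr])
      show "clinear (\<lambda>x. if t = k then of_bool (k = l) * tlift (\<lambda>h1 h2. r (u 1 1) h1 * r h2 (u 1 1)) x else 0)"
        by (cases "t = k") (auto intro!: linear_rules bilinear_rr)
      have rk: "r (u k t) a = of_bool (k = t) * r (u 1 1) a" "r b (u t l) = of_bool (t = l) * r b (u 1 1)" for a b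
        using char[of k t a] char[of t l b] that kl by auto
      show "tlift (\<lambda>h1 h2. r (u k t) h1 * r h2 (u t l)) (a \<otimes> b)
        = (if t = k then of_bool (k = l) * tlift (\<lambda>h1 h2. r (u 1 1) h1 * r h2 (u 1 1)) (a \<otimes> b) else 0)" for a b
        unfolding tlift_tensor[OF bilinear_rr] rk(1)[of a] rk(2)[of b] by auto
    qed
    then show ?thesis using kl by (simp add: Q_expand)
  qed
  show ?thesis using *[OF kl] *[OF one_N one_N] by simp
qed

end

locale quantum_projective_calculus = quantum_projective_space +
  fixes cls :: "'a \<Rightarrow> 'l::complex_vector" and \<delta> :: "'l \<Rightarrow> ('l, 'b) tensor"
  assumes cls: "is_quotient_map (augmentation_ideal epsG) (ideal_SU N u copG epsG antG r) cls"
    and \<delta>: "is_V_coaction copG epsG antU \<alpha> cls \<delta>"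
begin

section \<open>The invariant forms on the quantum projective space\<close>

abbreviation Gp :: "'a set" where "Gp \<equiv> augmentation_ideal epsG"

lemma clinear_cls: "clinear cls"
  using cls by (simp add: is_quotient_map_def)

lemma cls_eq_0_iff: "h \<in> Gp \<Longrightarrow> cls h = 0 \<longleftrightarrow> h \<in> ideal_SU N u copG epsG antG r"
  using cls by (auto simp: is_quotient_map_def)

lemma cls_surj: "\<exists>h\<in>Gp. cls h = x"
proof -
  have "x \<in> cls ` Gp" using cls by (simp add: is_quotient_map_def)
  then show ?thesis by auto
qed

lemma subspace_Gp: "csubspace Gp"
  using G.eps_linear by (simp add: cvec.subspace_def augmentation_ideal_def clinear_iff clinear_0)

lemma ideal_SU_I:
  assumes "a \<in> ker_Q N u copG r \<inter> Gp" "b \<in> cspan {u i 1 * s 1 i | i. i \<in> {2..N}}"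
    "d \<in> cspan {u i j | i j. i \<in> {2..N} \<and> j \<in> {2..N} \<and> i \<noteq> j}"
  shows "a + b + d \<in> ideal_SU N u copG epsG antG r"
  using assms unfolding ideal_SU_def by blast

lemma zero_ker_Q: "0 \<in> ker_Q N u copG r \<inter> Gp"
  using clinear_0[OF clinear_Q] cvec.subspace_0[OF subspace_Gp] by (auto simp: ker_Q_def)

lemma cls_ker_Q: "h \<in> Gp \<Longrightarrow> (\<And>k l. k \<in> {1..N} \<Longrightarrow> l \<in> {1..N} \<Longrightarrow> Q k l h = 0) \<Longrightarrow> cls h = 0"
  using ideal_SU_I[OF _ cvec.span_zero cvec.span_zero, of h] by (simp add: cls_eq_0_iff ker_Q_def)

lemma cls_u_offdiag:
  assumes "i \<in> {2..N}" "j \<in> {2..N}" "i \<noteq> j"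
  shows "cls (u i j) = 0"
proof -
  have "u i j \<in> cspan {u i j | i j. i \<in> {2..N} \<and> j \<in> {2..N} \<and> i \<noteq> j}"
    using assms by (intro cvec.span_base) blast
  from ideal_SU_I[OF zero_ker_Q cvec.span_zero this] show ?thesis
    using assms by (subst cls_eq_0_iff) (simp_all add: augmentation_ideal_def eps_u)
qed

lemma cls_z_diag:
  assumes "i \<in> {2..N}"
  shows "cls (z (i, i)) = 0"
proof -
  have "z (i, i) \<in> cspan {u i 1 * s 1 i | i. i \<in> {2..N}}"
    using assms by (intro cvec.span_base) (auto simp: y_def)
  from ideal_SU_I[OF zero_ker_Q this cvec.span_zero] show ?thesis
    using assms one_N by (subst cls_eq_0_iff) (simp_all add: augmentation_ideal_def eps_y)
qed

lemma \<alpha>_s: "i \<in> {2..N} \<Longrightarrow> \<alpha> (s 1 i) = 0 \<and> \<alpha> (s i 1) = 0"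
  by (simp add: \<alpha>_1i clinear_0[OF H.cod.ant_linear] flip: H.hom_ant)

text \<open>The coaction sends \<open>z p\<close> to the sum of
  \<open>y p t \<otimes> \<alpha> (z t)\<close>. Since \<open>\<alpha>\<close> kills the first
  column of u and the first row of s beyond the corner, only \<open>t = (1, 1)\<close> survives,
  where the value is 1.\<close>

lemma z_in_M:
  assumes p: "p \<in> IJ"
  shows "z p \<in> M"
proof -
  have "\<alpha> (u 1 1) * \<alpha> (s 1 1) = (\<Sum>k\<in>{1..N}. \<alpha> (u 1 k) * \<alpha> (s k 1))"
    by (rule sum_first[symmetric]) (simp add: \<alpha>_1i)
  also have "\<dots> = \<alpha> (\<Sum>k\<in>{1..N}. u 1 k * s k 1)"
    by (simp add: H.hom_mult clinear_sum[OF H.hom_linear])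
  also have "\<dots> = 1"
    using one_N by (simp add: u_s H.hom_one)
  finally have one: "\<alpha> (u 1 1) * \<alpha> (s 1 1) = 1" .
  have \<alpha>_z: "\<alpha> (z t) = of_bool (t = (1, 1))" if "t \<in> IJ" for t
  proof (cases "t = (1, 1)")
    case False
    then have "fst t \<in> {2..N} \<or> snd t \<in> {2..N}" using that by (cases t) auto
    then show ?thesis using False by (auto simp: y_def H.hom_mult \<alpha>_1i \<alpha>_s)
  qed (simp add: y_def H.hom_mult one)
  have "tmap id \<alpha> (copG (z p)) = (\<Sum>t\<in>IJ. y p t \<otimes> \<alpha> (z t))"
    using p one_N
    by (subst cop_y) (auto simp: clinear_sum[OF clinear_tmap[OF clinear_id H.hom_linear clinear_ident]]
      tmap_tensor[OF clinear_id H.hom_linear])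
  also have "\<dots> = (\<Sum>t\<in>IJ. if t = (1, 1) then z p \<otimes> 1 else 0)"
    by (intro sum.cong refl) (auto simp: \<alpha>_z)
  also have "\<dots> = z p \<otimes> 1" using one_N by simp
  finally show ?thesis by (simp add: coinvariant_algebra_def)
qed

section \<open>The coaction on the classes of the z\<close>

definition P_plus :: "(nat \<times> nat) set" where "P_plus = {2..N} \<times> {1}"

definition P_minus :: "(nat \<times> nat) set" where "P_minus = {1} \<times> {2..N}"

abbreviation F :: "(nat \<times> nat) set" where "F \<equiv> P_plus \<union> P_minus"

abbreviation e :: "nat \<times> nat \<Rightarrow> 'l" where "e p \<equiv> cls (z p)"

lemma F_subset: "F \<subseteq> IJ - {(1, 1)}" and finite_P: "finite P_plus" "finite P_minus"
  and P_disjoint: "P_plus \<inter> P_minus = {}"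
  using N by (auto simp: P_plus_def P_minus_def)

lemma F_IJ: "p \<in> F \<Longrightarrow> p \<in> IJ"
  using F_subset by blast

lemma z_in_Gp: "p \<in> IJ - {(1, 1)} \<Longrightarrow> z p \<in> Gp"
  using one_N eps_y[of p "(1, 1)"] by (auto simp: augmentation_ideal_def)

definition \<beta> :: "nat \<times> nat \<Rightarrow> nat \<times> nat \<Rightarrow> 'b" where "\<beta> p t = \<alpha> (antG (y p t))"

text \<open>This is the origin of the two types of forms: \<open>\<alpha>\<close> makes u block
  diagonal with blocks of size 1 and N - 1, so \<open>P_plus\<close> and \<open>P_minus\<close>
  index invariant blocks of the corepresentation y.\<close>

lemma \<beta>_eq_0:
  assumes "p \<in> P_plus \<and> t \<in> IJ - P_plus \<or> p \<in> P_minus \<and> t \<in> IJ - P_minus"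
  shows "\<beta> p t = 0"
proof -
  have "\<alpha> (y p t) = 0"
  proof (cases "p \<in> P_plus")
    case True
    then have "fst t = 1 \<or> snd t \<in> {2..N}"
      using assms by (cases t) (auto simp: P_plus_def P_minus_def)
    then show ?thesis using True by (auto simp: P_plus_def y_def H.hom_mult \<alpha>_1i \<alpha>_s)
  next
    case False
    then have "snd t = 1 \<or> fst t \<in> {2..N}" "p \<in> P_minus"
      using assms by (cases t; auto simp: P_plus_def P_minus_def)+
    then show ?thesis by (auto simp: P_minus_def y_def H.hom_mult \<alpha>_1i \<alpha>_s)
  qed
  then show ?thesis
    by (simp add: \<beta>_def clinear_0[OF H.cod.ant_linear] flip: H.hom_ant)
qed

lemma \<delta>_e:
  assumes p: "p \<in> F"
  shows "\<delta> (e p) = (\<Sum>t\<in>F. e t \<otimes> \<beta> p t)"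
proof -
  have bil: "cbilinear (\<lambda>v1 v2. cls v2 \<otimes> antU (\<alpha> v1))"
    by (rule cbilinearI; intro linear_rules clinear_cls clinear_compose[OF H.cod.ant_linear] H.hom_linear)
  have p': "p \<in> IJ" "z p \<in> M \<inter> Gp" using p F_subset z_in_M[of p] z_in_Gp[of p] by auto
  then have "\<delta> (e p) = tlift (\<lambda>v1 v2. cls v2 \<otimes> antU (\<alpha> v1)) (copG (z p))"
    using \<delta> by (simp only: is_V_coaction_def)
  also have "\<dots> = (\<Sum>t\<in>IJ. e t \<otimes> \<beta> p t)"
    using p'(1) one_N by (simp add: cop_y[of p "(1, 1)"] mem_Times_iff
        clinear_sum[OF clinear_tlift[OF bil]] tlift_tensor[OF bil] \<beta>_def flip: H.hom_ant)
  also have "\<dots> = (\<Sum>t\<in>F. e t \<otimes> \<beta> p t)"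
    using F_subset p \<beta>_eq_0[of p] by (intro sum.mono_neutral_right) auto
  finally show ?thesis .
qed

lemma Q_u_offdiag:
  assumes "i \<in> {1..N}" "j \<in> {1..N}" "k \<in> {1..N}" "l \<in> {1..N}" "i \<noteq> j"
  shows "Q k l (u i j) = c\<^sup>2 * \<nu> * of_bool (k = j \<and> l = i)"
  using assms by (auto simp: Q_u rmat_def)

text \<open>The factor in front of the matrix unit to which Q sends \<open>z p\<close>; the two
  cases come from \<open>Q_z_first_column\<close> and \<open>Q_z_row\<close>.\<close>

definition \<kappa> :: "nat \<times> nat \<Rightarrow> complex"
  where "\<kappa> p = c * (if fst p = 1 then of_real q else \<nu>) * \<tau> (snd p)"

text \<open>The indices are transposed because \<open>z (a, b)\<close> lands in the matrix entry
  with row b and column a.\<close>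

definition \<phi> :: "nat \<times> nat \<Rightarrow> 'a \<Rightarrow> complex" where "\<phi> p h = Q (snd p) (fst p) h / \<kappa> p"

lemma Q_z_all:
  assumes "p \<in> IJ - {(1, 1)}" "k \<in> {1..N}" "l \<in> {1..N}"
  shows "Q k l (z p) = \<kappa> p * of_bool (p = (l, k))"
proof -
  obtain a b where p: "p = (a, b)" by (cases p)
  consider "a \<in> {2..N}" | "a = 1" "l = 1" "b \<in> {2..N}" | "a = 1" "l \<in> {2..N}" "b \<in> {2..N}"
    using assms p by fastforce
  then show ?thesis
    using assms p Q_z_row[of a b k l] Q_z_first_column[of b k] Q_z_other[of b k l]
    by cases (auto simp: \<kappa>_def)
qed

lemma clinear_\<phi>: "p \<in> IJ \<Longrightarrow> clinear (\<phi> p)"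
  using clinear_Q[of "snd p" "fst p"] unfolding \<phi>_def
  by (auto simp: clinear_iff scaleC_complex_def add_divide_distrib)

section \<open>The dual basis of the invariant forms for \<open>q \<noteq> 1\<close>\<close>

context
  assumes q1: "q \<noteq> 1"
begin

lemma \<kappa>_nz: "p \<in> IJ \<Longrightarrow> \<kappa> p \<noteq> 0"
  using q q_root_nz \<nu>_nz[OF q1] \<tau>_nz[OF _ q1] by (auto simp: \<kappa>_def)

lemma \<phi>_z:
  assumes p: "p \<in> F" and t: "t \<in> IJ"
  shows "\<phi> p (z t) = of_bool (p = t)"
proof (cases "t = (1, 1)")
  case True
  then show ?thesis
    using p one_N Q_z_first_column[of 1] Q_z_other[of 1 1]
    by (auto simp: \<phi>_def P_plus_def P_minus_def)
next
  case False
  then show ?thesis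
    using p t F_subset Q_z_all[of t "snd p" "fst p"] \<kappa>_nz[of p] by (auto simp: \<phi>_def)
qed

text \<open>The z in the sum supply a matrix unit for every entry except (1,1), and
  \<open>Q 1 1 h = 0\<close> takes care of that one. Hence h minus its expansion lies in the kernel
  of Q and has class zero.\<close>

lemma cls_expand_all:
  assumes h: "h \<in> Gp" "Q 1 1 h = 0"
  shows "cls h = (\<Sum>p\<in>IJ - {(1, 1)}. \<phi> p h *\<^sub>C e p)"
proof -
  let ?h = "h - (\<Sum>p\<in>IJ - {(1, 1)}. \<phi> p h *\<^sub>C z p)"
  have "cls ?h = 0"
  proof (rule cls_ker_Q)
    show "?h \<in> Gp"
      by (intro cvec.subspace_diff[OF subspace_Gp] cvec.subspace_sum[OF subspace_Gp]
          cvec.subspace_scale[OF subspace_Gp] h z_in_Gp)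
    fix k l assume kl: "k \<in> {1..N}" "l \<in> {1..N}"
    have "Q k l (\<Sum>p\<in>IJ - {(1, 1)}. \<phi> p h *\<^sub>C z p)
      = (\<Sum>p\<in>IJ - {(1, 1)}. \<phi> p h * Q k l (z p))"
      by (simp add: clinear_sum[OF clinear_Q[OF kl]] clinear_scale[OF clinear_Q[OF kl]] scaleC_complex_def)
    also have "\<dots> = (\<Sum>p\<in>IJ - {(1, 1)}. if p = (l, k) then Q k l h else 0)"
      using kl by (intro sum.cong refl) (auto simp: Q_z_all \<phi>_def \<kappa>_nz)
    also have "\<dots> = Q k l h" using kl h(2) by (auto simp: sum.delta')
    finally show "Q k l ?h = 0" by (simp add: clinear_diff[OF clinear_Q[OF kl]])
  qed
  then show ?thesis
    by (simp add: clinear_diff[OF clinear_cls] clinear_sum[OF clinear_cls] clinear_scale[OF clinear_cls])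
qed

text \<open>For distinct a and b above 1, expanding the class of \<open>u a b\<close> yields a
  nonzero multiple of \<open>e (a, b)\<close>; but \<open>u a b\<close> lies in the ideal. The
  diagonal case is built into the ideal.\<close>

lemma cls_z_eq_0:
  assumes p: "p \<in> IJ - {(1, 1)} - F"
  shows "e p = 0"
proof -
  obtain a b where ab: "p = (a, b)" "a \<in> {2..N}" "b \<in> {2..N}"
    using p by (cases p) (force simp: P_plus_def P_minus_def)
  show ?thesis
  proof (cases "a = b")
    case True
    then show ?thesis using ab cls_z_diag by simp
  next
    case False
    have "cls (u a b) = (\<Sum>p\<in>IJ - {(1, 1)}. \<phi> p (u a b) *\<^sub>C e p)"
      using ab False one_N by (intro cls_expand_all) (auto simp: augmentation_ideal_def eps_u Q_u_offdiag)
    also have "\<dots> = (\<Sum>p'\<in>IJ - {(1, 1)}. if p' = p then (c\<^sup>2 * \<nu> / \<kappa> p) *\<^sub>C e p else 0)"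
      using ab False by (intro sum.cong refl) (auto simp: \<phi>_def Q_u_offdiag)
    also have "\<dots> = (c\<^sup>2 * \<nu> / \<kappa> p) *\<^sub>C e p" using p by simp
    finally have "(c\<^sup>2 * \<nu> / \<kappa> p) *\<^sub>C e p = 0"
      using ab False by (simp add: cls_u_offdiag)
    then show ?thesis
      using p \<kappa>_nz[of p] \<nu>_nz[OF q1] q_root_nz by auto
  qed
qed

lemma cls_expand:
  assumes "h \<in> Gp" "Q 1 1 h = 0"
  shows "cls h = (\<Sum>p\<in>F. \<phi> p h *\<^sub>C e p)"
  unfolding cls_expand_all[OF assms]
  using F_subset cls_z_eq_0 by (intro sum.mono_neutral_right) auto

text \<open>Off the diagonal, Q sends \<open>u i j\<close> and \<open>z (i, j)\<close> to the same
  matrix unit. This ties \<open>V_plus\<close> and \<open>V_minus\<close>, defined by the u, to the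
  classes on which the coaction is known.\<close>

lemma cls_u:
  assumes ij: "i \<in> {1..N}" "j \<in> {1..N}" "(i, j) \<in> F"
  shows "cls (u i j) = (c\<^sup>2 * \<nu> / \<kappa> (i, j)) *\<^sub>C e (i, j)"
proof -
  have ne: "i \<noteq> j" using ij by (auto simp: P_plus_def P_minus_def)
  have "cls (u i j) = (\<Sum>p\<in>F. \<phi> p (u i j) *\<^sub>C e p)"
    using ij ne one_N by (intro cls_expand) (auto simp: augmentation_ideal_def eps_u Q_u_offdiag)
  also have "\<dots> = (\<Sum>p\<in>F. if p = (i, j) then (c\<^sup>2 * \<nu> / \<kappa> (i, j)) *\<^sub>C e (i, j) else 0)"
    using ij ne F_subset by (intro sum.cong refl) (auto simp: \<phi>_def Q_u_offdiag)
  also have "\<dots> = (c\<^sup>2 * \<nu> / \<kappa> (i, j)) *\<^sub>C e (i, j)"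
    using ij finite_P by simp
  finally show ?thesis .
qed

lemma cls_u_span:
  assumes "A \<subseteq> F"
  shows "cspan {cls (u i j) | i j. (i, j) \<in> A} = cspan (e ` A)"
proof (rule cvec.span_eq[THEN iffD2], intro conjI)
  have A: "i \<in> {1..N} \<and> j \<in> {1..N} \<and> (i, j) \<in> F" if "(i, j) \<in> A" for i j
    using assms that F_IJ[of "(i, j)"] by auto
  show "{cls (u i j) | i j. (i, j) \<in> A} \<subseteq> cspan (e ` A)"
  proof clarify
    fix i j assume "(i, j) \<in> A"
    then show "cls (u i j) \<in> cspan (e ` A)"
      using A[of i j] by (simp only: cls_u) (intro cvec.span_scale cvec.span_base imageI)
  qed
  show "e ` A \<subseteq> cspan {cls (u i j) | i j. (i, j) \<in> A}"
  proof safe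
    fix i j assume ij: "(i, j) \<in> A"
    have "e (i, j) = (\<kappa> (i, j) / (c\<^sup>2 * \<nu>)) *\<^sub>C cls (u i j)"
      using A[OF ij] \<kappa>_nz[of "(i, j)"] \<nu>_nz[OF q1] q_root_nz by (simp add: cls_u scaleC_scaleC scaleC_one)
    then show "e (i, j) \<in> cspan {cls (u i j) | i j. (i, j) \<in> A}"
      using ij by (simp only:) (intro cvec.span_scale cvec.span_base, blast)
  qed
qed

lemma V_plus_eq: "V_plus N u cls = cspan (e ` P_plus)"
  and V_minus_eq: "V_minus N u cls = cspan (e ` P_minus)"
  using cls_u_span[of P_plus] cls_u_span[of P_minus]
  by (simp_all add: V_plus_def V_minus_def P_plus_def P_minus_def conj_commute)

text \<open>Each summand of the ideal is killed for its own reason: the first because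
  \<open>\<phi> p\<close> is an entry of Q, the other two because their generators have their matrix
  unit at a position outside F.\<close>

lemma \<phi>_ideal:
  assumes p: "p \<in> F" and h: "h \<in> ideal_SU N u copG epsG antG r"
  shows "\<phi> p h = 0"
proof -
  have p': "fst p \<in> {1..N}" "snd p \<in> {1..N}" "p \<in> IJ" using p F_subset by auto
  note lin = clinear_\<phi>[OF p'(3)]
  have ker: "csubspace {h. \<phi> p h = 0}"
    using lin by (simp add: cvec.subspace_def clinear_iff clinear_0[OF lin])
  obtain a b d where h: "h = a + b + d" "a \<in> ker_Q N u copG r"
    "b \<in> cspan {u i 1 * s 1 i | i. i \<in> {2..N}}"
    "d \<in> cspan {u i j | i j. i \<in> {2..N} \<and> j \<in> {2..N} \<and> i \<noteq> j}"
    using h by (auto simp: ideal_SU_def)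
  have "\<phi> p a = 0" using h(2) p' by (auto simp: \<phi>_def ker_Q_def)
  moreover have "\<phi> p b = 0" using h(3)
  proof (rule cvec.span_induct[OF _ ker])
    fix x assume "x \<in> {u i 1 * s 1 i | i. i \<in> {2..N}}"
    then obtain i where i: "i \<in> {2..N}" "x = z (i, i)" by (auto simp: y_def)
    then have "\<phi> p x = of_bool (p = (i, i))" using \<phi>_z[OF p, of "(i, i)"] by auto
    then show "\<phi> p x = 0" using p i by (auto simp: P_plus_def P_minus_def)
  qed
  moreover have "\<phi> p d = 0" using h(4)
  proof (rule cvec.span_induct[OF _ ker])
    fix x assume "x \<in> {u i j | i j. i \<in> {2..N} \<and> j \<in> {2..N} \<and> i \<noteq> j}"
    then show "\<phi> p x = 0" using p p' by (auto simp: \<phi>_def Q_u_offdiag P_plus_def P_minus_def)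
  qed
  ultimately show ?thesis by (simp add: h(1) clinear_add[OF lin])
qed

text \<open>\<open>\<Lambda>\<^sup>1\<close> is known only through the quotient map, so the
  functional is evaluated on a chosen representative in \<open>Gp\<close>; by
  \<open>\<phi>_ideal\<close> the choice does not matter. It follows that the \<open>e p\<close> are
  linearly independent.\<close>

lemma dual_functional:
  assumes p: "p \<in> F"
  obtains \<epsilon> :: "'l \<Rightarrow> complex" where "clinear \<epsilon>" "\<And>t. t \<in> F \<Longrightarrow> \<epsilon> (e t) = of_bool (t = p)"
proof -
  have p': "p \<in> IJ" using p F_subset by auto
  note lin = clinear_\<phi>[OF p']
  define \<epsilon> where "\<epsilon> x = \<phi> p (SOME h. h \<in> Gp \<and> cls h = x)" for x
  have \<epsilon>: "\<epsilon> (cls h) = \<phi> p h" if h: "h \<in> Gp" for h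
  proof -
    let ?g = "SOME g. g \<in> Gp \<and> cls g = cls h"
    have g: "?g \<in> Gp \<and> cls ?g = cls h"
      by (rule someI[of _ h]) (use h in simp)
    then have "cls (?g - h) = 0" "?g - h \<in> Gp"
      using h cvec.subspace_diff[OF subspace_Gp] by (simp_all add: clinear_diff[OF clinear_cls])
    then have "\<phi> p (?g - h) = 0" using \<phi>_ideal[OF p] cls_eq_0_iff by blast
    then show ?thesis by (simp add: \<epsilon>_def clinear_diff[OF lin])
  qed
  show thesis
  proof (rule that[of \<epsilon>])
    show "clinear \<epsilon>"
    proof (rule clinearI)
      fix x y k
      obtain g h where gh: "g \<in> Gp" "x = cls g" "h \<in> Gp" "y = cls h" using cls_surj by metis
      have "x + y = cls (g + h)" "k *\<^sub>C x = cls (k *\<^sub>C g)"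
        by (simp_all add: gh clinear_add[OF clinear_cls] clinear_scale[OF clinear_cls])
      then show "\<epsilon> (x + y) = \<epsilon> x + \<epsilon> y" "\<epsilon> (k *\<^sub>C x) = k *\<^sub>C \<epsilon> x"
        using gh cvec.subspace_add[OF subspace_Gp] cvec.subspace_scale[OF subspace_Gp]
        by (simp_all add: \<epsilon> clinear_add[OF lin] clinear_scale[OF lin])
    qed
    show "\<epsilon> (e t) = of_bool (t = p)" if "t \<in> F" for t
    proof -
      have "t \<in> IJ - {(1, 1)}" using that F_subset by auto
      then show ?thesis using \<epsilon>[OF z_in_Gp] \<phi>_z[OF p, of t] by auto
    qed
  qed
qed

end


section \<open>Coinvariance in coordinates\<close>

lemma \<delta>_linear: "clinear \<delta>"
  using \<delta> by (simp add: is_V_coaction_def)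

lemmas calculus_linear_rules = G.hopf_linear_rules H.hom_linear clinear_compose[OF H.hom_linear]
  clinear_cls clinear_compose[OF clinear_cls] \<delta>_linear clinear_compose[OF \<delta>_linear]
  H.cod.ant_linear clinear_compose[OF H.cod.ant_linear]

definition \<rho> :: "'a \<Rightarrow> ('a, 'b) tensor" where "\<rho> g = tmap id \<alpha> (copG g)"

lemma \<rho>_linear: "clinear \<rho>"
  unfolding \<rho>_def by (intro calculus_linear_rules)

lemma \<rho>_mult: "\<rho> (g * h) = \<rho> g * \<rho> h"
  unfolding \<rho>_def G.cop_hom by (intro tmap_mult calculus_linear_rules) (simp_all add: H.hom_mult)

lemma M_iff: "m \<in> M \<longleftrightarrow> \<rho> m = m \<otimes> 1"
  by (simp add: coinvariant_algebra_def \<rho>_def)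

text \<open>The tensor product of two coactions with its two inputs kept free: comodule legs are
  tensored, algebra legs multiplied. Linearity in each input can then be used separately.\<close>

definition pair :: "('a, 'b) tensor \<Rightarrow> ('l, 'b) tensor \<Rightarrow> (('a, 'l) tensor, 'b) tensor"
  where "pair \<sigma> t = tlift (\<lambda>g k. tlift (\<lambda>x0 x1. (g \<otimes> x0) \<otimes> (k * x1)) t) \<sigma>"

lemma bilinear_pair_inner: "cbilinear (\<lambda>(x0::'l) x1. ((g::'a) \<otimes> x0) \<otimes> ((k::'b) * x1))"
  by (rule cbilinearI; intro linear_rules)

lemma bilinear_pair_outer: "cbilinear (\<lambda>(g::'a) (k::'b). tlift (\<lambda>(x0::'l) x1. (g \<otimes> x0) \<otimes> (k * x1)) t)"
  by (rule cbilinearI; intro linear_rules bilinear_pair_inner)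

lemma bilinear_pair: "cbilinear pair"
  unfolding pair_def by (rule cbilinearI; intro linear_rules bilinear_pair_inner bilinear_pair_outer)

lemma pair_tensor: "pair (g \<otimes> k) (x \<otimes> l) = (g \<otimes> x) \<otimes> (k * l)"
  unfolding pair_def
  by (subst tlift_tensor[OF bilinear_pair_outer], subst tlift_tensor[OF bilinear_pair_inner]) (rule refl)

lemmas pair_linear_rules = clinear_bilinear_left[OF bilinear_pair] clinear_bilinear_right[OF bilinear_pair]

abbreviation TC :: "('a, 'l) tensor \<Rightarrow> (('a, 'l) tensor, 'b) tensor"
  where "TC \<equiv> tensor_coaction copG \<alpha> \<delta>"

lemma tensor_coaction_eq: "TC = tlift (\<lambda>g x. pair (\<rho> g) (\<delta> x))"
  unfolding tensor_coaction_def pair_def \<rho>_def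
  by (simp add: tlift_tmap bilinear_pair_outer clinear_id H.hom_linear)

lemma bilinear_TC: "cbilinear (\<lambda>g x. pair (\<rho> g) (\<delta> x))"
  by (rule cbilinearI; intro pair_linear_rules \<rho>_linear \<delta>_linear)

lemma TC_linear: "clinear TC"
  unfolding tensor_coaction_eq by (rule clinear_tlift[OF bilinear_TC])

lemma TC_tensor: "TC (g \<otimes> x) = pair (\<rho> g) (\<delta> x)"
  unfolding tensor_coaction_eq by (rule tlift_tensor[OF bilinear_TC])

text \<open>Puts a fixed form between the two legs of a tensor. Elements of the target of
  \<open>TC\<close> become sums over t of such insertions of \<open>e t\<close>, so that their
  coefficients can be compared.\<close>

definition insert_form :: "'l \<Rightarrow> ('a, 'b) tensor \<Rightarrow> (('a, 'l) tensor, 'b) tensor"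
  where "insert_form x \<sigma> = pair \<sigma> (x \<otimes> 1)"

lemma insert_form_linear: "clinear (insert_form x)"
  unfolding insert_form_def by (intro pair_linear_rules linear_rules)

lemma pair_tensor_right: "pair \<sigma> (x \<otimes> l) = insert_form x (\<sigma> * (1 \<otimes> l))"
  by (induct \<sigma> rule: tensor_induct)
    (simp_all add: insert_form_def pair_tensor tensor_mult distrib_right
      clinear_add[OF clinear_bilinear_left[OF bilinear_pair clinear_ident]])

definition coact :: "(nat \<times> nat \<Rightarrow> 'a) \<Rightarrow> nat \<times> nat \<Rightarrow> ('a, 'b) tensor"
  where "coact g t = (\<Sum>p\<in>F. \<rho> (g p) * (1 \<otimes> \<beta> p t))"

lemma finite_F: "finite F"
  using finite_P by simp

lemma TC_sum: "TC (\<Sum>p\<in>F. g p \<otimes> e p) = (\<Sum>t\<in>F. insert_form (e t) (coact g t))"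
proof -
  have "TC (\<Sum>p\<in>F. g p \<otimes> e p) = (\<Sum>p\<in>F. \<Sum>t\<in>F. insert_form (e t) (\<rho> (g p) * (1 \<otimes> \<beta> p t)))"
    by (simp add: clinear_sum[OF TC_linear] TC_tensor \<delta>_e
        clinear_sum[OF clinear_bilinear_right[OF bilinear_pair clinear_ident]] pair_tensor_right)
  also have "\<dots> = (\<Sum>t\<in>F. insert_form (e t) (coact g t))"
    unfolding coact_def clinear_sum[OF insert_form_linear] by (rule sum.swap)
  finally show ?thesis .
qed

lemma tensor_one_sum: "(\<Sum>p\<in>F. g p \<otimes> e p) \<otimes> 1 = (\<Sum>t\<in>F. insert_form (e t) (g t \<otimes> 1))"
  by (simp add: insert_form_def pair_tensor tensor_sum_left)

text \<open>The coinvariants form a left coideal: by coassociativity, evaluating the first leg of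
  the coproduct commutes with the coaction, which acts on the other end.\<close>

lemma M_slice:
  assumes m: "m \<in> M" and \<xi>: "clinear \<xi>"
  shows "tlift (\<lambda>x h. \<xi> x *\<^sub>C h) (copG m) \<in> M"
proof -
  note rules = calculus_linear_rules \<xi> clinear_compose[OF \<xi>]
  have b1: "cbilinear (\<lambda>x h. \<xi> x *\<^sub>C h)" for h :: "'x::complex_vector"
    by (rule cbilinearI; intro rules)
  have b2: "cbilinear (\<lambda>a b. a \<otimes> \<alpha> b)" for a :: 'a
    by (rule cbilinearI; intro rules)
  have b3: "cbilinear (\<lambda>x k. tlift (\<lambda>a b. \<xi> a *\<^sub>C b) (copG x) \<otimes> k)"
    by (rule cbilinearI; intro rules b1)
  have \<rho>: "\<rho> h = tlift (\<lambda>a b. a \<otimes> \<alpha> b) (copG h)" for h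
    by (simp add: \<rho>_def tmap_def)
  have "\<rho> (tlift (\<lambda>x h. \<xi> x *\<^sub>C h) (copG m)) = tlift (\<lambda>x h. \<xi> x *\<^sub>C \<rho> h) (copG m)"
    by (subst clinear_comp_tlift[OF \<rho>_linear b1]) (simp add: clinear_scale[OF \<rho>_linear])
  also have "\<dots> = tlift (\<lambda>x h. tlift (\<lambda>a b. \<xi> x *\<^sub>C (a \<otimes> \<alpha> b)) (copG h)) (copG m)"
    by (simp add: \<rho> clinear_comp_tlift[OF clinear_scaleC_right[OF clinear_ident] b2])
  also have "\<dots> = tlift (\<lambda>x k. tlift (\<lambda>a b. \<xi> a *\<^sub>C (b \<otimes> \<alpha> k)) (copG x)) (copG m)"
    by (rule G.cop_coassoc[symmetric]; intro rules)
  also have "\<dots> = tlift (\<lambda>x k. tlift (\<lambda>a b. \<xi> a *\<^sub>C b) (copG x) \<otimes> \<alpha> k) (copG m)"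
    by (simp add: clinear_comp_tlift[OF clinear_tensor_left[OF clinear_ident] b1] tensor_scaleC_left)
  also have "\<dots> = tlift (\<lambda>x h. \<xi> x *\<^sub>C h) (copG m) \<otimes> 1"
    by (rule coinvariant_tlift[OF m b3])
  finally show ?thesis by (simp add: M_iff)
qed

lemma M_components:
  assumes "m \<in> M"
  obtains I b where "finite I" "copG m = (\<Sum>a\<in>I. a \<otimes> b a)" "\<And>a. a \<in> I \<Longrightarrow> b a \<in> M"
  using tensor_slices[of "copG m"] M_slice[OF assms] by metis

text \<open>Composes \<open>cls\<close> with the projection onto the augmentation ideal, the domain
  on which \<open>cls\<close> carries meaning.\<close>

definition cls' :: "'a \<Rightarrow> 'l" where "cls' v = cls (v - epsG v *\<^sub>C 1)"

lemma cls'_linear: "clinear cls'"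
  unfolding cls'_def by (intro calculus_linear_rules)

abbreviation d :: "'a \<Rightarrow> ('a, 'l) tensor" where "d \<equiv> differential copG epsG cls"

lemma d_eq: "d h = tlift (\<lambda>h1 h2. h1 \<otimes> cls' h2) (copG h)"
  by (simp add: differential_def cls'_def)

lemma bilinear_d: "cbilinear (\<lambda>h1 h2. h1 \<otimes> cls' h2)"
  by (rule cbilinearI; intro linear_rules cls'_linear)

lemma minus_eps: "h - epsG h *\<^sub>C 1 \<in> Gp"
  by (simp add: augmentation_ideal_def clinear_diff[OF G.eps_linear] clinear_scale[OF G.eps_linear]
      G.eps_one scaleC_complex_def)

text \<open>Since \<open>\<alpha>\<close> restricts to the counit on coinvariants, the constant part of \<open>b\<close> drops out of
  the coaction.\<close>

lemma \<delta>_cls':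
  assumes b: "b \<in> M"
  shows "\<delta> (cls' b) = tlift (\<lambda>v1 v2. cls' v2 \<otimes> antU (\<alpha> v1)) (copG b)"
proof -
  note rules = calculus_linear_rules cls'_linear
  let ?T = "tlift (\<lambda>v1 v2. cls v2 \<otimes> antU (\<alpha> v1))"
  have T: "cbilinear (\<lambda>v1 v2. cls v2 \<otimes> antU (\<alpha> v1))"
    by (rule cbilinearI; intro rules)
  have T': "cbilinear (\<lambda>v1 v2. cls' v2 \<otimes> antU (\<alpha> v1))"
    by (rule cbilinearI; intro rules)
  have eps: "cbilinear (\<lambda>h1 h2. epsG h2 *\<^sub>C h1)"
    by (rule cbilinearI; intro rules)
  let ?L = "\<lambda>h. cls 1 \<otimes> antU (\<alpha> h)"
  have L: "clinear ?L" by (intro rules)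
  have "b - epsG b *\<^sub>C 1 \<in> M"
    using b by (simp add: M_iff clinear_diff[OF \<rho>_linear] clinear_scale[OF \<rho>_linear] tensor_diff_right
        clinear_diff[OF clinear_tensor_left[OF clinear_ident]] tensor_scaleC_left)
      (simp add: \<rho>_def G.cop_one tmap_tensor clinear_id H.hom_linear H.hom_one)
  then have "\<delta> (cls' b) = ?T (copG (b - epsG b *\<^sub>C 1))"
    using \<delta> minus_eps[of b] by (simp add: is_V_coaction_def cls'_def)
  also have "\<dots> = ?T (copG b) - epsG b *\<^sub>C (cls 1 \<otimes> 1)"
    by (simp add: clinear_diff[OF G.cop_linear] clinear_scale[OF G.cop_linear] G.cop_one
        clinear_diff[OF clinear_tlift[OF T]] clinear_scale[OF clinear_tlift[OF T]] tlift_tensor[OF T]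
        H.hom_one H.cod.ant_one)
  also have "epsG b *\<^sub>C (cls 1 \<otimes> 1) = ?L b"
    by (simp add: \<alpha>_coinvariant[OF b] clinear_scale[OF H.cod.ant_linear] H.cod.ant_one tensor_scaleC_right)
  also have "?L b = ?L (tlift (\<lambda>h1 h2. epsG h2 *\<^sub>C h1) (copG b))"
    by (simp add: G.counit_right)
  also have "\<dots> = tlift (\<lambda>h1 h2. ?L (epsG h2 *\<^sub>C h1)) (copG b)"
    by (rule clinear_comp_tlift[OF L eps])
  also have "?T (copG b) - \<dots> = tlift (\<lambda>v1 v2. cls' v2 \<otimes> antU (\<alpha> v1)) (copG b)"
  proof (rule clinear_tensor_eqI[where F = "\<lambda>t. ?T t - tlift (\<lambda>h1 h2. ?L (epsG h2 *\<^sub>C h1)) t"])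
    have b2: "cbilinear (\<lambda>h1 h2. ?L (epsG h2 *\<^sub>C h1))"
      by (rule cbilinearI; intro rules)
    show "clinear (\<lambda>t. ?T t - tlift (\<lambda>h1 h2. ?L (epsG h2 *\<^sub>C h1)) t)"
      by (intro linear_rules T b2)
    show "clinear (tlift (\<lambda>v1 v2. cls' v2 \<otimes> antU (\<alpha> v1)))"
      by (rule clinear_tlift[OF T'])
    fix v w
    show "?T (v \<otimes> w) - tlift (\<lambda>h1 h2. ?L (epsG h2 *\<^sub>C h1)) (v \<otimes> w)
        = tlift (\<lambda>v1 v2. cls' v2 \<otimes> antU (\<alpha> v1)) (v \<otimes> w)"
      unfolding tlift_tensor[OF T] tlift_tensor[OF T'] tlift_tensor[OF b2]
      by (simp add: cls'_def clinear_diff[OF clinear_cls] clinear_scale[OF clinear_cls] clinear_scale[OF L]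
          clinear_diff[OF clinear_tensor_left[OF clinear_ident]] tensor_scaleC_left)
  qed
  finally show ?thesis .
qed

text \<open>Here the antipode cancels: \<open>h\<^sub>(\<^sub>1\<^sub>) \<otimes> h\<^sub>(\<^sub>4\<^sub>) \<otimes> \<alpha>(h\<^sub>(\<^sub>2\<^sub>) S(h\<^sub>(\<^sub>3\<^sub>)))\<close> collapses.\<close>

lemma pair_coinvariant:
  "tlift (\<lambda>a b. pair (\<rho> a) (tlift (\<lambda>v1 v2. cls' v2 \<otimes> antU (\<alpha> v1)) (copG b))) (copG h) = d h \<otimes> 1"
proof -
  note rules = calculus_linear_rules cls'_linear
  let ?F = "\<lambda>a b c x. (a \<otimes> cls' x) \<otimes> \<alpha> (b * antG c)"
  have F: "cbilinear (\<lambda>c x. ?F a b c x)" "cbilinear (\<lambda>b c. ?F a b c x)"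
    "cbilinear (\<lambda>a b. ?F a b c x)" for a b c x
    by (rule cbilinearI; intro rules)+
  have F2: "cbilinear (\<lambda>a b. tlift (\<lambda>c x. ?F a b c x) t)" for t
    by (rule cbilinearI; intro rules F)
  have T: "cbilinear (\<lambda>v1 v2. cls' v2 \<otimes> antU (\<alpha> v1))"
    by (rule cbilinearI; intro rules)
  have b\<rho>: "cbilinear (\<lambda>g k. g \<otimes> \<alpha> k)" for g :: 'a
    by (rule cbilinearI; intro rules)
  have pair_eq: "pair (tmap id \<alpha> \<sigma>) (tlift (\<lambda>v1 v2. cls' v2 \<otimes> antU (\<alpha> v1)) t)
      = tlift (\<lambda>a b. tlift (\<lambda>c x. ?F a b c x) t) \<sigma>" for \<sigma> t
  proof (rule clinear_tensor_eqI[where t = \<sigma>])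
    show "clinear (\<lambda>\<sigma>. pair (tmap id \<alpha> \<sigma>) (tlift (\<lambda>v1 v2. cls' v2 \<otimes> antU (\<alpha> v1)) t))"
      by (intro pair_linear_rules rules)
    show "clinear (tlift (\<lambda>a b. tlift (\<lambda>c x. ?F a b c x) t))"
      by (rule clinear_tlift[OF F2])
    fix a b
    have "pair (a \<otimes> \<alpha> b) (tlift (\<lambda>v1 v2. cls' v2 \<otimes> antU (\<alpha> v1)) t) = tlift (\<lambda>c x. ?F a b c x) t"
      by (subst clinear_comp_tlift[OF clinear_bilinear_right[OF bilinear_pair clinear_ident] T])
        (simp add: pair_tensor H.hom_mult H.hom_ant)
    then show "pair (tmap id \<alpha> (a \<otimes> b)) (tlift (\<lambda>v1 v2. cls' v2 \<otimes> antU (\<alpha> v1)) t)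
      = tlift (\<lambda>a b. tlift (\<lambda>c x. ?F a b c x) t) (a \<otimes> b)"
      by (simp add: tmap_tensor clinear_id H.hom_linear tlift_tensor[OF F2])
  qed
  have "tlift (\<lambda>a b. pair (\<rho> a) (tlift (\<lambda>v1 v2. cls' v2 \<otimes> antU (\<alpha> v1)) (copG b))) (copG h)
    = tlift (\<lambda>x w. tlift (\<lambda>a b. tlift (\<lambda>c x. ?F a b c x) (copG w)) (copG x)) (copG h)"
    by (simp only: \<rho>_def pair_eq)
  also have "\<dots> = tlift (\<lambda>a w. tlift (\<lambda>b w. tlift (\<lambda>c x. ?F a b c x) (copG w)) (copG w)) (copG h)"
    by (rule G.cop_coassoc; intro rules F)
  also have "\<dots> = tlift (\<lambda>a w. tlift (\<lambda>v x. tlift (\<lambda>b c. ?F a b c x) (copG v)) (copG w)) (copG h)"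
    by (subst G.cop_coassoc) (intro rules | simp)+
  also have "\<dots> = tlift (\<lambda>a w. (a \<otimes> cls' w) \<otimes> 1) (copG h)"
  proof -
    have "tlift (\<lambda>v x. tlift (\<lambda>b c. ?F a b c x) (copG v)) (copG w) = (a \<otimes> cls' w) \<otimes> 1" for a :: 'a and w
    proof -
      let ?L = "\<lambda>x. (a \<otimes> cls' x) \<otimes> (1::'b)"
      have L: "clinear ?L" by (intro rules)
      have eps: "cbilinear (\<lambda>h1 h2. epsG h1 *\<^sub>C h2)"
        by (rule cbilinearI; intro rules)
      have "tlift (\<lambda>b c. ?F a b c x) (copG v) = ?L (epsG v *\<^sub>C x)" for v x
      proof -
        have "tlift (\<lambda>b c. ?F a b c x) (copG v) = (a \<otimes> cls' x) \<otimes> \<alpha> (tlift (\<lambda>h1 h2. h1 * antG h2) (copG v))"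
          by (rule clinear_comp_tlift[symmetric]; intro rules G.bilinear_ant_right)
        then show ?thesis
          by (simp add: G.antipode_right clinear_scale[OF H.hom_linear] H.hom_one tensor_scaleC_right
              clinear_scale[OF L])
      qed
      then have "tlift (\<lambda>v x. tlift (\<lambda>b c. ?F a b c x) (copG v)) (copG w)
        = ?L (tlift (\<lambda>h1 h2. epsG h1 *\<^sub>C h2) (copG w))"
        by (simp add: clinear_comp_tlift[OF L eps])
      then show ?thesis by (simp only: G.counit_left)
    qed
    then show ?thesis by simp
  qed
  also have "\<dots> = d h \<otimes> 1"
    unfolding d_eq by (rule clinear_comp_tlift[symmetric]; intro rules bilinear_d)
  finally show ?thesis .
qed

section \<open>Coinvariance of the forms \<open>f dm\<close>\<close>

lemma left_mult_linear: "clinear (left_mult f)"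
  unfolding left_mult_def by (rule clinear_tmap; intro linear_rules)

lemma left_mult_tensor: "left_mult f (g \<otimes> x) = (f * g) \<otimes> x"
  unfolding left_mult_def by (subst tmap_tensor) (intro linear_rules | simp)+

text \<open>By \<open>M_components\<close> the coproduct of m can be written with second legs in M,
  so \<open>\<delta>_cls'\<close> applies to each term. The factor f passes through since
  \<open>\<rho> f = f \<otimes> 1\<close>, and the antipode cancellation in
  \<open>pair_coinvariant\<close> does the rest.\<close>

lemma TC_fdm:
  assumes f: "f \<in> M" and m: "m \<in> M"
  shows "TC (left_mult f (d m)) = left_mult f (d m) \<otimes> 1"
proof -
  obtain I b where I: "finite I" "copG m = (\<Sum>a\<in>I. a \<otimes> b a)" "\<And>a. a \<in> I \<Longrightarrow> b a \<in> M"
    using M_components[OF m] by blast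
  let ?T = "\<lambda>b. tlift (\<lambda>v1 v2. cls' v2 \<otimes> antU (\<alpha> v1)) (copG b)"
  define L :: "(('a, 'l) tensor, 'b) tensor \<Rightarrow> _" where "L = tmap (left_mult f) id"
  have L: "clinear L" "L (w \<otimes> k) = left_mult f w \<otimes> k" for w k
    using clinear_tmap[OF left_mult_linear clinear_id clinear_ident] unfolding L_def
    by (auto simp: tmap_tensor left_mult_linear clinear_id)
  have T: "cbilinear (\<lambda>v1 v2. cls' v2 \<otimes> antU (\<alpha> v1))"
    by (rule cbilinearI; intro calculus_linear_rules cls'_linear clinear_compose[OF cls'_linear])
  have bil: "cbilinear (\<lambda>a b. pair (\<rho> a) (?T b))"
    by (rule cbilinearI; intro pair_linear_rules linear_rules \<rho>_linear T G.cop_linear)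
  have pl: "pair ((f \<otimes> 1) * \<sigma>) t = L (pair \<sigma> t)" for \<sigma> t
  proof (induct \<sigma> rule: tensor_induct)
    case (pure g k)
    show ?case
      by (induct t rule: tensor_induct)
        (simp_all add: tensor_mult pair_tensor L left_mult_tensor clinear_add[OF L(1)]
          clinear_add[OF clinear_bilinear_right[OF bilinear_pair clinear_ident]])
  qed (simp add: distrib_left clinear_add[OF L(1)] clinear_add[OF clinear_bilinear_left[OF bilinear_pair clinear_ident]])
  have "left_mult f (d m) = (\<Sum>a\<in>I. (f * a) \<otimes> cls' (b a))"
    by (simp add: d_eq I(2) clinear_sum[OF clinear_tlift[OF bilinear_d]] tlift_tensor[OF bilinear_d]
        clinear_sum[OF left_mult_linear] left_mult_tensor)
  then have "TC (left_mult f (d m)) = (\<Sum>a\<in>I. L (pair (\<rho> a) (?T (b a))))"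
    using f I(3) by (simp add: clinear_sum[OF TC_linear] TC_tensor \<rho>_mult M_iff[of f] \<delta>_cls' pl)
  also have "\<dots> = L (tlift (\<lambda>a b. pair (\<rho> a) (?T b)) (copG m))"
    by (simp add: I(2) clinear_sum[OF clinear_tlift[OF bil]] tlift_tensor[OF bil] clinear_sum[OF L(1)])
  also have "\<dots> = left_mult f (d m) \<otimes> 1"
    by (simp add: pair_coinvariant L)
  finally show ?thesis .
qed

lemma subspace_coinvariant_forms: "csubspace (coinvariant_forms copG \<alpha> \<delta> V)"
proof -
  have "csubspace {t. TC t = t \<otimes> 1}"
    using TC_linear by (auto simp: cvec.subspace_def clinear_iff clinear_0 tensor_add_left tensor_scaleC_left)
  from cvec.subspace_inter[OF cvec.subspace_span this] show ?thesis
    unfolding coinvariant_forms_def tensor_space_def by (simp add: Int_def)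
qed

lemma sum_restrict_F: "A \<subseteq> F \<Longrightarrow> (\<Sum>p\<in>F. (if p \<in> A then g p else 0) \<otimes> e p) = (\<Sum>p\<in>A. g p \<otimes> e p)"
  using finite_F by (intro sum.mono_neutral_cong_right) auto

section \<open>The decomposition\<close>

context
  assumes q1: "q \<noteq> 1"
begin

lemma coefficient_extraction:
  assumes t: "t \<in> F"
  obtains \<epsilon> :: "'l \<Rightarrow> complex" where "clinear \<epsilon>" "\<And>p. p \<in> F \<Longrightarrow> \<epsilon> (e p) = of_bool (p = t)"
    "\<And>g. tlift (\<lambda>(h::'a) x. \<epsilon> x *\<^sub>C h) (\<Sum>p\<in>F. g p \<otimes> e p) = g t" "cbilinear (\<lambda>h x. \<epsilon> x *\<^sub>C (h::'a))"
proof -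
  obtain \<epsilon> :: "'l \<Rightarrow> complex" where \<epsilon>: "clinear \<epsilon>" "\<And>p. p \<in> F \<Longrightarrow> \<epsilon> (e p) = of_bool (p = t)"
    using dual_functional[OF q1 t] by blast
  have bil: "cbilinear (\<lambda>h x. \<epsilon> x *\<^sub>C (h::'a))"
    by (rule cbilinearI; intro linear_rules \<epsilon>)
  have coeff: "tlift (\<lambda>h x. \<epsilon> x *\<^sub>C h) (\<Sum>p\<in>F. g p \<otimes> e p) = g t" for g :: "nat \<times> nat \<Rightarrow> 'a"
  proof -
    have "tlift (\<lambda>h x. \<epsilon> x *\<^sub>C h) (\<Sum>p\<in>F. g p \<otimes> e p) = (\<Sum>p\<in>F. if p = t then g p else 0)"
      unfolding clinear_sum[OF clinear_tlift[OF bil]]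
      by (intro sum.cong refl) (simp add: tlift_tensor[OF bil] \<epsilon>(2) scaleC_one)
    then show ?thesis using t finite_F by simp
  qed
  show thesis by (rule that[OF \<epsilon> coeff bil])
qed

text \<open>Applying the functional dual to \<open>e t\<close> to the middle leg isolates coordinate
  t on both sides.\<close>

lemma coact_eq_iff:
  "TC (\<Sum>p\<in>F. g p \<otimes> e p) = (\<Sum>p\<in>F. g p \<otimes> e p) \<otimes> 1 \<longleftrightarrow> (\<forall>t\<in>F. coact g t = g t \<otimes> 1)"
proof (intro iffI ballI)
  assume "\<forall>t\<in>F. coact g t = g t \<otimes> 1"
  then show "TC (\<Sum>p\<in>F. g p \<otimes> e p) = (\<Sum>p\<in>F. g p \<otimes> e p) \<otimes> 1"
    by (simp add: TC_sum tensor_one_sum)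
next
  assume eq: "TC (\<Sum>p\<in>F. g p \<otimes> e p) = (\<Sum>p\<in>F. g p \<otimes> e p) \<otimes> 1"
  fix t assume t: "t \<in> F"
  obtain \<epsilon> :: "'l \<Rightarrow> complex" where \<epsilon>: "clinear \<epsilon>" "\<And>p. p \<in> F \<Longrightarrow> \<epsilon> (e p) = of_bool (p = t)"
    "cbilinear (\<lambda>h x. \<epsilon> x *\<^sub>C (h::'a))"
    using coefficient_extraction[OF t] by metis
  define E :: "(('a, 'l) tensor, 'b) tensor \<Rightarrow> ('a, 'b) tensor"
    where "E = tmap (tlift (\<lambda>h x. \<epsilon> x *\<^sub>C h)) id"
  have E: "clinear E" "E (w \<otimes> k) = tlift (\<lambda>h x. \<epsilon> x *\<^sub>C h) w \<otimes> k" for w k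
    using clinear_tmap[OF clinear_tlift[OF \<epsilon>(3)] clinear_id clinear_ident] unfolding E_def
    by (auto simp: tmap_tensor clinear_tlift[OF \<epsilon>(3)] clinear_id)
  have ins: "E (insert_form x \<sigma>) = \<epsilon> x *\<^sub>C \<sigma>" for x \<sigma>
    by (induct \<sigma> rule: tensor_induct)
      (simp_all add: insert_form_def pair_tensor E(2)
        tlift_tensor[OF \<epsilon>(3)] tensor_scaleC_left clinear_add[OF E(1)] scaleC_add_right
        clinear_add[OF clinear_bilinear_left[OF bilinear_pair clinear_ident]])
  have coeff: "E (\<Sum>p\<in>F. insert_form (e p) (w p)) = w t" for w
  proof -
    have "E (\<Sum>p\<in>F. insert_form (e p) (w p)) = (\<Sum>p\<in>F. if p = t then w p else 0)"
      unfolding clinear_sum[OF E(1)] by (intro sum.cong refl) (simp add: ins \<epsilon>(2) scaleC_one)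
    then show ?thesis using t finite_F by simp
  qed
  show "coact g t = g t \<otimes> 1"
    using arg_cong[OF eq, of E] by (simp only: TC_sum tensor_one_sum coeff)
qed

text \<open>For a coinvariant, \<open>Q_11_coinvariant\<close> supplies the vanishing corner entry
  that \<open>cls_expand\<close> requires of \<open>b - epsG b *\<^sub>C 1\<close>. The subtracted
  constant is invisible to \<open>\<phi> p\<close>, an off-diagonal entry of Q.\<close>

lemma cls'_expand:
  assumes b: "b \<in> M"
  shows "cls' b = (\<Sum>p\<in>F. \<phi> p b *\<^sub>C e p)"
proof -
  have "Q 1 1 (b - epsG b *\<^sub>C 1) = 0"
    using one_N by (simp add: clinear_diff[OF clinear_Q] clinear_scale[OF clinear_Q] Q_one
        Q_11_coinvariant[OF b] scaleC_complex_def)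
  then have "cls' b = (\<Sum>p\<in>F. \<phi> p (b - epsG b *\<^sub>C 1) *\<^sub>C e p)"
    unfolding cls'_def by (intro cls_expand[OF q1] minus_eps)
  also have "\<dots> = (\<Sum>p\<in>F. \<phi> p b *\<^sub>C e p)"
  proof (intro sum.cong refl)
    fix p assume p: "p \<in> F"
    have "\<phi> p 1 = 0"
      using p one_N by (auto simp: \<phi>_def P_plus_def P_minus_def Q_one)
    then show "\<phi> p (b - epsG b *\<^sub>C 1) *\<^sub>C e p = \<phi> p b *\<^sub>C e p"
      using F_IJ[OF p] by (simp add: clinear_diff[OF clinear_\<phi>] clinear_scale[OF clinear_\<phi>] scaleC_complex_def)
  qed
  finally show ?thesis .
qed

lemma fdm_coefficients:
  assumes m: "m \<in> M"
  obtains g where "left_mult f (d m) = (\<Sum>p\<in>F. g p \<otimes> e p)"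
proof -
  obtain I b where I: "finite I" "copG m = (\<Sum>a\<in>I. a \<otimes> b a)" "\<And>a. a \<in> I \<Longrightarrow> b a \<in> M"
    using M_components[OF m] by blast
  have "left_mult f (d m) = (\<Sum>a\<in>I. (f * a) \<otimes> cls' (b a))"
    by (simp add: d_eq I(2) clinear_sum[OF clinear_tlift[OF bilinear_d]] tlift_tensor[OF bilinear_d]
        clinear_sum[OF left_mult_linear] left_mult_tensor)
  also have "\<dots> = (\<Sum>a\<in>I. \<Sum>p\<in>F. (\<phi> p (b a) *\<^sub>C (f * a)) \<otimes> e p)"
    using I(3) by (simp add: cls'_expand tensor_sum_right tensor_scaleC_left tensor_scaleC_right)
  also have "\<dots> = (\<Sum>p\<in>F. (\<Sum>a\<in>I. \<phi> p (b a) *\<^sub>C (f * a)) \<otimes> e p)"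
    by (subst sum.swap) (simp add: tensor_sum_left)
  finally show thesis by (rule that)
qed

text \<open>No \<open>\<beta>\<close> connects the two blocks, so truncating \<open>g\<close> to A
  leaves the equation at t unchanged for t in A and empties it otherwise.\<close>

lemma coact_restrict:
  assumes A: "A = P_plus \<or> A = P_minus" and g: "\<forall>t\<in>F. coact g t = g t \<otimes> 1" and t: "t \<in> F"
  shows "coact (\<lambda>p. if p \<in> A then g p else 0) t = (if t \<in> A then g t else 0) \<otimes> 1"
proof -
  have \<beta>: "\<beta> p t = 0" if "p \<in> F" "(p \<in> A) \<noteq> (t \<in> A)" for p
    using that A t P_disjoint F_IJ[OF t] by (intro \<beta>_eq_0) auto
  show ?thesis
  proof (cases "t \<in> A")
    case True
    then have "coact (\<lambda>p. if p \<in> A then g p else 0) t = coact g t"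
      unfolding coact_def using \<beta> by (intro sum.cong refl) auto
    then show ?thesis using True g t by simp
  next
    case False
    then have "coact (\<lambda>p. if p \<in> A then g p else 0) t = 0"
      unfolding coact_def using \<beta> by (intro sum.neutral) (auto simp: clinear_0[OF \<rho>_linear])
    then show ?thesis using False by simp
  qed
qed

lemma fdm_decompose:
  assumes f: "f \<in> M" and m: "m \<in> M"
  shows "\<exists>a b. left_mult f (d m) = a + b \<and> a \<in> coinvariant_forms copG \<alpha> \<delta> (V_plus N u cls)
    \<and> b \<in> coinvariant_forms copG \<alpha> \<delta> (V_minus N u cls)"
proof -
  obtain g where g: "left_mult f (d m) = (\<Sum>p\<in>F. g p \<otimes> e p)"
    using fdm_coefficients[OF m] by blast
  then have coact: "\<forall>t\<in>F. coact g t = g t \<otimes> 1"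
    using TC_fdm[OF f m] by (simp only: coact_eq_iff)
  have part: "(\<Sum>p\<in>A. g p \<otimes> e p) \<in> coinvariant_forms copG \<alpha> \<delta> (cspan (e ` A))"
    if A: "A = P_plus \<or> A = P_minus" for A
  proof -
    let ?g = "\<lambda>p. if p \<in> A then g p else 0"
    have eq: "(\<Sum>p\<in>F. ?g p \<otimes> e p) = (\<Sum>p\<in>A. g p \<otimes> e p)" using A by (intro sum_restrict_F) auto
    have "TC (\<Sum>p\<in>F. ?g p \<otimes> e p) = (\<Sum>p\<in>F. ?g p \<otimes> e p) \<otimes> 1"
      unfolding coact_eq_iff using coact_restrict[OF A coact] by blast
    then show ?thesis
      using A finite_P unfolding eq by (auto simp: coinvariant_forms_def tensor_space_span)
  qed
  have "left_mult f (d m) = (\<Sum>p\<in>P_plus. g p \<otimes> e p) + (\<Sum>p\<in>P_minus. g p \<otimes> e p)"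
    using g finite_P P_disjoint by (simp add: sum.union_disjoint)
  then show ?thesis
    using part[of P_plus] part[of P_minus] by (auto simp: V_plus_eq[OF q1] V_minus_eq[OF q1])
qed

text \<open>In the coproduct of \<open>z l\<close> the second legs are the \<open>z t\<close>, and
  \<open>cls'\<close> kills those with t outside F. This includes \<open>z (1, 1)\<close>, whose
  Q-matrix is diagonal.\<close>

lemma d_z:
  assumes l: "l \<in> IJ"
  shows "d (z l) = (\<Sum>p\<in>F. y l p \<otimes> e p)"
proof -
  have cz: "cls' (z t) = (if t \<in> F then e t else 0)" if t: "t \<in> IJ" for t
  proof -
    have "cls' (z t) = (\<Sum>p\<in>F. if p = t then e p else 0)"
      unfolding cls'_expand[OF z_in_M[OF t]]
      using t by (intro sum.cong refl) (simp add: \<phi>_z[OF q1] scaleC_one)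
    then show ?thesis using finite_F by simp
  qed
  have "d (z l) = (\<Sum>t\<in>IJ. y l t \<otimes> cls' (z t))"
    using l one_N by (simp add: d_eq cop_y[of l "(1, 1)"] mem_Times_iff
        clinear_sum[OF clinear_tlift[OF bilinear_d]] tlift_tensor[OF bilinear_d])
  also have "\<dots> = (\<Sum>p\<in>F. y l p \<otimes> e p)"
    using F_IJ cz by (intro sum.mono_neutral_cong_right) auto
  finally show ?thesis .
qed

text \<open>A coinvariant combination \<open>\<Sum> g\<^sub>p \<otimes> e\<^sub>p\<close> equals \<open>\<Sum> f\<^sub>l dz\<^sub>l\<close> with the coinvariants
  \<open>f\<^sub>l = \<Sum> g\<^sub>p S(y\<^sub>p\<^sub>l)\<close>, because \<open>dz\<^sub>l = \<Sum> y\<^sub>l\<^sub>p \<otimes> e\<^sub>p\<close>.\<close>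

lemma coinvariant_in_Omega:
  assumes t: "t = (\<Sum>p\<in>F. g p \<otimes> e p)" and TC: "TC t = t \<otimes> 1"
  shows "t \<in> Omega_CP copG epsG \<alpha> cls"
proof -
  have coact: "coact g t = g t \<otimes> 1" if "t \<in> F" for t
    using TC that unfolding t coact_eq_iff by blast
  define w where "w p l = antG (y p l)" for p l
  define f where "f l = (\<Sum>p\<in>F. g p * w p l)" for l
  have f: "f l \<in> M" if l: "l \<in> IJ" for l
  proof -
    \<comment> \<open>With \<open>1 \<otimes> \<beta> p t\<close> written on the left, it meets
      \<open>\<rho> (g p)\<close> in the product; summing over p gives \<open>coact g t\<close>,
      which coinvariance replaces by \<open>g t \<otimes> 1\<close>.\<close>
    have \<rho>w: "\<rho> (w p l) = (\<Sum>t\<in>F. (1 \<otimes> \<beta> p t) * (w t l \<otimes> 1))" if p: "p \<in> F" for p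
    proof -
      have "copG (w p l) = (\<Sum>t\<in>IJ. w t l \<otimes> w p t)"
        unfolding w_def using F_IJ[OF p] l
        by (intro G.cop_ant_matrix cop_y eps_y) auto
      then have "\<rho> (w p l) = (\<Sum>t\<in>IJ. w t l \<otimes> \<beta> p t)"
        by (simp add: \<rho>_def clinear_sum[OF clinear_tmap[OF clinear_id H.hom_linear clinear_ident]]
            tmap_tensor[OF clinear_id H.hom_linear] \<beta>_def w_def)
      also have "\<dots> = (\<Sum>t\<in>F. w t l \<otimes> \<beta> p t)"
        using F_subset p \<beta>_eq_0[of p] by (intro sum.mono_neutral_right) auto
      finally show ?thesis by (simp add: tensor_mult)
    qed
    have "\<rho> (f l) = (\<Sum>p\<in>F. \<Sum>t\<in>F. \<rho> (g p) * (1 \<otimes> \<beta> p t) * (w t l \<otimes> 1))"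
      by (simp add: f_def clinear_sum[OF \<rho>_linear] \<rho>_mult \<rho>w sum_distrib_left mult.assoc)
    also have "\<dots> = (\<Sum>t\<in>F. coact g t * (w t l \<otimes> 1))"
      by (subst sum.swap) (simp add: coact_def sum_distrib_right)
    also have "\<dots> = f l \<otimes> 1"
      by (simp add: coact tensor_mult f_def tensor_sum_left)
    finally show ?thesis by (simp add: M_iff)
  qed
  \<comment> \<open>The sum runs over all of \<open>IJ\<close> because the antipode inverts only the
    full matrix y, even though p and t stay in F.\<close>
  have wy: "(\<Sum>l\<in>IJ. w p l * y l t) = of_bool (p = t)" if "p \<in> F" "t \<in> F" for p t
    unfolding w_def using that F_IJ by (intro G.ant_matrix_left cop_y eps_y) auto
  have fy: "(\<Sum>l\<in>IJ. f l * y l t) = g t" if t: "t \<in> F" for t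
  proof -
    have "(\<Sum>l\<in>IJ. f l * y l t) = (\<Sum>p\<in>F. g p * (\<Sum>l\<in>IJ. w p l * y l t))"
      unfolding f_def sum_distrib_left sum_distrib_right by (subst sum.swap) (simp add: mult.assoc)
    also have "\<dots> = (\<Sum>p\<in>F. if p = t then g p else 0)"
      using t by (intro sum.cong refl) (simp add: wy)
    finally show ?thesis using t finite_F by simp
  qed
  have "(\<Sum>l\<in>IJ. left_mult (f l) (d (z l))) = (\<Sum>l\<in>IJ. \<Sum>p\<in>F. (f l * y l p) \<otimes> e p)"
    by (intro sum.cong refl) (simp add: d_z clinear_sum[OF left_mult_linear] left_mult_tensor)
  also have "\<dots> = (\<Sum>p\<in>F. (\<Sum>l\<in>IJ. f l * y l p) \<otimes> e p)"
    by (subst sum.swap) (simp add: tensor_sum_left)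
  also have "\<dots> = t"
    by (simp add: t fy)
  finally have "t = (\<Sum>l\<in>IJ. left_mult (f l) (d (z l)))" ..
  moreover have "left_mult (f l) (d (z l)) \<in> Omega_CP copG epsG \<alpha> cls" if "l \<in> IJ" for l
    unfolding Omega_CP_def using f z_in_M that by (intro cvec.span_base) blast
  ultimately show ?thesis
    by (simp only: Omega_CP_def) (intro cvec.span_sum)
qed

lemma decomposition_quantum:
  "is_direct_sum (Omega_CP copG epsG \<alpha> cls)
    (coinvariant_forms copG \<alpha> \<delta> (V_plus N u cls)) (coinvariant_forms copG \<alpha> \<delta> (V_minus N u cls))"
  (is "is_direct_sum ?W ?A ?B")
proof -
  have form: "\<exists>g. t = (\<Sum>p\<in>F. (if p \<in> A then g p else 0) \<otimes> e p) \<and> TC t = t \<otimes> 1"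
    if "t \<in> coinvariant_forms copG \<alpha> \<delta> (cspan (e ` A))" "A \<subseteq> F" for t A
  proof -
    have fin: "finite A" using that(2) finite_F by (rule finite_subset)
    have t: "t \<in> tensor_space UNIV (cspan (e ` A))" "TC t = t \<otimes> 1"
      using that(1) by (simp_all add: coinvariant_forms_def)
    obtain g where "t = (\<Sum>p\<in>A. g p \<otimes> e p)"
      using t(1) unfolding tensor_space_span[OF fin] by (rule imageE)
    with t(2) show ?thesis
      using sum_restrict_F[OF that(2), of g] by (intro exI[of _ g]) simp
  qed
  have sub: "csubspace {a + b | a b. a \<in> ?A \<and> b \<in> ?B}"
    using cvec.subspace_sums[OF subspace_coinvariant_forms subspace_coinvariant_forms] .
  have W1: "?W \<subseteq> {a + b | a b. a \<in> ?A \<and> b \<in> ?B}"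
    unfolding Omega_CP_def
  proof (rule cvec.span_minimal[OF _ sub], clarify)
    fix f g assume "f \<in> M" "g \<in> M"
    then show "\<exists>a b. left_mult f (d g) = a + b \<and> a \<in> ?A \<and> b \<in> ?B" by (rule fdm_decompose)
  qed
  have in_W: "t \<in> ?W" if "t \<in> coinvariant_forms copG \<alpha> \<delta> (cspan (e ` A))" "A \<subseteq> F" for t A
  proof -
    from form[OF that] show ?thesis by (elim exE conjE) (rule coinvariant_in_Omega)
  qed
  have "?A \<subseteq> ?W"
    unfolding V_plus_eq[OF q1] by (rule subsetI, erule in_W) simp
  moreover have "?B \<subseteq> ?W"
    unfolding V_minus_eq[OF q1] by (rule subsetI, erule in_W) simp
  moreover have "a + b \<in> ?W" if "a \<in> ?W" "b \<in> ?W" for a b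
    using that unfolding Omega_CP_def by (rule cvec.span_add)
  ultimately have W2: "{a + b | a b. a \<in> ?A \<and> b \<in> ?B} \<subseteq> ?W"
    by blast
  have "t = 0" if t: "t \<in> ?A" "t \<in> ?B" for t
  proof -
    obtain g where g: "t = (\<Sum>p\<in>F. (if p \<in> P_plus then g p else 0) \<otimes> e p)"
      using form[OF t(1)[unfolded V_plus_eq[OF q1]]] by blast
    obtain h where h: "t = (\<Sum>p\<in>F. (if p \<in> P_minus then h p else 0) \<otimes> e p)"
      using form[OF t(2)[unfolded V_minus_eq[OF q1]]] by blast
    have "(if p \<in> P_plus then g p else 0) = 0" if p: "p \<in> F" for p
    proof -
      obtain \<epsilon> :: "'l \<Rightarrow> complex" where \<epsilon>: "\<And>g. tlift (\<lambda>(h::'a) x. \<epsilon> x *\<^sub>C h) (\<Sum>p\<in>F. g p \<otimes> e p) = g p"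
        using coefficient_extraction[OF p] by metis
      have "(if p \<in> P_plus then g p else 0) = (if p \<in> P_minus then h p else 0)"
        using \<epsilon>[of "\<lambda>p. if p \<in> P_plus then g p else 0"] \<epsilon>[of "\<lambda>p. if p \<in> P_minus then h p else 0"] g h
        by simp
      then show ?thesis using P_disjoint by (auto split: if_splits)
    qed
    then have "(\<Sum>p\<in>F. (if p \<in> P_plus then g p else 0) \<otimes> e p) = 0"
      by (intro sum.neutral ballI) simp
    then show ?thesis using g by simp
  qed
  moreover have "0 \<in> ?A" "0 \<in> ?B"
    using cvec.subspace_0[OF subspace_coinvariant_forms] by blast+
  ultimately have "?A \<inter> ?B = {0}" by blast
  then show ?thesis
    unfolding is_direct_sum_def using subspace_coinvariant_forms W1 W2 by blast
qed

end

text \<open>For \<open>q = 1\<close> all spaces vanish, whatever root of unity \<open>q_root\<close> is.\<close>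

lemma decomposition_classical:
  assumes q1: "q = 1"
  shows "is_direct_sum (Omega_CP copG epsG \<alpha> cls)
    (coinvariant_forms copG \<alpha> \<delta> (V_plus N u cls)) (coinvariant_forms copG \<alpha> \<delta> (V_minus N u cls))"
proof -
  have "cls (u i j) = 0" if "i \<in> {1..N}" "j \<in> {1..N}" "i \<noteq> j" for i j
    using that q1 by (intro cls_ker_Q) (auto simp: augmentation_ideal_def eps_u Q_u_offdiag)
  then have "{cls (u i 1) | i. i \<in> {2..N}} \<subseteq> {0}" "{cls (u 1 i) | i. i \<in> {2..N}} \<subseteq> {0}"
    by auto
  then have V: "V_plus N u cls = {0}" "V_minus N u cls = {0}"
    unfolding V_plus_def V_minus_def
    using cvec.span_minimal[OF _ cvec.subspace_single_0] cvec.span_zero by blast+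
  have "tensor_space UNIV {0} = ({0} :: ('a, 'l) tensor set)"
  proof
    show "tensor_space UNIV {0} \<subseteq> ({0} :: ('a, 'l) tensor set)"
      unfolding tensor_space_def by (rule cvec.span_minimal[OF _ cvec.subspace_single_0]) auto
  qed (simp add: tensor_space_def cvec.span_zero)
  then have forms: "coinvariant_forms copG \<alpha> \<delta> {0} = {0}"
    using cvec.subspace_0[OF subspace_coinvariant_forms] by (auto simp: coinvariant_forms_def)
  have "left_mult f (d m) = 0" if m: "m \<in> M" for f m
  proof -
    obtain I b where I: "finite I" "copG m = (\<Sum>a\<in>I. a \<otimes> b a)" "\<And>a. a \<in> I \<Longrightarrow> b a \<in> M"
      using M_components[OF m] by blast
    have "cls' a = 0" if a: "a \<in> M" for a
      unfolding cls'_def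
    proof (rule cls_ker_Q[OF minus_eps])
      have "Q 1 1 (a - epsG a *\<^sub>C 1) = 0"
        using one_N by (simp add: clinear_diff[OF clinear_Q] clinear_scale[OF clinear_Q] Q_one
            Q_11_coinvariant[OF a] scaleC_complex_def)
      then show "Q k l (a - epsG a *\<^sub>C 1) = 0" if "k \<in> {1..N}" "l \<in> {1..N}" for k l
        using Q_classical[OF q1 that] by simp
    qed
    then have "d m = 0"
      using I by (simp add: d_eq clinear_sum[OF clinear_tlift[OF bilinear_d]] tlift_tensor[OF bilinear_d])
    then show ?thesis by (simp add: clinear_0[OF left_mult_linear])
  qed
  then have "{left_mult f (d g) | f g. f \<in> M \<and> g \<in> M} \<subseteq> {0}" by auto
  then have "Omega_CP copG epsG \<alpha> cls = {0}"
    unfolding Omega_CP_def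
    using cvec.span_minimal[OF _ cvec.subspace_single_0] cvec.span_zero by blast
  then show ?thesis
    by (simp add: V forms is_direct_sum_def cvec.subspace_single_0)
qed

end

theorem proposition7p1:
  fixes N :: nat and q :: real and q_root :: complex
    and uG :: "nat \<Rightarrow> nat \<Rightarrow> 'g::complex_algebra_1"
    and copG :: "'g \<Rightarrow> ('g, 'g) tensor" and epsG :: "'g \<Rightarrow> complex" and antG :: "'g \<Rightarrow> 'g"
    and uU :: "nat \<Rightarrow> nat \<Rightarrow> 'k::complex_algebra_1" and det_inv :: 'k
    and copU :: "'k \<Rightarrow> ('k, 'k) tensor" and epsU :: "'k \<Rightarrow> complex" and antU :: "'k \<Rightarrow> 'k"
    and \<alpha> :: "'g \<Rightarrow> 'k"
    and r :: "'g \<Rightarrow> 'g \<Rightarrow> complex"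
    and cls :: "'g \<Rightarrow> 'l::complex_vector"
    and \<delta> :: "'l \<Rightarrow> ('l, 'k) tensor"
  assumes N: "N \<ge> 2" and q: "0 < q" "q \<le> 1" and q_root: "q_root ^ N = of_real q"
    \<comment> \<open>\<open>G = \<C>\<^sub>q[SU\<^sub>N]\<close>\<close>
    and SU: "presents_SU q N uG" "hopf_algebra copG epsG antG" "matrix_coalgebra N uG copG epsG"
    \<comment> \<open>\<open>\<C>\<^sub>q[U\<^sub>N\<^sub>-\<^sub>1]\<close>\<close>
    and U: "presents_U q (N - 1) uU det_inv" "hopf_algebra copU epsU antU"
      "matrix_coalgebra (N - 1) uU copU epsU"
    and \<alpha>_hom: "hopf_algebra_hom copG epsG antG copU epsU antU \<alpha>"
    and \<alpha>_11: "\<alpha> (uG 1 1) = det_inv"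
    and \<alpha>_1i: "\<And>i. i \<in> {2..N} \<Longrightarrow> \<alpha> (uG 1 i) = 0 \<and> \<alpha> (uG i 1) = 0"
    and \<alpha>_ij: "\<And>i j. i \<in> {2..N} \<Longrightarrow> j \<in> {2..N} \<Longrightarrow> \<alpha> (uG i j) = uU (i - 1) (j - 1)"
    and r: "coquasi_triangular copG epsG antG r"
    and r_gen: "\<And>i j k l. i \<in> {1..N} \<Longrightarrow> j \<in> {1..N} \<Longrightarrow> k \<in> {1..N} \<Longrightarrow> l \<in> {1..N} \<Longrightarrow>
      r (uG i j) (uG k l) = inverse q_root * rmat q k i j l"
    \<comment> \<open>\<open>\<Lambda>\<^sup>1 = G\<^sup>+ / I\<close>\<close>
    and cls: "is_quotient_map (augmentation_ideal epsG) (ideal_SU N uG copG epsG antG r) cls"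
    and \<delta>: "is_V_coaction copG epsG antU \<alpha> cls \<delta>"
  shows "is_direct_sum (Omega_CP copG epsG \<alpha> cls)
    (coinvariant_forms copG \<alpha> \<delta> (V_plus N uG cls))
    (coinvariant_forms copG \<alpha> \<delta> (V_minus N uG cls))"
proof -
  interpret G: coquasi_triangular copG epsG antG r by (rule r)
  interpret H: hopf_algebra_hom copG epsG antG copU epsU antU \<alpha> by (rule \<alpha>_hom)
  interpret quantum_projective_calculus copG epsG antG r copU epsU antU \<alpha> N q q_root uG uU det_inv cls \<delta>
    by unfold_locales (use assms in auto)
  show ?thesis
    using decomposition_quantum decomposition_classical by blast
qed

end
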